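(* Let $X$ be a finite $T_0$ topological space and let $F:X\multimap X$ be a multivalued map. Suppose that $F=G_n\circ\cdots\circ G_0$, where $G_i:Y_i\multimap Y_{i+1}$ for $i=0,\dots,n$, $Y_0=Y_{n+1}=X$, each $Y_i$ is a finite $T_0$ topological space and each $G_i$ is a Vietoris-like multivalued map. If $\Lambda(G_{n*}\circ\cdots\circ G_{0*})\neq 0$, then there exists a point $x\in X$ such that $x\in F(x)$.
   Context: A finite $T_0$ topological space is identified with a finite poset: $x\le y$ iff $U_x\subseteq U_y$, where $U_x$ is the intersection of all open sets containing $x$ (so the open sets are the lower sets); continuous maps are exactly the order-preserving maps. $H_*$ is singular homology with integer coefficients. A space is acyclic if its homology groups are isomorphic to those of a point. A continuous map $f:X\to Y$ between finite $T_0$ spaces is a Vietoris-like map if for every chain $y_1<\dots<y_n$ in $Y$ ($n\ge1$) the subspace $\bigcup_{i=1}^n f^{-1}(y_i)$ of $X$ is acyclic; such a map induces isomorphisms in all homology groups. A multivalued map $F:X\multimap Y$ assigns to each $x\in X$ a subset $F(x)\subseteq Y$ (no continuity is required). Its graph is $\Gamma(F)=\{(x,y)\in X\times Y : y\in F(x)\}$, a finite $T_0$ space with the order induced by the product order ($(x,y)\le(x',y')$ iff $x\le x'$ and $y\le y'$); $p:\Gamma(F)\to X$ and $q:\Gamma(F)\to Y$ are the projections. $F$ is a Vietoris-like multivalued map if $p$ is a Vietoris-like map; then $F_*:=q_*\circ p_*^{-1}:H_*(X)\to H_*(Y)$. The composition of $F:X\multimap Y$ and $G:Y\multimap Z$ is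 $(G\circ F)(x)=\bigcup_{y\in F(x)}G(y)$. For a degree-preserving endomorphism $\varphi$ of $H_*(X)$, $\Lambda(\varphi)=\sum_{i\ge0}(-1)^i\,\mathrm{tr}(\varphi_i)$, the trace being taken on the torsion-free part of $H_i(X)$. *)

theory Defs
  imports "HOL-Analysis.Analysis" "HOL-Homology.Homology"
begin

section \<open>Finite \<open>T\<^sub>0\<close> spaces as posets\<close>

definition minimal_open :: "'a topology \<Rightarrow> 'a \<Rightarrow> 'a set"
  where "minimal_open X x = \<Inter>{U. openin X U \<and> x \<in> U}"

definition spec_le :: "'a topology \<Rightarrow> 'a \<Rightarrow> 'a \<Rightarrow> bool"
  where "spec_le X x y \<longleftrightarrow>
    x \<in> topspace X \<and> y \<in> topspace X \<and> minimal_open X x \<subseteq> minimal_open X y"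

definition spec_less :: "'a topology \<Rightarrow> 'a \<Rightarrow> 'a \<Rightarrow> bool"
  where "spec_less X x y \<longleftrightarrow> spec_le X x y \<and> x \<noteq> y"


section \<open>Vietoris-like maps\<close>

definition acyclic_space :: "'a topology \<Rightarrow> bool"
  where "acyclic_space X \<longleftrightarrow>
    (\<forall>p. homology_group p X \<cong> homology_group p (discrete_topology {()}))"

text \<open>A finite nonempty chain \<open>y\<^sub>1 < \<dots> < y\<^sub>n\<close> is given as a list.\<close>

definition vietoris_like_map :: "'a topology \<Rightarrow> 'b topology \<Rightarrow> ('a \<Rightarrow> 'b) \<Rightarrow> bool"
  where "vietoris_like_map X Y f \<longleftrightarrow>
    continuous_map X Y f \<and>
    (\<forall>ys. ys \<noteq> [] \<and> set ys \<subseteq> topspace Y \<and> sorted_wrt (spec_less Y) ys \<longrightarrow>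
      acyclic_space (subtopology X (\<Union>y\<in>set ys. {x \<in> topspace X. f x = y})))"


section \<open>Multivalued maps\<close>

text \<open>Only the values at points of the domain \<^term>\<open>topspace X\<close> are relevant.\<close>

definition multivalued_map :: "'a topology \<Rightarrow> 'b topology \<Rightarrow> ('a \<Rightarrow> 'b set) \<Rightarrow> bool"
  where "multivalued_map X Y F \<longleftrightarrow> (\<forall>x\<in>topspace X. F x \<subseteq> topspace Y)"

definition multi_graph :: "'a topology \<Rightarrow> 'b topology \<Rightarrow> ('a \<Rightarrow> 'b set) \<Rightarrow> ('a \<times> 'b) set"
  where "multi_graph X Y F = {(x, y). x \<in> topspace X \<and> y \<in> topspace Y \<and> y \<in> F x}"

text \<open>For finite \<open>X\<close> and \<open>Y\<close> the subspace topology of the product is the one belonging to the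
  restricted product order, see \<open>spec_le_graph_space\<close> and \<open>openin_iff_lower_set\<close> below.\<close>

definition graph_space :: "'a topology \<Rightarrow> 'b topology \<Rightarrow> ('a \<Rightarrow> 'b set) \<Rightarrow> ('a \<times> 'b) topology"
  where "graph_space X Y F = subtopology (prod_topology X Y) (multi_graph X Y F)"

definition vietoris_like_multimap :: "'a topology \<Rightarrow> 'b topology \<Rightarrow> ('a \<Rightarrow> 'b set) \<Rightarrow> bool"
  where "vietoris_like_multimap X Y F \<longleftrightarrow>
    multivalued_map X Y F \<and> vietoris_like_map (graph_space X Y F) X fst"

text \<open>The map \<open>q\<^sub>* \<circ> p\<^sub>*\<inverse>\<close> in degree \<open>k\<close>; it is meaningful on the carrier of
  \<^term>\<open>homology_group k X\<close> when \<open>p\<^sub>*\<close> is bijective.\<close>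

definition multi_induced ::
    "int \<Rightarrow> 'a topology \<Rightarrow> 'b topology \<Rightarrow> ('a \<Rightarrow> 'b set) \<Rightarrow> 'a chain set \<Rightarrow> 'b chain set"
  where "multi_induced k X Y F =
    hom_induced k (graph_space X Y F) {} Y {} snd \<circ>
    inv_into (carrier (homology_group k (graph_space X Y F)))
      (hom_induced k (graph_space X Y F) {} X {} fst)"

definition multi_comp :: "('b \<Rightarrow> 'c set) \<Rightarrow> ('a \<Rightarrow> 'b set) \<Rightarrow> 'a \<Rightarrow> 'c set"
  where "multi_comp G F x = (\<Union>y\<in>F x. G y)"

text \<open>\<open>G n \<circ> \<dots> \<circ> G 0\<close>, and the corresponding composite of induced maps on \<open>H\<^sub>k\<close>.\<close>

primrec multi_comp_upto :: "(nat \<Rightarrow> 'a \<Rightarrow> 'a set) \<Rightarrow> nat \<Rightarrow> 'a \<Rightarrow> 'a set"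
  where
    "multi_comp_upto G 0 = G 0"
  | "multi_comp_upto G (Suc n) = multi_comp (G (Suc n)) (multi_comp_upto G n)"

primrec multi_induced_upto ::
    "(nat \<Rightarrow> 'a topology) \<Rightarrow> (nat \<Rightarrow> 'a \<Rightarrow> 'a set) \<Rightarrow> nat \<Rightarrow> int \<Rightarrow> 'a chain set \<Rightarrow> 'a chain set"
  where
    "multi_induced_upto Y G 0 k = multi_induced k (Y 0) (Y (Suc 0)) (G 0)"
  | "multi_induced_upto Y G (Suc n) k =
      multi_induced k (Y (Suc n)) (Y (Suc (Suc n))) (G (Suc n)) \<circ> multi_induced_upto Y G n k"


section \<open>Traces and the Lefschetz number\<close>

definition torsion_part :: "('a, 'm) monoid_scheme \<Rightarrow> 'a set"
  where "torsion_part A = {x \<in> carrier A. \<exists>m::nat. m > 0 \<and> x [^]\<^bsub>A\<^esub> m = \<one>\<^bsub>A\<^esub>}"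

text \<open>The trace of an endomorphism of a free abelian group of finite rank, computed in some
  basis; a basis is an isomorphism with \<open>\<int>\<^sup>n\<close>, and the trace does not depend on it.\<close>

definition free_trace :: "('a, 'm) monoid_scheme \<Rightarrow> ('a \<Rightarrow> 'a) \<Rightarrow> int"
  where "free_trace A \<psi> =
    (let (n, h) = (SOME (n, h). h \<in> iso A (free_Abelian_group {..<n::nat}))
     in \<Sum>i<n. Poly_Mapping.lookup (h (\<psi> (inv_into (carrier A) h (frag_of i)))) i)"

text \<open>For a homomorphism \<open>\<phi>\<close> and a coset \<open>C = x + T\<close> of the torsion subgroup \<open>T\<close>, the set
  \<open>T + \<phi>(C)\<close> is the coset of \<open>\<phi>(x)\<close>, so the map passed to \<^const>\<open>free_trace\<close> is the one that
  \<open>\<phi>\<close> induces on the quotient by \<open>T\<close>.\<close>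

definition torsion_free_trace :: "('a, 'm) monoid_scheme \<Rightarrow> ('a \<Rightarrow> 'a) \<Rightarrow> int"
  where "torsion_free_trace A \<phi> =
    free_trace (A Mod torsion_part A) (\<lambda>C. torsion_part A <#>\<^bsub>A\<^esub> (\<phi> ` C))"

text \<open>For a finite space only finitely many homology groups are nonzero, so \<^const>\<open>Sum_any\<close>,
  the sum of a function of finite support, is the sum over all degrees.\<close>

definition lefschetz_number ::
    "'a topology \<Rightarrow> (int \<Rightarrow> 'a chain set \<Rightarrow> 'a chain set) \<Rightarrow> int"
  where "lefschetz_number X \<phi> =
    Sum_any (\<lambda>i::nat. (-1) ^ i * torsion_free_trace (homology_group (int i) X) (\<phi> (int i)))"


section \<open>The order and the topology of the graph\<close>

lemma openin_minimal_open:
  assumes "finite (topspace X)" "x \<in> topspace X"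
  shows "openin X (minimal_open X x)"
proof -
  have "finite {U. openin X U \<and> x \<in> U}"
    by (rule finite_subset[of _ "Pow (topspace X)"]) (use assms openin_subset in auto)
  moreover have "{U. openin X U \<and> x \<in> U} \<noteq> {}"
    using assms(2) by blast
  ultimately show ?thesis
    unfolding minimal_open_def by (intro openin_Inter) auto
qed

lemma spec_le_iff_mem:
  assumes "finite (topspace X)" "x \<in> topspace X" "y \<in> topspace X"
  shows "spec_le X x y \<longleftrightarrow> x \<in> minimal_open X y"
proof
  assume "x \<in> minimal_open X y"
  then have "minimal_open X x \<subseteq> minimal_open X y"
    using openin_minimal_open[OF assms(1,3)] by (auto simp: minimal_open_def)
  then show "spec_le X x y" using assms by (simp add: spec_le_def)
qed (auto simp: spec_le_def minimal_open_def)

lemma spec_le_iff: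
  assumes "finite (topspace X)" "x \<in> topspace X" "y \<in> topspace X"
  shows "spec_le X x y \<longleftrightarrow> (\<forall>U. openin X U \<and> y \<in> U \<longrightarrow> x \<in> U)"
  using spec_le_iff_mem[OF assms] by (auto simp: minimal_open_def)

lemma openin_iff_lower_set:
  assumes "finite (topspace X)"
  shows "openin X U \<longleftrightarrow> U \<subseteq> topspace X \<and> (\<forall>x y. y \<in> U \<and> spec_le X x y \<longrightarrow> x \<in> U)"
proof
  assume U: "openin X U"
  then have "x \<in> U" if "y \<in> U" "spec_le X x y" for x y
    using that spec_le_iff[OF assms] by (auto simp: spec_le_def)
  then show "U \<subseteq> topspace X \<and> (\<forall>x y. y \<in> U \<and> spec_le X x y \<longrightarrow> x \<in> U)"
    using openin_subset[OF U] by blast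
next
  assume U: "U \<subseteq> topspace X \<and> (\<forall>x y. y \<in> U \<and> spec_le X x y \<longrightarrow> x \<in> U)"
  have "openin X (minimal_open X y) \<and> y \<in> minimal_open X y \<and> minimal_open X y \<subseteq> U"
    if "y \<in> U" for y
  proof (intro conjI subsetI)
    show o: "openin X (minimal_open X y)" using U that openin_minimal_open[OF assms] by blast
    show "y \<in> minimal_open X y" by (simp add: minimal_open_def)
    fix x assume x: "x \<in> minimal_open X y"
    then have "x \<in> topspace X" using openin_subset[OF o] by blast
    then show "x \<in> U" using U that x spec_le_iff_mem[OF assms] by blast
  qed
  then show "openin X U" by (subst openin_subopen) blast
qed

lemma topspace_graph_space: "topspace (graph_space X Y F) = multi_graph X Y F"
  by (auto simp: graph_space_def multi_graph_def)

lemma spec_le_graph_space: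
  assumes "finite (topspace X)" "finite (topspace Y)"
  shows "spec_le (graph_space X Y F) (x, y) (x', y') \<longleftrightarrow>
    (x, y) \<in> multi_graph X Y F \<and> (x', y') \<in> multi_graph X Y F \<and>
    spec_le X x x' \<and> spec_le Y y y'"
proof (cases "(x, y) \<in> multi_graph X Y F \<and> (x', y') \<in> multi_graph X Y F")
  case True
  then have mem: "x \<in> topspace X" "x' \<in> topspace X" "y \<in> topspace Y" "y' \<in> topspace Y"
    by (auto simp: multi_graph_def)
  have fin: "finite (topspace (graph_space X Y F))"
    by (rule finite_subset[of _ "topspace X \<times> topspace Y"])
      (use assms in \<open>auto simp: topspace_graph_space multi_graph_def\<close>)
  have "spec_le (graph_space X Y F) (x, y) (x', y') \<longleftrightarrow>
      (\<forall>W. openin (prod_topology X Y) W \<and> (x', y') \<in> W \<longrightarrow> (x, y) \<in> W)"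
    using True by (subst spec_le_iff[OF fin])
      (auto simp: topspace_graph_space graph_space_def openin_subtopology multi_graph_def)
  also have "\<dots> \<longleftrightarrow> spec_le X x x' \<and> spec_le Y y y'"
  proof
    assume *: "\<forall>W. openin (prod_topology X Y) W \<and> (x', y') \<in> W \<longrightarrow> (x, y) \<in> W"
    have "(x, y) \<in> minimal_open X x' \<times> minimal_open Y y'"
      using openin_minimal_open[OF assms(1) mem(2)] openin_minimal_open[OF assms(2) mem(4)]
      by (intro *[rule_format]) (auto simp: openin_prod_Times_iff minimal_open_def)
    then show "spec_le X x x' \<and> spec_le Y y y'"
      using mem assms by (simp add: spec_le_iff_mem)
  next
    assume *: "spec_le X x x' \<and> spec_le Y y y'"
    show "\<forall>W. openin (prod_topology X Y) W \<and> (x', y') \<in> W \<longrightarrow> (x, y) \<in> W"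
    proof (intro allI impI)
      fix W assume "openin (prod_topology X Y) W \<and> (x', y') \<in> W"
      then obtain U V where UV: "openin X U" "openin Y V" "x' \<in> U" "y' \<in> V" "U \<times> V \<subseteq> W"
        unfolding openin_prod_topology_alt by blast
      then show "(x, y) \<in> W"
        using * spec_le_iff[OF assms(1) mem(1,2)] spec_le_iff[OF assms(2) mem(3,4)] by blast
    qed
  qed
  finally show ?thesis using True by simp
next
  case False
  then show ?thesis by (auto simp: spec_le_def topspace_graph_space)
qed

end

theory Submission
  imports Defs
begin

text \<open>
  Write \<open>C(P)\<close> for the complex of integer chains on the strictly decreasing lists of a finite poset
  \<open>P\<close>, i.e. the simplicial chain complex of its order complex. The proof reduces the statement to the
  following observation about \<open>C\<close>. If \<open>p : \<Gamma>(G) \<rightarrow> X\<close> is Vietoris-like, then sending a chain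
  \<open>\<sigma>\<close> of \<open>X\<close> to the complex of \<open>p\<inverse>(\<sigma>)\<close> is an acyclic carrier, so there is a chain map
  \<open>s : C(X) \<rightarrow> C(\<Gamma>(G))\<close> with \<open>s(\<sigma>)\<close> supported on \<open>p\<inverse>(\<sigma>)\<close>. Composing it with a chain map that
  is carried by the images under \<open>q\<close> gives a chain map \<open>C(X) \<rightarrow> C(Y)\<close> in the class of \<open>G\<^sub>*\<close>. Suppose
  that \<open>\<sigma>'\<close> occurs in the image of \<open>\<sigma>\<close>. Then it comes from a chain \<open>\<tau>\<close> of \<open>\<Gamma>(G)\<close> with
  \<open>p(\<tau>) \<subseteq> \<sigma>\<close> and \<open>\<sigma>' \<subseteq> q(\<tau>)\<close>, and as \<open>\<sigma>'\<close> and \<open>\<tau>\<close> have the same number of elements, \<open>q\<close> maps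
  \<open>\<tau>\<close> bijectively onto \<open>\<sigma>'\<close>. Reading \<open>p\<close> after the inverse of this bijection gives an
  order-preserving map \<open>f : \<sigma>' \<rightarrow> \<sigma>\<close> with \<open>y \<in> G(f(y))\<close> for all \<open>y\<close> in \<open>\<sigma>'\<close>. Such maps compose
  along \<open>G\<^sub>n \<circ> \<dots> \<circ> G\<^sub>0\<close>. If the Lefschetz number is nonzero, the Hopf trace formula provides a chain
  \<open>\<sigma>\<close> of \<open>X\<close> that occurs in its own image, hence an order-preserving self-map \<open>f\<close> of the finite
  nonempty chain \<open>\<sigma>\<close> with \<open>x \<in> F(f(x))\<close> for all \<open>x\<close>. A fixed point of \<open>f\<close> is the required point
  (\<open>vietoris_multimap_chain_map\<close>, \<open>monotone_selection_compose\<close>, \<open>monotone_self_map_fixpoint\<close>).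

  Three further ingredients justify this computation.

  The theorem speaks of singular homology, so \<open>C(X)\<close> has to compute it (\<open>comparison_exact\<close>). A chain
  map \<open>\<eta>\<close> from \<open>C(X)\<close> to singular chains that sends each \<open>\<sigma>\<close> into the contractible subspace \<open>\<sigma>\<close>
  exists by acyclic carriers. Its mapping cone is acyclic on every subspace, by induction on the number
  of points: for a maximal point \<open>x\<close>, the Mayer-Vietoris argument applies to the open sets of the points
  below \<open>x\<close> and of the points other than \<open>x\<close>. Every comparison between \<open>\<eta>\<close>, induced maps and \<open>s\<close> is
  then a comparison of two chain maps with a common acyclic carrier.

  The trace formula (\<open>hopf_trace\<close>) is proved over the integers. Every integer matrix \<open>D\<close> has an
  \<open>h\<close> with \<open>D h D = N D\<close> for some \<open>N > 0\<close>. Applied to the boundary operators, \<open>N - \<partial>h - h\<partial>\<close> is a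
  chain map homotopic to multiplication by \<open>N\<close> which, modulo torsion, factors through homology; this
  turns the alternating trace on chains into the one on homology.

  Finally, traces in the definition of the Lefschetz number are taken in an arbitrary basis of homology
  modulo torsion. Such a basis exists because the same operator embeds this quotient into a finitely
  generated free group (\<open>homology_basis_ex\<close>), and any choice of it is admissible in \<open>hopf_trace\<close>.
\<close>

section \<open>Integer chains\<close>

abbreviation coef :: "('b \<Rightarrow>\<^sub>0 int) \<Rightarrow> 'b \<Rightarrow> int"
  where "coef \<equiv> Poly_Mapping.lookup"

abbreviation supp :: "('b \<Rightarrow>\<^sub>0 int) \<Rightarrow> 'b set"
  where "supp \<equiv> Poly_Mapping.keys"

text \<open>The carrier of \<^term>\<open>free_Abelian_group S\<close> as a plain set, so that chains can be added with
  type-class arithmetic.\<close>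
definition frags :: "'b set \<Rightarrow> ('b \<Rightarrow>\<^sub>0 int) set"
  where "frags S = {c. supp c \<subseteq> S}"

lemma frags_0 [simp, intro]: "0 \<in> frags S"
  by (simp add: frags_def)

lemma frags_of [simp]: "frag_of x \<in> frags S \<longleftrightarrow> x \<in> S"
  by (simp add: frags_def)

lemma frags_add: "a \<in> frags S \<Longrightarrow> b \<in> frags S \<Longrightarrow> a + b \<in> frags S"
  using keys_add[of a b] by (auto simp: frags_def)

lemma frags_diff: "a \<in> frags S \<Longrightarrow> b \<in> frags S \<Longrightarrow> a - b \<in> frags S"
  using keys_diff[of a b] by (auto simp: frags_def)

lemma frags_minus: "a \<in> frags S \<Longrightarrow> - a \<in> frags S"
  by (simp add: frags_def)

lemma frags_cmul: "a \<in> frags S \<Longrightarrow> frag_cmul k a \<in> frags S"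
  by (auto simp: frags_def)

lemma frags_mono: "a \<in> frags S \<Longrightarrow> S \<subseteq> T \<Longrightarrow> a \<in> frags T"
  by (auto simp: frags_def)

lemma frags_empty [simp]: "frags {} = {0}"
  by (auto simp: frags_def)

lemma frags_extend:
  assumes "c \<in> frags S" "\<And>x. x \<in> S \<Longrightarrow> f x \<in> frags T"
  shows "frag_extend f c \<in> frags T"
  using assms keys_frag_extend[of f c] by (fastforce simp: frags_def)

lemma frags_induct [consumes 1, case_names zero one diff]:
  assumes "c \<in> frags S" "P 0" "\<And>x. x \<in> S \<Longrightarrow> P (frag_of x)"
    and "\<And>a b. P a \<Longrightarrow> P b \<Longrightarrow> P (a - b)"
  shows "P c"
  using frag_induction[of c S P] assms by (auto simp: frags_def)

lemma frag_extend_cong_frags: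
  assumes "c \<in> frags S" "\<And>x. x \<in> S \<Longrightarrow> f x = g x"
  shows "frag_extend f c = frag_extend g c"
  using assms by (intro frag_extend_eq) (auto simp: frags_def)

lemma frag_extend_extend:
  "frag_extend f (frag_extend g c) = frag_extend (\<lambda>x. frag_extend f (g x)) c"
  using subset_UNIV by (induction c rule: frag_induction) (auto simp: frag_extend_diff)

lemma frag_cmul_diff_distrib2: "frag_cmul k (a - b) = frag_cmul k a - frag_cmul k b"
  by (simp add: poly_mapping_eqI lookup_minus right_diff_distrib)

lemma frag_extend_fun_add:
  "frag_extend (\<lambda>x. f x + g x) c = frag_extend f c + frag_extend g c"
  using subset_UNIV by (induction c rule: frag_induction) (auto simp: frag_extend_diff)

lemma frag_extend_fun_diff:
  "frag_extend (\<lambda>x. f x - g x) c = frag_extend f c - frag_extend g c"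
  using subset_UNIV by (induction c rule: frag_induction) (auto simp: frag_extend_diff)

lemma frag_extend_fun_cmul:
  "frag_extend (\<lambda>x. frag_cmul k (f x)) c = frag_cmul k (frag_extend f c)"
  using subset_UNIV
  by (induction c rule: frag_induction) (auto simp: frag_extend_diff frag_cmul_diff_distrib2)

lemma frag_extend_ident [simp]: "frag_extend frag_of c = c"
  using frag_expansion[of c] by simp

lemma frags_insert_split:
  assumes "c \<in> frags (insert s S)" "s \<notin> S"
  obtains y k where "y \<in> frags S" "c = y + frag_cmul k (frag_of s)"
    "k = coef c s"
proof
  let ?k = "coef c s"
  show "c - frag_cmul ?k (frag_of s) \<in> frags S"
    using assms by (auto simp: frags_def in_keys_iff lookup_minus split: if_splits)
qed auto

definition frag_subgroup :: "('b \<Rightarrow>\<^sub>0 int) set \<Rightarrow> bool"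
  where "frag_subgroup L \<longleftrightarrow> 0 \<in> L \<and> (\<forall>x\<in>L. \<forall>y\<in>L. x - y \<in> L)"

lemma frag_subgroup_zero: "frag_subgroup L \<Longrightarrow> 0 \<in> L"
  by (simp add: frag_subgroup_def)

lemma frag_subgroup_diff: "frag_subgroup L \<Longrightarrow> x \<in> L \<Longrightarrow> y \<in> L \<Longrightarrow> x - y \<in> L"
  by (simp add: frag_subgroup_def)

lemma frag_subgroup_minus: "frag_subgroup L \<Longrightarrow> x \<in> L \<Longrightarrow> - x \<in> L"
  using frag_subgroup_diff[of L 0 x] frag_subgroup_zero[of L] by simp

lemma frag_subgroup_add: "frag_subgroup L \<Longrightarrow> x \<in> L \<Longrightarrow> y \<in> L \<Longrightarrow> x + y \<in> L"
  using frag_subgroup_diff[of L x "- y"] frag_subgroup_minus[of L y] by simp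

lemma frag_subgroup_cmul:
  assumes L: "frag_subgroup L" and x: "x \<in> L"
  shows "frag_cmul k x \<in> L"
proof -
  have nat: "frag_cmul (int m) x \<in> L" for m
    by (induction m) (auto simp: frag_cmul_distrib frag_subgroup_zero[OF L] frag_subgroup_add[OF L] x)
  show ?thesis
    using nat[of "nat k"] frag_subgroup_minus[OF L nat[of "nat (- k)"]]
    by (cases "k \<ge> 0") auto
qed

lemma frag_subgroup_sum: "frag_subgroup L \<Longrightarrow> (\<And>i. i \<in> I \<Longrightarrow> f i \<in> L) \<Longrightarrow> sum f I \<in> L"
  by (induction I rule: infinite_finite_induct) (auto simp: frag_subgroup_zero frag_subgroup_add)

section \<open>Integral generalized inverses and bases of subgroups\<close>

text \<open>Induction on the columns of \<open>D\<close>. Over the rationals every matrix has a generalized inverse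
  \<open>h\<close> with \<open>D h D = D\<close>; the factor \<open>N\<close> clears the denominators.\<close>
lemma generalized_inverse:
  fixes D :: "'s \<Rightarrow> 'r \<Rightarrow>\<^sub>0 int"
  assumes "finite S"
  shows "\<exists>N>0. \<exists>h. (\<forall>x. h x \<in> frags S) \<and>
    (\<forall>c\<in>frags S. frag_extend D (frag_extend h (frag_extend D c)) = frag_cmul N (frag_extend D c))"
  using assms
proof (induction S)
  case empty
  have "(\<forall>x. (\<lambda>_. 0) x \<in> frags {}) \<and> (\<forall>c\<in>frags {}. frag_extend D
      (frag_extend (\<lambda>_. 0) (frag_extend D c)) = frag_cmul 1 (frag_extend D c))"
    by simp
  then show ?case by (metis zero_less_one)
next
  case (insert s S)
  then obtain N h where N: "N > 0" and h: "\<And>x. h x \<in> frags S"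
    and DhD: "\<And>c. c \<in> frags S \<Longrightarrow>
      frag_extend D (frag_extend h (frag_extend D c)) = frag_cmul N (frag_extend D c)"
    by blast
  let ?D = "frag_extend D" and ?h = "frag_extend h"
  \<comment> \<open>\<open>w\<close> vanishes on \<open>D (frags S)\<close>; its value at \<open>D s\<close> is the failure of \<open>h\<close> at the new
    generator \<open>s\<close>\<close>
  define w where "w = (\<lambda>y. frag_cmul N y - ?D (?h y))"
  have w_diff: "w (a - b) = w a - w b" for a b
    by (simp add: w_def frag_extend_diff frag_cmul_diff_distrib2)
  have wD: "w (?D y) = 0" if "y \<in> frags S" for y
    using DhD[OF that] by (simp add: w_def)
  show ?case
  proof (cases "w (D s) = 0")
    case True
    have "?D (?h (?D c)) = frag_cmul N (?D c)" if c: "c \<in> frags (insert s S)" for c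
    proof -
      obtain y k where y: "y \<in> frags S" "c = y + frag_cmul k (frag_of s)"
        using frags_insert_split[OF c insert.hyps(2)] by metis
      have "?D (?h (D s)) = frag_cmul N (D s)"
        using True by (simp add: w_def)
      then show ?thesis
        by (simp add: y(2) frag_extend_add frag_extend_cmul DhD[OF y(1)] frag_cmul_distrib2
            mult.commute)
    qed
    moreover have "h x \<in> frags (insert s S)" for x
      using h frags_mono by blast
    ultimately show ?thesis using N by blast
  next
    case False
    then obtain j where j: "coef (w (D s)) j \<noteq> 0"
      by (metis poly_mapping_eqI lookup_zero)
    \<comment> \<open>a nonzero coordinate \<open>j\<close> of \<open>w (D s)\<close> gives a functional \<open>l\<close> that kills \<open>D (frags S)\<close> and
      has the value \<open>m \<noteq> 0\<close> at \<open>D s\<close>; adding \<open>l\<close> times \<open>u\<close> to \<open>m h\<close> repairs the new generator without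
      affecting the old ones, and the sign \<open>e\<close> makes the new factor positive\<close>
    define m where "m = coef (w (D s)) j"
    define l where "l = (\<lambda>y. coef (w y) j)"
    define u where "u = frag_cmul N (frag_of s) - ?h (D s)"
    define e where "e = sgn m"
    define g where "g = (\<lambda>x. frag_cmul e (frag_cmul m (h x) + frag_cmul (l (frag_of x)) u))"
    have l_diff: "l (a - b) = l a - l b" for a b
      by (simp add: l_def w_diff lookup_minus)
    have w0: "w 0 = 0" by (simp add: w_def)
    have g: "frag_extend g y = frag_cmul e (frag_cmul m (?h y) + frag_cmul (l y) u)" for y
      using subset_UNIV
    proof (induction y rule: frag_induction)
      case zero then show ?case by (simp add: l_def w0)
    next
      case (one x) then show ?case by (simp add: g_def)
    next
      case (diff a b) then show ?case
        by (simp add: frag_extend_diff l_diff frag_cmul_diff_distrib frag_cmul_diff_distrib2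
            frag_cmul_distrib2 algebra_simps)
    qed
    have Du: "?D u = w (D s)"
      by (simp add: u_def w_def frag_extend_diff frag_extend_cmul)
    have u: "u \<in> frags (insert s S)"
      unfolding u_def
      by (intro frags_diff frags_cmul frags_extend[where S = UNIV])
        (use h in \<open>auto simp: frags_def\<close>)
    have *: "?D (frag_extend g (?D c)) = frag_cmul (\<bar>m\<bar> * N) (?D c)"
      if c: "c \<in> frags (insert s S)" for c
    proof -
      obtain y k where y: "y \<in> frags S" "c = y + frag_cmul k (frag_of s)"
        using frags_insert_split[OF c insert.hyps(2)] by metis
      have 1: "?D (frag_extend g (?D y)) = frag_cmul e (frag_cmul m (frag_cmul N (?D y)))"
        using wD[OF y(1)] DhD[OF y(1)] by (simp add: g l_def frag_extend_cmul frag_extend_add mult.assoc)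
      have "?D (frag_extend g (D s)) =
          frag_cmul e (frag_cmul m (?D (?h (D s))) + frag_cmul m (w (D s)))"
        by (simp add: g l_def frag_extend_cmul frag_extend_add Du m_def)
      then have 2: "?D (frag_extend g (D s)) = frag_cmul e (frag_cmul m (frag_cmul N (D s)))"
        by (simp add: w_def frag_cmul_diff_distrib2)
      have em: "e * m = \<bar>m\<bar>" by (simp add: e_def abs_sgn mult.commute)
      have em': "frag_cmul e (frag_cmul m z) = frag_cmul \<bar>m\<bar> z" for z :: "'r \<Rightarrow>\<^sub>0 int"
        by (simp add: em)
      have "?D (frag_extend g (?D c)) =
          ?D (frag_extend g (?D y)) + frag_cmul k (?D (frag_extend g (D s)))"
        by (simp add: y(2) frag_extend_add frag_extend_cmul)
      also have "\<dots> = frag_cmul (\<bar>m\<bar> * N) (?D y) + frag_cmul (\<bar>m\<bar> * N) (frag_cmul k (D s))"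
        unfolding 1 2 em' by (simp add: mult.commute)
      finally show ?thesis
        by (simp add: y(2) frag_extend_add frag_extend_cmul frag_cmul_distrib2)
    qed
    have "\<bar>m\<bar> * N > 0" using j N by (simp add: m_def)
    moreover have "g x \<in> frags (insert s S)" for x
      unfolding g_def using h[of x] u by (intro frags_cmul frags_add) (auto intro: frags_mono)
    ultimately show ?thesis using * by blast
  qed
qed

text \<open>Elements \<open>w\<close> with dual coordinate functionals \<open>c\<close>: they describe a basis of \<open>L / K\<close> without
  forming the quotient group.\<close>
definition basis_mod ::
    "'g set \<Rightarrow> 'g set \<Rightarrow> nat \<Rightarrow> (nat \<Rightarrow> 'g) \<Rightarrow> (nat \<Rightarrow> 'g::ab_group_add \<Rightarrow> int) \<Rightarrow> bool"
  where "basis_mod L K n w c \<longleftrightarrow>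
    (\<forall>i<n. w i \<in> L) \<and>
    (\<forall>i<n. \<forall>x\<in>L. \<forall>y\<in>L. c i (x - y) = c i x - c i y) \<and>
    (\<forall>i<n. \<forall>j<n. c i (w j) = (if i = j then 1 else 0)) \<and>
    (\<forall>x\<in>L. (\<forall>i<n. c i x = 0) \<longleftrightarrow> x \<in> K)"

lemma basis_mod_linear:
  assumes L: "frag_subgroup L" and b: "basis_mod L K n w c" and i: "i < n"
  shows "x \<in> L \<Longrightarrow> y \<in> L \<Longrightarrow> c i (x - y) = c i x - c i y"
    and "c i 0 = 0" and "x \<in> L \<Longrightarrow> y \<in> L \<Longrightarrow> c i (x + y) = c i x + c i y"
    and "x \<in> L \<Longrightarrow> c i (frag_cmul m x) = m * c i x"
    and "(\<And>j. j \<in> J \<Longrightarrow> f j \<in> L) \<Longrightarrow> c i (sum f J) = (\<Sum>j\<in>J. c i (f j))"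
proof -
  have d: "c i (x - y) = c i x - c i y" if "x \<in> L" "y \<in> L" for x y
    using b i that by (simp add: basis_mod_def)
  show "x \<in> L \<Longrightarrow> y \<in> L \<Longrightarrow> c i (x - y) = c i x - c i y" by (rule d)
  have L0: "0 \<in> L" by (rule frag_subgroup_zero[OF L])
  show 0: "c i 0 = 0" using d[OF L0 L0] by simp
  show add: "c i (x + y) = c i x + c i y" if "x \<in> L" "y \<in> L" for x y
    using d[OF that(1) frag_subgroup_minus[OF L that(2)]] d[OF L0 that(2)] 0 by simp
  have nat: "c i (frag_cmul (int m) x) = int m * c i x" if "x \<in> L" for x m
    by (induction m)
      (auto simp: 0 frag_cmul_distrib add frag_subgroup_cmul[OF L] that algebra_simps)
  show "c i (frag_cmul m x) = m * c i x" if "x \<in> L" for x m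
  proof (cases "m \<ge> 0")
    case True
    then show ?thesis using nat[OF that, of "nat m"] by simp
  next
    case False
    then show ?thesis
      using nat[OF that, of "nat (- m)"] d[OF L0 frag_subgroup_cmul[OF L that, of "- m"]] 0 by simp
  qed
  show "c i (sum f J) = (\<Sum>j\<in>J. c i (f j))" if "\<And>j. j \<in> J \<Longrightarrow> f j \<in> L" for f :: "'j \<Rightarrow> _" and J
    using that
    by (induction J rule: infinite_finite_induct) (auto simp: 0 add frag_subgroup_sum[OF L])
qed

text \<open>Splits off one coordinate at a time: its values on the subgroup are the multiples of the least
  positive one, so an element with that value generates a complement of the kernel.\<close>
lemma subgroup_basis:
  fixes L :: "('s \<Rightarrow>\<^sub>0 int) set"
  assumes "finite S" "L \<subseteq> frags S" "frag_subgroup L"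
  shows "\<exists>n w c. basis_mod L {0} n w c"
  using assms
proof (induction S arbitrary: L)
  case empty
  then show ?case by (intro exI[of _ 0]) (auto simp: basis_mod_def)
next
  case (insert s S)
  let ?l = "\<lambda>x. coef x s"
  define L' where "L' = L \<inter> frags S"
  note sg = insert.prems(2)
  have L'_iff: "x \<in> L' \<longleftrightarrow> x \<in> L \<and> ?l x = 0" for x
  proof -
    have "supp x \<subseteq> S \<longleftrightarrow> s \<notin> supp x" if "x \<in> L"
      using that insert.prems(1) insert.hyps(2) unfolding frags_def by blast
    then show ?thesis by (auto simp: L'_def frags_def in_keys_iff)
  qed
  have "\<exists>n w c. basis_mod L' {0} n w c"
  proof (rule insert.IH)
    show "L' \<subseteq> frags S" by (auto simp: L'_def)
    show "frag_subgroup L'" using sg frags_diff[of _ S] by (auto simp: L'_def frag_subgroup_def)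
  qed
  then obtain n w c where basis: "basis_mod L' {0} n w c" by blast
  have w: "w i \<in> L'" if "i < n" for i
    using basis that by (simp add: basis_mod_def)
  have c_diff: "c i (x - y) = c i x - c i y" if "i < n" "x \<in> L'" "y \<in> L'" for i x y
    using basis that by (simp add: basis_mod_def)
  have cw: "c i (w j) = (if i = j then 1 else 0)" if "i < n" "j < n" for i j
    using basis that by (simp add: basis_mod_def)
  have c0: "x = 0" if "x \<in> L'" "\<And>i. i < n \<Longrightarrow> c i x = 0" for x
    using basis that unfolding basis_mod_def by blast
  show ?case
  proof (cases "\<exists>x\<in>L. ?l x \<noteq> 0")
    case False
    then have "L = L'" using L'_iff by blast
    then show ?thesis using basis by blast
  next
    case True
    have "\<exists>k. k > 0 \<and> (\<exists>x\<in>L. ?l x = int k)"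
    proof -
      obtain x where x: "x \<in> L" "?l x \<noteq> 0" using True by blast
      show ?thesis
      proof (cases "?l x > 0")
        case True
        then show ?thesis using x by (intro exI[of _ "nat (?l x)"]) auto
      next
        case False
        then show ?thesis using x frag_subgroup_minus[OF sg x(1)]
          by (intro exI[of _ "nat (- ?l x)"]) (auto intro!: bexI[of _ "- x"])
      qed
    qed
    then obtain k where k: "k > 0" "\<exists>x\<in>L. ?l x = int k"
      and least: "\<And>k'. k' > 0 \<and> (\<exists>x\<in>L. ?l x = int k') \<Longrightarrow> k \<le> k'"
      using exists_least_iff[of "\<lambda>k. k > 0 \<and> (\<exists>x\<in>L. ?l x = int k)"]
      by (meson not_le_imp_less)
    obtain v where v: "v \<in> L" "?l v = int k" using k by blast
    have dvd: "int k dvd ?l x" if x: "x \<in> L" for x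
    proof (rule ccontr)
      assume "\<not> int k dvd ?l x"
      then have "?l x mod int k \<noteq> 0" by (simp only: dvd_eq_mod_eq_0 not_False_eq_True)
      moreover have "?l x mod int k \<ge> 0" and r': "?l x mod int k < int k"
        using k(1) by simp_all
      ultimately have r: "?l x mod int k > 0" by linarith
      have z: "x - frag_cmul (?l x div int k) v \<in> L"
        by (intro frag_subgroup_diff[OF sg] frag_subgroup_cmul[OF sg] x v)
      have "?l (x - frag_cmul (?l x div int k) v) = ?l x mod int k"
        by (simp add: lookup_minus v(2) minus_div_mult_eq_mod)
      then have "\<exists>y\<in>L. ?l y = int (nat (?l x mod int k))"
        using r by (intro bexI[OF _ z]) simp
      then have "k \<le> nat (?l x mod int k)"
        using r by (intro least) simp
      then show False using r r' by linarith
    qed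
    \<comment> \<open>the projection to \<open>L'\<close> along \<open>v\<close>, a splitting \<open>L = L' \<oplus> \<int> v\<close>\<close>
    define q where "q = (\<lambda>x. x - frag_cmul (?l x div int k) v)"
    have q_L': "q x \<in> L'" if x: "x \<in> L" for x
    proof -
      have "q x \<in> L"
        unfolding q_def by (intro frag_subgroup_diff[OF sg] frag_subgroup_cmul[OF sg] x v)
      moreover have "?l (q x) = 0"
        using dvd[OF x] by (simp add: q_def lookup_minus v(2))
      ultimately show ?thesis by (simp add: L'_iff)
    qed
    have div_diff: "?l (x - y) div int k = ?l x div int k - ?l y div int k"
      if "x \<in> L" "y \<in> L" for x y
      unfolding lookup_minus by (rule div_diff[OF dvd[OF that(1)] dvd[OF that(2)]])
    have q_diff: "q (x - y) = q x - q y" if "x \<in> L" "y \<in> L" for x y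
      by (simp add: q_def div_diff[OF that] frag_cmul_diff_distrib)
    have qw: "q (w i) = w i" if "i < n" for i
      using w[OF that] by (simp add: L'_iff q_def)
    have qv: "q v = 0" using k(1) by (simp add: q_def v(2))
    have lw: "?l (w i) = 0" if "i < n" for i
      using w[OF that] by (simp add: L'_iff)
    have cz: "c i 0 = 0" if "i < n" for i
      using c_diff[OF that, of 0 0] frag_subgroup_zero[OF sg] by (simp add: L'_iff)
    define w' where "w' = (\<lambda>i. if i < n then w i else v)"
    define c' where "c' = (\<lambda>i x. if i < n then c i (q x) else ?l x div int k)"
    have "basis_mod L {0} (Suc n) w' c'"
      unfolding basis_mod_def
    proof (intro conjI allI impI ballI iffI)
      fix i assume "i < Suc n"
      show "w' i \<in> L" using w v by (auto simp: w'_def L'_iff)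
    next
      fix i x y assume "i < Suc n" "x \<in> L" "y \<in> L"
      then show "c' i (x - y) = c' i x - c' i y"
        by (simp add: c'_def q_diff c_diff q_L' div_diff)
    next
      fix i j assume "i < Suc n" "j < Suc n"
      then show "c' i (w' j) = (if i = j then 1 else 0)"
        using k(1) by (auto simp: c'_def w'_def qw cw qv cz lw v(2))
    next
      fix x assume x: "x \<in> L" and 0: "\<forall>i<Suc n. c' i x = 0"
      have "?l x div int k = 0" using 0[rule_format, of n] by (simp add: c'_def)
      then have "q x = x" by (simp add: q_def)
      moreover have "q x = 0"
      proof (rule c0[OF q_L'[OF x]])
        fix i assume "i < n"
        then show "c i (q x) = 0" using 0[rule_format, of i] by (simp add: c'_def)
      qed
      ultimately show "x \<in> {0}" by simp
    next
      fix i x assume "x \<in> L" "x \<in> {0::'s \<Rightarrow>\<^sub>0 int}" "i < Suc n"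
      then show "c' i x = 0" using cz by (auto simp: c'_def q_def)
    qed
    then show ?thesis by blast
  qed
qed

lemma frag_extend_zero_on:
  assumes "c \<in> frags S" "\<And>x. x \<in> S \<Longrightarrow> f x = 0"
  shows "frag_extend f c = 0"
  using assms by (intro frag_extend_eq_0) (auto simp: frags_def)

lemma lookup_frag_extend:
  assumes "finite T" "c \<in> frags T"
  shows "coef (frag_extend g c) x =
    (\<Sum>y\<in>T. coef c y * coef (g y) x)"
  unfolding frag_extend_def lookup_sum lookup_frag_cmul
  using assms by (intro sum.mono_neutral_left) (auto simp: frags_def in_keys_iff)

section \<open>The Hopf trace formula\<close>

lemma additive_expand:
  fixes f :: "('s \<Rightarrow>\<^sub>0 int) \<Rightarrow> int"
  assumes "finite S" and "z \<in> frags S"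
    and f: "\<And>x y. x \<in> frags S \<Longrightarrow> y \<in> frags S \<Longrightarrow> f (x - y) = f x - f y"
  shows "f z = (\<Sum>s\<in>S. coef z s * f (frag_of s))"
proof -
  have "z \<in> frags S \<and> f z = (\<Sum>s\<in>S. coef z s * f (frag_of s))"
    using assms(2)
  proof (induction z rule: frags_induct)
    case zero
    then show ?case using f[of 0 0] by simp
  next
    case (one x)
    then show ?case using assms(1)
      by (simp add: if_distrib[of "\<lambda>t. t * _"] sum.delta cong: if_cong)
  next
    case (diff a b)
    then show ?case
      by (simp add: f frags_diff lookup_minus left_diff_distrib sum_subtractf)
  qed
  then show ?thesis ..
qed

definition trace_on :: "'s set \<Rightarrow> ('s \<Rightarrow> 's \<Rightarrow>\<^sub>0 int) \<Rightarrow> int"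
  where "trace_on S f = (\<Sum>s\<in>S. coef (f s) s)"

lemma trace_on_cong: "(\<And>s. s \<in> S \<Longrightarrow> f s = g s) \<Longrightarrow> trace_on S f = trace_on S g"
  by (simp add: trace_on_def)

lemma trace_on_commute:
  assumes "finite S" "finite T" "\<And>s. s \<in> S \<Longrightarrow> f s \<in> frags T" "\<And>t. t \<in> T \<Longrightarrow> g t \<in> frags S"
  shows "trace_on S (\<lambda>s. frag_extend g (f s)) = trace_on T (\<lambda>t. frag_extend f (g t))"
proof -
  have "trace_on S (\<lambda>s. frag_extend g (f s)) =
      (\<Sum>s\<in>S. \<Sum>t\<in>T. coef (f s) t * coef (g t) s)"
    unfolding trace_on_def using assms by (intro sum.cong refl lookup_frag_extend)
  also have "\<dots> = (\<Sum>t\<in>T. \<Sum>s\<in>S. coef (g t) s * coef (f s) t)"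
    by (subst sum.swap) (simp add: mult.commute)
  also have "\<dots> = trace_on T (\<lambda>t. frag_extend f (g t))"
    unfolding trace_on_def using assms by (intro sum.cong refl lookup_frag_extend[symmetric])
  finally show ?thesis .
qed

locale finite_complex =
  fixes S :: "nat \<Rightarrow> 's set" and D :: "'s \<Rightarrow> 's \<Rightarrow>\<^sub>0 int"
  assumes finite_S: "finite (S k)"
    and D_0: "s \<in> S 0 \<Longrightarrow> D s = 0"
    and D_Suc: "s \<in> S (Suc k) \<Longrightarrow> D s \<in> frags (S k)"
    and D_D: "s \<in> S k \<Longrightarrow> frag_extend D (D s) = 0"
begin

definition cycles :: "nat \<Rightarrow> ('s \<Rightarrow>\<^sub>0 int) set"
  where "cycles k = {c \<in> frags (S k). frag_extend D c = 0}"

definition boundaries :: "nat \<Rightarrow> ('s \<Rightarrow>\<^sub>0 int) set"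
  where "boundaries k = frag_extend D ` frags (S (Suc k))"

text \<open>The cycles that represent torsion classes.\<close>
definition weak_boundaries :: "nat \<Rightarrow> ('s \<Rightarrow>\<^sub>0 int) set"
  where "weak_boundaries k = {c \<in> frags (S k). \<exists>m>0. frag_cmul m c \<in> boundaries k}"

lemma D_frags: "c \<in> frags (S (Suc k)) \<Longrightarrow> frag_extend D c \<in> frags (S k)"
  using D_Suc by (intro frags_extend)

lemma D_frags_0: "c \<in> frags (S 0) \<Longrightarrow> frag_extend D c = 0"
  by (erule frag_extend_zero_on) (rule D_0)

lemma D_D_frags: "c \<in> frags (S k) \<Longrightarrow> frag_extend D (frag_extend D c) = 0"
  unfolding frag_extend_extend by (erule frag_extend_zero_on) (rule D_D)

lemma boundaries_subset_cycles: "boundaries k \<subseteq> cycles k"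
  using D_D_frags[of _ "Suc k"] D_frags by (auto simp: boundaries_def cycles_def)

lemma boundaries_subset_weak: "boundaries k \<subseteq> weak_boundaries k"
  using D_frags by (auto simp: boundaries_def weak_boundaries_def intro!: exI[of _ 1])

lemma frag_subgroup_cycles: "frag_subgroup (cycles k)"
  by (simp add: frag_subgroup_def cycles_def frags_diff frag_extend_diff)

lemma frag_subgroup_boundaries: "frag_subgroup (boundaries k)"
  unfolding frag_subgroup_def boundaries_def
proof (intro conjI ballI)
  show "0 \<in> frag_extend D ` frags (S (Suc k))" by (rule image_eqI[of _ _ 0]) auto
  fix x y assume "x \<in> frag_extend D ` frags (S (Suc k))" "y \<in> frag_extend D ` frags (S (Suc k))"
  then obtain a b where "a \<in> frags (S (Suc k))" "x = frag_extend D a"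
    "b \<in> frags (S (Suc k))" "y = frag_extend D b" by blast
  then show "x - y \<in> frag_extend D ` frags (S (Suc k))"
    by (intro image_eqI[of _ _ "a - b"]) (simp_all add: frag_extend_diff frags_diff)
qed

lemmas cycles_0 = frag_subgroup_zero[OF frag_subgroup_cycles]
  and cycles_diff = frag_subgroup_diff[OF frag_subgroup_cycles]
  and cycles_cmul = frag_subgroup_cmul[OF frag_subgroup_cycles]
  and cycles_sum = frag_subgroup_sum[OF frag_subgroup_cycles]

lemma common_generalized_inverse:
  "\<exists>N>0. \<exists>h. (\<forall>k s. h k s \<in> frags (S (Suc k))) \<and> (\<forall>k\<le>M. \<forall>c\<in>frags (S (Suc k)).
     frag_extend D (frag_extend (h k) (frag_extend D c)) = frag_cmul N (frag_extend D c))"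
proof -
  have "\<forall>k. \<exists>N h. N > 0 \<and> (\<forall>x. h x \<in> frags (S (Suc k))) \<and> (\<forall>c\<in>frags (S (Suc k)).
      frag_extend D (frag_extend h (frag_extend D c)) = frag_cmul N (frag_extend D c))"
    using generalized_inverse[OF finite_S, of _ D] by blast
  then obtain N h where N: "\<And>k. N k > 0" and h: "\<And>k x. h k x \<in> frags (S (Suc k))"
    and DhD: "\<And>k c. c \<in> frags (S (Suc k)) \<Longrightarrow>
      frag_extend D (frag_extend (h k) (frag_extend D c)) = frag_cmul (N k) (frag_extend D c)"
    by metis
  define T where "T = (\<Prod>k\<le>M. N k)"
  define g where "g = (\<lambda>k s. frag_cmul (\<Prod>j\<in>{..M} - {k}. N j) (h k s))"
  have "frag_extend D (frag_extend (g k) (frag_extend D c)) = frag_cmul T (frag_extend D c)"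
    if "k \<le> M" "c \<in> frags (S (Suc k))" for k c
  proof -
    have "T = (\<Prod>j\<in>{..M} - {k}. N j) * N k"
      unfolding T_def using that(1) by (subst prod.remove[of _ k]) (auto simp: mult.commute)
    then show ?thesis
      by (simp add: g_def frag_extend_fun_cmul frag_extend_cmul DhD[OF that(2)])
  qed
  moreover have "T > 0" using N by (auto simp: T_def intro: prod_pos)
  moreover have "g k s \<in> frags (S (Suc k))" for k s
    by (simp add: g_def frags_cmul h)
  ultimately show ?thesis by blast
qed

context
  fixes N :: int and h :: "nat \<Rightarrow> 's \<Rightarrow> 's \<Rightarrow>\<^sub>0 int" and M :: nat
  assumes N: "N > 0" and h: "h k s \<in> frags (S (Suc k))"
    and DhD: "k \<le> M \<Longrightarrow> c \<in> frags (S (Suc k)) \<Longrightarrow>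
      frag_extend D (frag_extend (h k) (frag_extend D c)) = frag_cmul N (frag_extend D c)"
begin

text \<open>The operator \<open>N - \<partial>h - h\<partial>\<close>. Divided by \<open>N\<close> it is, over the rationals, a chain homotopy
  perturbation of the identity that takes values in the cycles and kills the boundaries.\<close>
definition projector :: "nat \<Rightarrow> 's \<Rightarrow> 's \<Rightarrow>\<^sub>0 int"
  where "projector k s = frag_cmul N (frag_of s) - frag_extend D (h k s)
    - frag_extend (h (k - 1)) (D s)"

lemma projector_extend:
  "frag_extend (projector k) c = frag_cmul N c - frag_extend D (frag_extend (h k) c)
    - frag_extend (h (k - 1)) (frag_extend D c)"
  unfolding projector_def
  by (simp add: frag_extend_fun_diff frag_extend_fun_cmul frag_extend_extend)

lemma h_frags: "frag_extend (h k) c \<in> frags (S (Suc k))"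
  using h by (intro frags_extend[of _ UNIV]) (auto simp: frags_def)

lemma projector_frags: "c \<in> frags (S k) \<Longrightarrow> frag_extend (projector k) c \<in> frags (S k)"
  unfolding projector_extend
  using D_frags[OF h_frags, of k c] h_frags[of "k - 1" "frag_extend D c"] D_frags_0[of c]
  by (cases k) (auto intro!: frags_diff frags_cmul)

lemma projector_boundary: "k \<le> M \<Longrightarrow> x \<in> boundaries k \<Longrightarrow> frag_extend (projector k) x = 0"
  by (auto simp: boundaries_def projector_extend DhD D_D_frags[of _ "Suc k"])

lemma projector_cycle:
  "c \<in> cycles k \<Longrightarrow> frag_extend (projector k) c = frag_cmul N c - frag_extend D (frag_extend (h k) c)"
  by (simp add: projector_extend cycles_def)

lemma projector_in_cycles:
  assumes "k \<le> M" "c \<in> frags (S k)"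
  shows "frag_extend (projector k) c \<in> cycles k"
proof -
  have "frag_extend D (frag_extend (projector k) c) = 0"
  proof (cases k)
    case 0
    then show ?thesis using D_frags_0 projector_frags assms(2) by blast
  next
    case (Suc j)
    then show ?thesis
      using assms DhD[of j c] D_D_frags[OF h_frags, of k c]
      by (simp add: projector_extend frag_extend_diff frag_extend_cmul)
  qed
  then show ?thesis using projector_frags[OF assms(2)] by (simp add: cycles_def)
qed

text \<open>On cycles \<open>projector\<close> differs from multiplication by \<open>N\<close> by a boundary, and it takes
  values in a torsion-free group. Hence it embeds homology modulo torsion into the chains.\<close>
lemma projector_eq_0_iff:
  assumes "k \<le> M" "c \<in> cycles k"
  shows "frag_extend (projector k) c = 0 \<longleftrightarrow> c \<in> weak_boundaries k"
proof
  assume "frag_extend (projector k) c = 0"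
  then have "frag_cmul N c = frag_extend D (frag_extend (h k) c)"
    using projector_cycle[OF assms(2)] by simp
  then have "frag_cmul N c \<in> boundaries k"
    using h_frags by (simp add: boundaries_def)
  then show "c \<in> weak_boundaries k"
    using N assms(2) by (auto simp: weak_boundaries_def cycles_def)
next
  assume "c \<in> weak_boundaries k"
  then obtain m where m: "m > 0" "frag_cmul m c \<in> boundaries k"
    by (auto simp: weak_boundaries_def)
  then have "frag_cmul m (frag_extend (projector k) c) = 0"
    using projector_boundary[OF assms(1) m(2)] by (simp add: frag_extend_cmul)
  then show "frag_extend (projector k) c = 0" using m(1) by simp
qed

text \<open>The image of the cycles under \<open>projector\<close> is a subgroup of a free group, and it is isomorphic to
  homology modulo torsion; so \<open>subgroup_basis\<close> applies.\<close>
lemma homology_basis_ex_aux: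
  assumes "k \<le> M"
  shows "\<exists>n z c. basis_mod (cycles k) (weak_boundaries k) n z c"
proof -
  let ?R = "frag_extend (projector k)"
  have "\<exists>n w c. basis_mod (?R ` cycles k) {0} n w c"
  proof (rule subgroup_basis[OF finite_S])
    show "?R ` cycles k \<subseteq> frags (S k)"
      using projector_frags by (auto simp: cycles_def)
    show "frag_subgroup (?R ` cycles k)"
      unfolding frag_subgroup_def
    proof (intro conjI ballI)
      show "0 \<in> ?R ` cycles k" by (rule image_eqI[of _ _ 0]) (auto simp: cycles_0)
      fix x y assume "x \<in> ?R ` cycles k" "y \<in> ?R ` cycles k"
      then obtain a b where "a \<in> cycles k" "b \<in> cycles k" "x = ?R a" "y = ?R b" by blast
      then show "x - y \<in> ?R ` cycles k"
        by (intro image_eqI[of _ _ "a - b"]) (auto simp: frag_extend_diff cycles_diff)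
    qed
  qed
  then obtain n w c where w: "basis_mod (?R ` cycles k) {0} n w c" by blast
  define z where "z = (\<lambda>i. inv_into (cycles k) ?R (w i))"
  have z: "z i \<in> cycles k \<and> ?R (z i) = w i" if "i < n" for i
  proof -
    have "w i \<in> ?R ` cycles k" using w that by (simp add: basis_mod_def)
    then show ?thesis unfolding z_def by (intro conjI inv_into_into f_inv_into_f)
  qed
  have "basis_mod (cycles k) (weak_boundaries k) n z (\<lambda>i x. c i (?R x))"
    unfolding basis_mod_def
  proof (intro conjI allI impI ballI)
    fix i x y assume "i < n" "x \<in> cycles k" "y \<in> cycles k"
    then show "c i (?R (x - y)) = c i (?R x) - c i (?R y)"
      using w by (simp add: basis_mod_def frag_extend_diff)
  next
    fix i j assume "i < n" "j < n"
    then show "c i (?R (z j)) = (if i = j then 1 else 0)"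
      using w z by (simp add: basis_mod_def)
  next
    fix x assume x: "x \<in> cycles k"
    then have "(\<forall>i<n. c i (?R x) = 0) \<longleftrightarrow> ?R x = 0"
      using w by (simp add: basis_mod_def)
    then show "(\<forall>i<n. c i (?R x) = 0) \<longleftrightarrow> x \<in> weak_boundaries k"
      using projector_eq_0_iff[OF assms x] by simp
  qed (use z in auto)
  then show ?thesis by blast
qed

text \<open>Homotopy invariance of the alternating trace: by cyclicity, the term with \<open>h\<partial>\<close> in degree
  \<open>k + 1\<close> equals the term with \<open>\<partial>h\<close> in degree \<open>k\<close>, so the sum telescopes.\<close>
lemma alternating_trace_projector:
  assumes f: "\<And>k s. s \<in> S k \<Longrightarrow> f k s \<in> frags (S k)"
    and comm: "\<And>k s. s \<in> S (Suc k) \<Longrightarrow> frag_extend D (f (Suc k) s) = frag_extend (f k) (D s)"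
    and top: "\<And>k. k > M \<Longrightarrow> S k = {}"
  shows "(\<Sum>k\<le>M. (-1) ^ k * trace_on (S k) (\<lambda>s. frag_extend (f k) (projector k s))) =
    N * (\<Sum>k\<le>M. (-1) ^ k * trace_on (S k) (f k))"
proof -
  define t where "t = (\<lambda>k. trace_on (S k) (\<lambda>s. frag_extend (f k) (frag_extend D (h k s))))"
  have expand: "trace_on (S k) (\<lambda>s. frag_extend (f k) (projector k s)) =
      N * trace_on (S k) (f k) - t k
      - trace_on (S k) (\<lambda>s. frag_extend (f k) (frag_extend (h (k - 1)) (D s)))" for k
    by (simp add: projector_def frag_extend_diff frag_extend_cmul trace_on_def t_def lookup_minus
        sum_subtractf sum_distrib_left)
  have zero: "trace_on (S 0) (\<lambda>s. frag_extend (f 0) (frag_extend (h (0 - 1)) (D s))) = 0"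
    by (simp add: trace_on_def D_0)
  have suc: "trace_on (S (Suc k)) (\<lambda>s. frag_extend (f (Suc k)) (frag_extend (h k) (D s))) = t k" for k
  proof -
    have "trace_on (S (Suc k)) (\<lambda>s. frag_extend (\<lambda>x. frag_extend (f (Suc k)) (h k x)) (D s)) =
        trace_on (S k) (\<lambda>s. frag_extend D (frag_extend (f (Suc k)) (h k s)))"
      by (rule trace_on_commute[OF finite_S finite_S D_Suc frags_extend[OF h f]])
    also have "\<dots> = t k"
      unfolding t_def
    proof (rule trace_on_cong)
      fix s
      show "frag_extend D (frag_extend (f (Suc k)) (h k s)) = frag_extend (f k) (frag_extend D (h k s))"
        unfolding frag_extend_extend by (rule frag_extend_cong_frags[OF h comm])
    qed
    finally show ?thesis by (simp add: frag_extend_extend)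
  qed
  have tM: "t M = 0"
    using h[of M] top[of "Suc M"] by (simp add: t_def trace_on_def)
  have partial: "(\<Sum>k\<le>m. (-1) ^ k * trace_on (S k) (\<lambda>s. frag_extend (f k) (projector k s))) =
      N * (\<Sum>k\<le>m. (-1) ^ k * trace_on (S k) (f k)) - (-1) ^ m * t m" for m
  proof (induction m)
    case 0
    then show ?case using zero by (simp add: expand)
  next
    case (Suc m)
    then show ?case using suc[of m] by (simp add: expand algebra_simps)
  qed
  show ?thesis using partial[of M] tM by simp
qed

text \<open>With \<open>R\<close> the projector, the alternating traces of \<open>f\<close>, \<open>fR\<close> and \<open>fRR\<close> differ by
  factors \<open>N\<close>, and the last one has the same trace as \<open>RfR\<close> in each degree. As \<open>R\<close> kills torsion
  cycles, \<open>RfR\<close> depends on its argument only through the homology coordinates of \<open>R x\<close>, so its trace is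
  a sum over a homology basis.\<close>
lemma hopf_trace_aux:
  assumes f: "\<And>k s. s \<in> S k \<Longrightarrow> f s \<in> frags (S k)"
    and comm: "\<And>k s. s \<in> S k \<Longrightarrow> frag_extend D (f s) = frag_extend f (D s)"
    and top: "\<And>k. k > M \<Longrightarrow> S k = {}"
    and basis: "\<And>k. k \<le> M \<Longrightarrow> basis_mod (cycles k) (weak_boundaries k) (n k) (z k) (c k)"
  shows "(\<Sum>k\<le>M. (-1) ^ k * (\<Sum>i<n k. c k i (frag_extend f (z k i)))) =
    (\<Sum>k\<le>M. (-1) ^ k * trace_on (S k) f)"
proof -
  let ?R = "\<lambda>k. frag_extend (projector k)" and ?f = "frag_extend f"
  have Rs_frags: "projector k s \<in> frags (S k)" if "s \<in> S k" for k s
    using projector_frags[of "frag_of s" k] that by simp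
  have Rs_cycles: "projector k s \<in> cycles k" if "s \<in> S k" "k \<le> M" for k s
    using projector_in_cycles[of k "frag_of s"] that by simp
  have f_frags: "?f x \<in> frags (S k)" if "x \<in> frags (S k)" for k x
    by (rule frags_extend[OF that f])
  have fD: "frag_extend D (?f x) = ?f (frag_extend D x)" if "x \<in> frags (S k)" for k x
    unfolding frag_extend_extend by (rule frag_extend_cong_frags[OF that comm])
  have f_cycles: "?f x \<in> cycles k" if "x \<in> cycles k" for k x
    using that f_frags fD[of x k] by (simp add: cycles_def)
  have f_boundaries: "?f x \<in> boundaries k" if x: "x \<in> boundaries k" for k x
  proof -
    obtain y where y: "y \<in> frags (S (Suc k))" "x = frag_extend D y"
      using x by (auto simp: boundaries_def)
    then have "?f x = frag_extend D (?f y)" using fD by simp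
    then show ?thesis using f_frags[OF y(1)] by (simp add: boundaries_def)
  qed
  have f_weak: "?f x \<in> weak_boundaries k" if "x \<in> weak_boundaries k" for k x
    using that f_boundaries f_frags by (auto simp: weak_boundaries_def simp flip: frag_extend_cmul)
  have S_le: "k \<le> M" if "s \<in> S k" for k s
    using that top[of k] by (cases "k \<le> M") auto
  define g where "g = (\<lambda>k s. ?f (projector k s))"
  have g: "frag_extend (g k) x = ?f (?R k x)" for k x
    unfolding g_def frag_extend_extend ..
  have g_frags: "g k s \<in> frags (S k)" if "s \<in> S k" for k s
    unfolding g_def by (intro f_frags Rs_frags that)
  have Dg: "frag_extend D (g (Suc k) s) = frag_extend (g k) (D s)" if s: "s \<in> S (Suc k)" for k s
  proof -
    have "projector (Suc k) s \<in> cycles (Suc k)"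
      by (intro Rs_cycles S_le[OF s] s)
    then have "frag_extend D (g (Suc k) s) = 0"
      using f_cycles unfolding g_def cycles_def by blast
    moreover have "D s \<in> boundaries k"
      unfolding boundaries_def by (intro image_eqI[of _ _ "frag_of s"]) (simp_all add: s)
    then have "?R k (D s) = 0"
      using S_le[OF s] by (intro projector_boundary) auto
    ultimately show ?thesis by (simp add: g)
  qed
  have 1: "(\<Sum>k\<le>M. (-1) ^ k * trace_on (S k) (g k)) = N * (\<Sum>k\<le>M. (-1) ^ k * trace_on (S k) f)"
    unfolding g_def by (rule alternating_trace_projector) (auto simp: f comm top)
  have 2: "(\<Sum>k\<le>M. (-1) ^ k * trace_on (S k) (\<lambda>s. frag_extend (g k) (projector k s))) =
      N * (\<Sum>k\<le>M. (-1) ^ k * trace_on (S k) (g k))"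
    by (rule alternating_trace_projector[OF g_frags Dg top])
  have 3: "trace_on (S k) (\<lambda>s. frag_extend (g k) (projector k s)) =
      N * (N * (\<Sum>i<n k. c k i (?f (z k i))))" if k: "k \<le> M" for k
  proof -
    note b = basis[OF k, unfolded basis_mod_def]
    have zc: "z k i \<in> cycles k" if "i < n k" for i using b that by blast
    note c_linear = basis_mod_linear[OF frag_subgroup_cycles basis[OF k]]
    have c_weak: "c k i x = 0" if "i < n k" "x \<in> cycles k" "x \<in> weak_boundaries k" for i x
      using b that by blast
    have cR: "c k i (?R k x) = N * c k i x" if "i < n k" "x \<in> cycles k" for i x
    proof -
      have "frag_extend D (frag_extend (h k) x) \<in> boundaries k"
        using h_frags by (simp add: boundaries_def)
      then show ?thesis
        using boundaries_subset_cycles boundaries_subset_weak that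
        by (simp add: projector_cycle c_linear(1,4) cycles_cmul c_weak subset_iff)
    qed
    have R_cycles: "?R k x \<in> cycles k" if "x \<in> frags (S k)" for x
      using projector_in_cycles k that by blast
    have cyc_frags: "x \<in> frags (S k)" if "x \<in> cycles k" for x
      using that by (simp add: cycles_def)
    define y where "y = (\<lambda>i. ?R k (?f (z k i)))"
    have y: "y i \<in> cycles k" if "i < n k" for i
      unfolding y_def by (intro R_cycles cyc_frags f_cycles zc that)
    \<comment> \<open>\<open>u\<close> is what remains of \<open>x\<close> after subtracting its expansion in the homology basis; it is a
      torsion cycle, so \<open>R (f u) = 0\<close>\<close>
    have key: "?R k (?f x) = (\<Sum>i<n k. frag_cmul (c k i x) (y i))" if x: "x \<in> cycles k" for x
    proof -
      define u where "u = x - (\<Sum>i<n k. frag_cmul (c k i x) (z k i))"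
      have u: "u \<in> cycles k"
        unfolding u_def by (intro cycles_diff cycles_sum cycles_cmul x zc) simp
      have "c k j u = 0" if j: "j < n k" for j
      proof -
        have s: "(\<Sum>i<n k. frag_cmul (c k i x) (z k i)) \<in> cycles k"
          by (intro cycles_sum cycles_cmul zc) simp
        have "c k j (\<Sum>i<n k. frag_cmul (c k i x) (z k i)) =
            (\<Sum>i<n k. c k j (frag_cmul (c k i x) (z k i)))"
          by (rule c_linear(5)[OF j]) (intro cycles_cmul zc, simp)
        also have "\<dots> = (\<Sum>i<n k. c k i x * c k j (z k i))"
          by (intro sum.cong refl c_linear(4)[OF j] zc) simp
        finally have "c k j u = c k j x - (\<Sum>i<n k. c k i x * c k j (z k i))"
          unfolding u_def c_linear(1)[OF j x s] by simp
        also have "(\<Sum>i<n k. c k i x * c k j (z k i)) = (\<Sum>i<n k. if i = j then c k j x else 0)"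
          using b j by (intro sum.cong) auto
        finally show ?thesis using j by simp
      qed
      then have "u \<in> weak_boundaries k" using b u by blast
      then have "?R k (?f u) = 0"
        using projector_eq_0_iff[OF k f_cycles[OF u]] f_weak by blast
      moreover have "?f x = ?f u + (\<Sum>i<n k. frag_cmul (c k i x) (?f (z k i)))"
        by (simp add: u_def frag_extend_diff frag_extend_sum frag_extend_cmul)
      ultimately show ?thesis
        by (simp add: frag_extend_add frag_extend_sum frag_extend_cmul y_def)
    qed
    have "trace_on (S k) (\<lambda>s. frag_extend (g k) (projector k s)) =
        trace_on (S k) (\<lambda>s. ?R k (?f (projector k s)))"
      using trace_on_commute[OF finite_S finite_S, of k "projector k" k "g k"] Rs_frags g_frags
      by (simp add: g_def)
    also have "\<dots> = trace_on (S k) (\<lambda>s. \<Sum>i<n k. frag_cmul (c k i (projector k s)) (y i))"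
    proof (rule trace_on_cong)
      fix s assume "s \<in> S k"
      then have "projector k s \<in> cycles k" using Rs_cycles k by blast
      then show "?R k (?f (projector k s)) = (\<Sum>i<n k. frag_cmul (c k i (projector k s)) (y i))"
        by (rule key)
    qed
    also have "\<dots> = (\<Sum>i<n k. \<Sum>s\<in>S k. coef (y i) s * c k i (?R k (frag_of s)))"
      unfolding trace_on_def by (simp add: lookup_sum mult.commute sum.swap[of _ _ "S k"])
    also have "\<dots> = (\<Sum>i<n k. c k i (?R k (y i)))"
    proof (intro sum.cong refl)
      fix i assume "i \<in> {..<n k}"
      then show "(\<Sum>s\<in>S k. coef (y i) s * c k i (?R k (frag_of s))) = c k i (?R k (y i))"
        using c_linear(1) R_cycles y cyc_frags
        by (intro additive_expand[symmetric, OF finite_S]) (auto simp: frag_extend_diff)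
    qed
    also have "\<dots> = (\<Sum>i<n k. N * (N * c k i (?f (z k i))))"
      by (intro sum.cong refl) (simp add: cR y, simp add: y_def cR f_cycles zc)
    finally show ?thesis by (simp add: sum_distrib_left)
  qed
  have "N * (N * (\<Sum>k\<le>M. (-1) ^ k * (\<Sum>i<n k. c k i (?f (z k i))))) =
      N * (N * (\<Sum>k\<le>M. (-1) ^ k * trace_on (S k) f))"
    unfolding 1[symmetric] 2[symmetric]
    by (simp add: sum_distrib_left 3 algebra_simps)
  then show ?thesis using N by simp
qed

end

lemma homology_basis_ex: "\<exists>n z c. basis_mod (cycles k) (weak_boundaries k) n z c"
  using common_generalized_inverse[of k] homology_basis_ex_aux[of _ _ k k]
  by (metis order_refl)

theorem hopf_trace:
  assumes "\<And>k s. s \<in> S k \<Longrightarrow> f s \<in> frags (S k)"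
    and "\<And>k s. s \<in> S k \<Longrightarrow> frag_extend D (f s) = frag_extend f (D s)"
    and "\<And>k. k > M \<Longrightarrow> S k = {}"
    and "\<And>k. k \<le> M \<Longrightarrow> basis_mod (cycles k) (weak_boundaries k) (n k) (z k) (c k)"
  shows "(\<Sum>k\<le>M. (-1) ^ k * (\<Sum>i<n k. c k i (frag_extend f (z k i)))) =
    (\<Sum>k\<le>M. (-1) ^ k * trace_on (S k) f)"
proof -
  obtain N h where N: "N > 0" and h: "\<And>k s. h k s \<in> frags (S (Suc k))"
    and DhD: "\<And>k c. k \<le> M \<Longrightarrow> c \<in> frags (S (Suc k)) \<Longrightarrow>
      frag_extend D (frag_extend (h k) (frag_extend D c)) = frag_cmul N (frag_extend D c)"
    using common_generalized_inverse[of M] by blast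
  show ?thesis by (rule hopf_trace_aux[OF N h DhD assms])
qed

end

section \<open>Traces on the torsion-free quotient of a presented group\<close>

text \<open>A group \<open>A\<close> presented as \<open>Z / B\<close> by chains. In the application \<open>A\<close> is a homology group, \<open>Z\<close>
  and \<open>B\<close> are the cycles and boundaries of the order complex, and \<open>cl\<close> takes the homology class.\<close>
locale presented_group = comm_group A for A :: "('g, 'm) monoid_scheme" (structure) +
  fixes Z B :: "('s \<Rightarrow>\<^sub>0 int) set" and cl :: "('s \<Rightarrow>\<^sub>0 int) \<Rightarrow> 'g"
  assumes Z: "frag_subgroup Z" and B: "frag_subgroup B" and B_Z: "B \<subseteq> Z"
    and cl_add: "x \<in> Z \<Longrightarrow> y \<in> Z \<Longrightarrow> cl (x + y) = cl x \<otimes> cl y"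
    and cl_one_iff: "x \<in> Z \<Longrightarrow> cl x = \<one> \<longleftrightarrow> x \<in> B"
    and cl_surj: "cl ` Z = carrier A"
begin

definition torsion_relations :: "('s \<Rightarrow>\<^sub>0 int) set"
  where "torsion_relations = {x \<in> Z. \<exists>m>0. frag_cmul m x \<in> B}"

lemmas Z_0 = frag_subgroup_zero[OF Z] and Z_diff = frag_subgroup_diff[OF Z]
  and Z_add = frag_subgroup_add[OF Z] and Z_cmul = frag_subgroup_cmul[OF Z]
  and Z_sum = frag_subgroup_sum[OF Z]

lemmas B_0 = frag_subgroup_zero[OF B] and B_diff = frag_subgroup_diff[OF B]
  and B_cmul = frag_subgroup_cmul[OF B]

lemma cl_closed: "x \<in> Z \<Longrightarrow> cl x \<in> carrier A"
  using cl_surj by blast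

lemma cl_0: "cl 0 = \<one>"
  using cl_one_iff[OF Z_0] B_0 by blast

lemma cl_pow: "x \<in> Z \<Longrightarrow> cl (frag_cmul (int m) x) = cl x [^] m"
proof (induction m)
  case 0
  then show ?case by (simp add: cl_0)
next
  case (Suc m)
  then show ?case
    by (simp add: frag_cmul_distrib cl_add Z_cmul m_comm cl_closed)
qed

lemma cl_eq_iff: "x \<in> Z \<Longrightarrow> y \<in> Z \<Longrightarrow> cl x = cl y \<longleftrightarrow> x - y \<in> B"
proof -
  assume x: "x \<in> Z" and y: "y \<in> Z"
  have "cl x = cl (x - y) \<otimes> cl y"
    using cl_add[OF Z_diff[OF x y] y] by simp
  then have "cl x = cl y \<longleftrightarrow> cl (x - y) = \<one>"
    using cl_closed[OF Z_diff[OF x y]] cl_closed[OF y] l_cancel_one' r_cancel_one' by metis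
  then show ?thesis using cl_one_iff[OF Z_diff[OF x y]] by simp
qed

lemma torsion_relations_Z: "x \<in> torsion_relations \<Longrightarrow> x \<in> Z"
  by (simp add: torsion_relations_def)

lemma B_torsion: "x \<in> B \<Longrightarrow> x \<in> torsion_relations"
  using B_Z by (auto simp: torsion_relations_def intro!: exI[of _ 1])

lemma torsion_relations_diff:
  assumes "x \<in> torsion_relations" "y \<in> torsion_relations"
  shows "x - y \<in> torsion_relations"
proof -
  obtain m m' where m: "m > 0" "frag_cmul m x \<in> B" "m' > 0" "frag_cmul m' y \<in> B" "x \<in> Z" "y \<in> Z"
    using assms by (auto simp: torsion_relations_def)
  have "frag_cmul (m * m') (x - y) = frag_cmul m' (frag_cmul m x) - frag_cmul m (frag_cmul m' y)"
    by (simp add: frag_cmul_diff_distrib2 mult.commute)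
  then have "frag_cmul (m * m') (x - y) \<in> B" using m B_cmul B_diff by metis
  then show ?thesis using m Z_diff by (auto simp: torsion_relations_def intro!: exI[of _ "m * m'"])
qed

lemma torsion_relations_add:
  "x \<in> torsion_relations \<Longrightarrow> y \<in> torsion_relations \<Longrightarrow> x + y \<in> torsion_relations"
  using torsion_relations_diff[of x "0 - y"] torsion_relations_diff[OF B_torsion[OF B_0], of y] by simp

lemma torsion_part_eq: "torsion_part A = cl ` torsion_relations"
proof (intro equalityI subsetI)
  fix g assume "g \<in> torsion_part A"
  then obtain m :: nat where g: "g \<in> carrier A" "m > 0" "g [^] m = \<one>" by (auto simp: torsion_part_def)
  then obtain x where x: "x \<in> Z" "g = cl x" using cl_surj by blast
  have "frag_cmul (int m) x \<in> B"
    using g x cl_pow[OF x(1), of m] cl_one_iff[OF Z_cmul[OF x(1)], of m] by simp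
  then show "g \<in> cl ` torsion_relations"
    using x g(2) by (auto simp: torsion_relations_def intro!: exI[of _ "int m"])
next
  fix g assume "g \<in> cl ` torsion_relations"
  then obtain x m where x: "g = cl x" "x \<in> Z" "m > 0" "frag_cmul m x \<in> B"
    by (auto simp: torsion_relations_def)
  have "cl x [^] nat m = \<one>"
    using x cl_pow[OF x(2), of "nat m"] cl_one_iff[OF Z_cmul[OF x(2)], of m] by simp
  then show "g \<in> torsion_part A"
    using x cl_closed by (auto simp: torsion_part_def intro!: exI[of _ "nat m"])
qed

lemma subgroup_torsion_part: "subgroup (torsion_part A) A"
proof (rule subgroupI)
  show "torsion_part A \<subseteq> carrier A" by (auto simp: torsion_part_def)
  show "torsion_part A \<noteq> {}" using B_torsion[OF B_0] by (auto simp: torsion_part_eq)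
  fix a assume "a \<in> torsion_part A"
  then obtain x where x: "x \<in> torsion_relations" "a = cl x" by (auto simp: torsion_part_eq)
  have x': "0 - x \<in> torsion_relations" by (rule torsion_relations_diff[OF B_torsion[OF B_0] x(1)])
  have "cl (0 - x) \<otimes> cl x = \<one>"
    using cl_add[OF torsion_relations_Z[OF x'] torsion_relations_Z[OF x(1)]] cl_0 by simp
  then have "inv a = cl (0 - x)"
    unfolding x(2)
    by (rule inv_equality) (intro cl_closed torsion_relations_Z x(1) x')+
  then show "inv a \<in> torsion_part A" using x' by (auto simp: torsion_part_eq)
next
  fix a b assume "a \<in> torsion_part A" "b \<in> torsion_part A"
  then obtain x y where "x \<in> torsion_relations" "a = cl x" "y \<in> torsion_relations" "b = cl y"
    by (auto simp: torsion_part_eq)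
  then show "a \<otimes> b \<in> torsion_part A"
    using cl_add[of x y] torsion_relations_Z torsion_relations_add[of x y]
    unfolding torsion_part_eq by (metis image_eqI)
qed

definition tf_class :: "('s \<Rightarrow>\<^sub>0 int) \<Rightarrow> 'g set"
  where "tf_class x = torsion_part A #> cl x"

lemma carrier_tf: "carrier (A Mod torsion_part A) = tf_class ` Z"
  by (auto simp: FactGroup_def RCOSETS_def tf_class_def simp flip: cl_surj)

lemma tf_class_add:
  "x \<in> Z \<Longrightarrow> y \<in> Z \<Longrightarrow> tf_class x <#> tf_class y = tf_class (x + y)"
  using normal.rcos_sum[OF subgroup_imp_normal[OF subgroup_torsion_part]] cl_closed
  by (simp add: tf_class_def cl_add)

lemma tf_class_eq_iff:
  assumes x: "x \<in> Z" and y: "y \<in> Z"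
  shows "tf_class x = tf_class y \<longleftrightarrow> x - y \<in> torsion_relations"
proof -
  have "tf_class x = tf_class y \<longleftrightarrow> cl x \<in> torsion_part A #> cl y"
    unfolding tf_class_def
    using rcos_self[OF cl_closed[OF x] subgroup_torsion_part]
      repr_independence[OF _ cl_closed[OF y] subgroup_torsion_part] by blast
  also have "\<dots> \<longleftrightarrow> (\<exists>p\<in>torsion_relations. cl x = cl p \<otimes> cl y)"
    by (auto simp: r_coset_def torsion_part_eq)
  also have "\<dots> \<longleftrightarrow> (\<exists>p\<in>torsion_relations. x - (p + y) \<in> B)"
    using cl_add[OF torsion_relations_Z y] cl_eq_iff[OF x Z_add[OF torsion_relations_Z y]]
    by (metis (no_types, lifting))
  also have "\<dots> \<longleftrightarrow> x - y \<in> torsion_relations"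
  proof
    assume "\<exists>p\<in>torsion_relations. x - (p + y) \<in> B"
    then obtain p where "p \<in> torsion_relations" "x - (p + y) \<in> B" by blast
    then show "x - y \<in> torsion_relations"
      using torsion_relations_add[OF _ B_torsion, of p "x - (p + y)"] by (simp add: algebra_simps)
  next
    assume "x - y \<in> torsion_relations"
    then show "\<exists>p\<in>torsion_relations. x - (p + y) \<in> B"
      by (rule bexI[rotated]) (simp add: B_0)
  qed
  finally show ?thesis .
qed

lemma lookup_nat_sum:
  "coef (\<Sum>i<n. frag_cmul (a i) (frag_of i)) j = (if j < n then a j else 0)" for n j :: nat
  by (simp add: lookup_sum if_distrib[of "\<lambda>t. _ * t"] cong: if_cong)

text \<open>This direction shows that the choice of a basis in the definition of \<^const>\<open>free_trace\<close> is not
  vacuous.\<close>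
lemma iso_of_basis:
  assumes b: "basis_mod Z torsion_relations n z c"
  shows "\<exists>h. h \<in> iso (A Mod torsion_part A) (free_Abelian_group {..<n})"
proof -
  have z: "z i \<in> Z" if "i < n" for i using b that by (simp add: basis_mod_def)
  have c_diff: "c i (x - y) = c i x - c i y" if "i < n" "x \<in> Z" "y \<in> Z" for i x y
    using b that by (simp add: basis_mod_def)
  have cz: "c i (z j) = (if i = j then 1 else 0)" if "i < n" "j < n" for i j
    using b that by (simp add: basis_mod_def)
  have c0: "(\<forall>i<n. c i x = 0) \<longleftrightarrow> x \<in> torsion_relations" if "x \<in> Z" for x
    using b that by (simp add: basis_mod_def)
  define v where "v = (\<lambda>x. \<Sum>i<n. frag_cmul (c i x) (frag_of i))"
  define h where "h = (\<lambda>C. v (SOME x. x \<in> Z \<and> tf_class x = C))"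
  have v_eq: "v x = v y \<longleftrightarrow> tf_class x = tf_class y" if "x \<in> Z" "y \<in> Z" for x y
  proof -
    have "v x = v y \<longleftrightarrow> (\<forall>i<n. c i x = c i y)"
      using lookup_nat_sum[of "\<lambda>i. c i x"] lookup_nat_sum[of "\<lambda>i. c i y"]
      unfolding v_def by (auto simp: poly_mapping_eq_iff fun_eq_iff)
    also have "\<dots> \<longleftrightarrow> (\<forall>i<n. c i (x - y) = 0)" using c_diff that by auto
    finally show ?thesis using c0[OF Z_diff[OF that]] tf_class_eq_iff[OF that] by simp
  qed
  have h: "h (tf_class x) = v x" if "x \<in> Z" for x
  proof -
    have "(SOME y. y \<in> Z \<and> tf_class y = tf_class x) \<in> Z \<and>
        tf_class (SOME y. y \<in> Z \<and> tf_class y = tf_class x) = tf_class x"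
      by (rule someI[of _ x]) (simp add: that)
    then show ?thesis using v_eq[OF _ that] unfolding h_def by blast
  qed
  have v_add: "v (x + y) = v x + v y" if "x \<in> Z" "y \<in> Z" for x y
    unfolding v_def sum.distrib[symmetric] using basis_mod_linear(3)[OF Z b _ that]
    by (intro sum.cong) (auto simp: frag_cmul_distrib)
  have v_in: "supp (v x) \<subseteq> {..<n}" for x
    using lookup_nat_sum[of "\<lambda>i. c i x" n] unfolding v_def by (auto simp: in_keys_iff split: if_splits)
  have surj: "u \<in> v ` Z" if "supp u \<subseteq> {..<n}" for u
  proof
    let ?x = "\<Sum>j<n. frag_cmul (coef u j) (z j)"
    show "?x \<in> Z" by (intro Z_sum Z_cmul z) simp
    have "c i ?x = coef u i" if "i < n" for i
    proof -
      have "c i ?x = (\<Sum>j<n. c i (frag_cmul (coef u j) (z j)))"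
        by (rule basis_mod_linear(5)[OF Z b that]) (intro Z_cmul z, simp)
      also have "\<dots> = (\<Sum>j<n. if j = i then coef u i else 0)"
        using that by (intro sum.cong refl) (auto simp: basis_mod_linear(4)[OF Z b that z] cz)
      finally show ?thesis using that by simp
    qed
    then show "u = v ?x"
      using that lookup_nat_sum[of "\<lambda>i. c i ?x" n] unfolding v_def
      by (intro poly_mapping_eqI) (auto simp: in_keys_iff subset_iff)
  qed
  have "h \<in> iso (A Mod torsion_part A) (free_Abelian_group {..<n})"
  proof (rule isoI)
    show "h \<in> hom (A Mod torsion_part A) (free_Abelian_group {..<n})"
      by (rule homI) (auto simp: carrier_tf h tf_class_add v_add Z_add dest: subsetD[OF v_in])
    show "bij_betw h (carrier (A Mod torsion_part A)) (carrier (free_Abelian_group {..<n}))"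
      unfolding bij_betw_def carrier_tf
    proof
      show "inj_on h (tf_class ` Z)" by (rule inj_onI) (auto simp: h v_eq)
      have "h ` tf_class ` Z = v ` Z" by (auto simp: image_iff h)
      also have "\<dots> = carrier (free_Abelian_group {..<n})"
        using v_in surj by (auto simp only: carrier_free_Abelian_group_iff)
      finally show "h ` tf_class ` Z = carrier (free_Abelian_group {..<n})" .
    qed
  qed
  then show ?thesis by blast
qed

text \<open>Conversely, the isomorphism with \<open>\<int>\<^sup>n\<close> that \<^const>\<open>free_trace\<close> happens to choose pulls back to
  a basis of \<open>Z\<close> modulo torsion relations, and the trace is the sum of the diagonal entries in it. The
  trace formula accepts any such basis, so the choice may remain unspecified.\<close>
lemma torsion_free_trace_basis:
  assumes ex: "basis_mod Z torsion_relations n0 z0 c0"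
    and f: "\<And>x. x \<in> Z \<Longrightarrow> f x \<in> Z" "\<And>x y. x \<in> Z \<Longrightarrow> y \<in> Z \<Longrightarrow> f (x - y) = f x - f y"
      "\<And>x. x \<in> B \<Longrightarrow> f x \<in> B"
    and \<phi>: "\<And>x. x \<in> Z \<Longrightarrow> \<phi> (cl x) = cl (f x)"
  shows "\<exists>n z c. basis_mod Z torsion_relations n z c \<and>
    torsion_free_trace A \<phi> = (\<Sum>i<n. c i (f (z i)))"
proof -
  let ?Q = "A Mod torsion_part A" and ?T = "torsion_part A"
  let ?\<psi> = "\<lambda>C. ?T <#> (\<phi> ` C)"
  obtain n h where nh: "(SOME (n, h). h \<in> iso ?Q (free_Abelian_group {..<n::nat})) = (n, h)" by fastforce
  obtain h' where h': "h' \<in> iso ?Q (free_Abelian_group {..<n0})" using iso_of_basis[OF ex] by blast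
  have "(\<lambda>(n, h). h \<in> iso ?Q (free_Abelian_group {..<n::nat})) (SOME (n, h). h \<in> iso ?Q (free_Abelian_group {..<n::nat}))"
    by (rule someI[where x = "(n0, h')"]) (simp add: h')
  then have iso: "h \<in> iso ?Q (free_Abelian_group {..<n})" unfolding nh by simp
  have tr: "torsion_free_trace A \<phi> = (\<Sum>i<n. coef (h (?\<psi> (inv_into (carrier ?Q) h (frag_of i)))) i)"
    unfolding torsion_free_trace_def free_trace_def nh by simp
  have bij: "bij_betw h (carrier ?Q) (carrier (free_Abelian_group {..<n}))" and hom: "h \<in> hom ?Q (free_Abelian_group {..<n})"
    using iso by (auto simp: iso_def)
  have h_add: "h (tf_class (x + y)) = h (tf_class x) + h (tf_class y)" if "x \<in> Z" "y \<in> Z" for x y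
    using hom_mult[OF hom, of "tf_class x" "tf_class y"] that by (simp add: carrier_tf tf_class_add)
  have h_diff: "h (tf_class (x - y)) = h (tf_class x) - h (tf_class y)" if "x \<in> Z" "y \<in> Z" for x y
    using h_add[OF Z_diff[OF that] that(2)] by simp
  have h_0: "h (tf_class 0) = 0" using h_diff[OF Z_0 Z_0] by simp
  have h_inj: "h (tf_class x) = 0 \<longleftrightarrow> x \<in> torsion_relations" if "x \<in> Z" for x
  proof -
    have "h (tf_class x) = h (tf_class 0) \<longleftrightarrow> tf_class x = tf_class 0"
      using bij that Z_0 by (intro inj_on_eq_iff[of h "carrier ?Q"]) (auto simp: bij_betw_def carrier_tf)
    then show ?thesis using h_0 tf_class_eq_iff[OF that Z_0] by simp
  qed
  have keys: "supp (h (tf_class x)) \<subseteq> {..<n}" if "x \<in> Z" for x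
    using bij that by (auto simp: bij_betw_def carrier_tf simp flip: carrier_free_Abelian_group_iff)
  have "\<exists>x. x \<in> Z \<and> tf_class x = inv_into (carrier ?Q) h (frag_of i) \<and> h (tf_class x) = frag_of i" if "i < n" for i
  proof -
    have "frag_of i \<in> h ` carrier ?Q" using bij that by (simp add: bij_betw_def)
    then have "inv_into (carrier ?Q) h (frag_of i) \<in> carrier ?Q" "h (inv_into (carrier ?Q) h (frag_of i)) = frag_of i"
      by (rule inv_into_into, intro f_inv_into_f)
    then show ?thesis unfolding carrier_tf by (metis imageE)
  qed
  then obtain z where z: "\<And>i. i < n \<Longrightarrow> z i \<in> Z"
    and zinv: "\<And>i. i < n \<Longrightarrow> tf_class (z i) = inv_into (carrier ?Q) h (frag_of i)"
    and hz: "\<And>i. i < n \<Longrightarrow> h (tf_class (z i)) = frag_of i" by metis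
  define c where "c = (\<lambda>i x. coef (h (tf_class x)) i)"
  have "basis_mod Z torsion_relations n z c"
    unfolding basis_mod_def
  proof (intro conjI allI impI ballI)
    fix x assume x: "x \<in> Z"
    have "(\<forall>i<n. c i x = 0) \<longleftrightarrow> h (tf_class x) = 0"
    proof
      assume "\<forall>i<n. c i x = 0"
      then have "i \<notin> supp (h (tf_class x))" for i
        using keys[OF x] by (cases "i < n") (auto simp: c_def in_keys_iff)
      then show "h (tf_class x) = 0" by (metis all_not_in_conv keys_eq_empty)
    qed (simp add: c_def)
    then show "(\<forall>i<n. c i x = 0) \<longleftrightarrow> x \<in> torsion_relations" using h_inj[OF x] by simp
  qed (auto simp: z hz c_def h_diff lookup_minus)
  moreover have "?\<psi> (tf_class x) = tf_class (f x)" if x: "x \<in> Z" for x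
  proof -
    have f_add: "f (p + x) = f p + f x" if "p \<in> Z" for p
      using f(2)[OF that Z_diff[OF Z_0 x]] f(2)[OF Z_0 x] f(2)[OF Z_0 Z_0] by simp
    have f_cmul: "f (frag_cmul (int m) p) = frag_cmul (int m) (f p)" if p: "p \<in> Z" for m p
    proof (induction m)
      case 0
      then show ?case using f(2)[OF Z_0 Z_0] by simp
    next
      case (Suc m)
      have "f (frag_cmul (int m) p - (0 - p)) = f (frag_cmul (int m) p) - (f 0 - f p)"
        using p by (simp only: f(2) Z_diff Z_0 Z_cmul)
      then show ?case using Suc f(2)[OF Z_0 Z_0] by (simp add: frag_cmul_distrib add.commute)
    qed
    have f_tors: "f p \<in> torsion_relations" if "p \<in> torsion_relations" for p
    proof -
      obtain m where m: "m > 0" "frag_cmul m p \<in> B" "p \<in> Z" using \<open>p \<in> torsion_relations\<close>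
        by (auto simp: torsion_relations_def)
      then have "frag_cmul m (f p) \<in> B" using f(3)[OF m(2)] f_cmul[OF m(3), of "nat m"] by simp
      then show ?thesis using m f(1) by (auto simp: torsion_relations_def)
    qed
    have "\<phi> ` tf_class x = {\<phi> (cl p \<otimes> cl x) | p. p \<in> torsion_relations}"
      by (auto simp: tf_class_def r_coset_def torsion_part_eq)
    also have "\<dots> = {cl (f p) \<otimes> cl (f x) | p. p \<in> torsion_relations}"
    proof -
      have "\<phi> (cl p \<otimes> cl x) = cl (f p) \<otimes> cl (f x)" if "p \<in> torsion_relations" for p
        using torsion_relations_Z[OF that] x \<phi>[OF Z_add, of p x] f(1)
        by (simp add: cl_add f_add flip: cl_add)
      then show ?thesis by (metis (no_types, lifting))
    qed
    finally have im: "\<phi> ` tf_class x = {cl (f p) \<otimes> cl (f x) | p. p \<in> torsion_relations}" .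
    show ?thesis
    proof (intro equalityI subsetI)
      fix g assume "g \<in> ?\<psi> (tf_class x)"
      then obtain q p where "q \<in> torsion_relations" "p \<in> torsion_relations" "g = cl q \<otimes> (cl (f p) \<otimes> cl (f x))"
        by (auto simp: set_mult_def im torsion_part_eq)
      moreover from this have "g = cl (q + f p) \<otimes> cl (f x)"
        using f_tors[of p] torsion_relations_Z f(1)[OF x] cl_closed
        by (simp add: cl_add m_assoc)
      ultimately have "q + f p \<in> torsion_relations" "g = cl (q + f p) \<otimes> cl (f x)"
        using torsion_relations_add[OF _ f_tors, of q p] by blast+
      then show "g \<in> tf_class (f x)"
        unfolding tf_class_def r_coset_def torsion_part_eq by blast
    next
      fix g assume "g \<in> tf_class (f x)"
      then obtain q where q: "q \<in> torsion_relations" "g = cl q \<otimes> cl (f x)"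
        by (auto simp: tf_class_def r_coset_def torsion_part_eq)
      have "cl (f 0) \<otimes> cl (f x) = cl (f x)"
        using f(2)[OF Z_0 Z_0] cl_0 cl_closed[OF f(1)[OF x]] by simp
      then have "cl (f x) \<in> \<phi> ` tf_class x" unfolding im using B_torsion[OF B_0] by force
      then show "g \<in> ?\<psi> (tf_class x)"
        using q unfolding set_mult_def torsion_part_eq by blast
    qed
  qed
  then have "torsion_free_trace A \<phi> = (\<Sum>i<n. c i (f (z i)))"
    unfolding tr by (intro sum.cong refl) (simp add: c_def z zinv[symmetric])
  ultimately show ?thesis by blast
qed

end

section \<open>Order complexes and acyclic carriers\<close>

text \<open>Degrees are shifted by one: degree \<open>0\<close> holds the augmentation. For an augmented complex,
  exactness in all degrees thus says that the unaugmented one has the homology of a point.\<close>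
definition exact_complex :: "(nat \<Rightarrow> 'b \<Rightarrow> 'b \<Rightarrow>\<^sub>0 int) \<Rightarrow> (nat \<Rightarrow> 'b set) \<Rightarrow> bool"
  where "exact_complex D K \<longleftrightarrow> (\<forall>n. \<forall>c\<in>frags (K n). frag_extend (D n) c = 0 \<longrightarrow>
    (\<exists>b\<in>frags (K (Suc n)). frag_extend (D (Suc n)) b = c))"

text \<open>The alternating sum of the faces. The empty list is the simplex of dimension \<open>-1\<close>, so the
  augmentation is included; the recursion is the boundary formula of a cone.\<close>
primrec list_boundary :: "'a list \<Rightarrow> ('a list \<Rightarrow>\<^sub>0 int)"
  where
    "list_boundary [] = 0"
  | "list_boundary (x # xs) =
      frag_of xs - frag_extend (\<lambda>ys. frag_of (x # ys)) (list_boundary xs)"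

abbreviation bd :: "('a list \<Rightarrow>\<^sub>0 int) \<Rightarrow> ('a list \<Rightarrow>\<^sub>0 int)"
  where "bd \<equiv> frag_extend list_boundary"

lemma list_boundary_cone:
  "bd (frag_extend (\<lambda>ys. frag_of (x # ys)) c) =
    c - frag_extend (\<lambda>ys. frag_of (x # ys)) (bd c)"
  by (simp add: frag_extend_extend frag_extend_fun_diff)

lemma list_boundary_list_boundary: "bd (list_boundary xs) = 0"
  by (induction xs) (simp_all add: frag_extend_diff list_boundary_cone)

lemma keys_list_boundary:
  "ys \<in> supp (list_boundary xs) \<Longrightarrow>
    length xs = Suc (length ys) \<and> set ys \<subseteq> set xs \<and> (sorted_wrt r xs \<longrightarrow> sorted_wrt r ys)"
proof (induction xs arbitrary: ys)
  case (Cons x xs)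
  then consider "ys = xs" | zs where "ys = x # zs" "zs \<in> supp (list_boundary xs)"
    using subsetD[OF keys_diff, of ys "frag_of xs"]
      subsetD[OF keys_frag_extend, of ys "\<lambda>ys. frag_of (x # ys)" "list_boundary xs"]
    by auto
  then show ?case
  proof cases
    case 2
    then show ?thesis using Cons.IH[of zs] by auto
  qed auto
qed simp

definition order_simplices :: "('a \<Rightarrow> 'a \<Rightarrow> bool) \<Rightarrow> 'a set \<Rightarrow> nat \<Rightarrow> 'a list set"
  where "order_simplices r A n = {xs. sorted_wrt r xs \<and> set xs \<subseteq> A \<and> length xs = n}"

lemma list_boundary_in:
  assumes "xs \<in> order_simplices r A (Suc n)"
  shows "list_boundary xs \<in> frags (order_simplices r A n)"
  using assms by (auto simp: frags_def order_simplices_def dest: keys_list_boundary[of _ xs r])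

lemma order_simplices_mono: "A \<subseteq> B \<Longrightarrow> order_simplices r A n \<subseteq> order_simplices r B n"
  by (auto simp: order_simplices_def)

text \<open>With a vertex \<open>x\<close> that may be put in front of every other one, \<open>ys \<mapsto> x # ys\<close> (and \<open>0\<close> if \<open>x\<close>
  occurs already) is a contraction of the augmented complex.\<close>
lemma exact_order_complex_cone:
  assumes x: "x \<in> A" and max: "\<And>y. y \<in> A \<Longrightarrow> y \<noteq> x \<Longrightarrow> r x y"
    and asym: "\<And>y z. r y z \<Longrightarrow> \<not> r z y"
  shows "exact_complex (\<lambda>_. list_boundary) (order_simplices r A)"
  unfolding exact_complex_def
proof (intro allI ballI impI)
  fix n c assume c: "c \<in> frags (order_simplices r A n)" and c0: "bd c = 0"
  define h where "h = (\<lambda>ys. if x \<in> set ys then 0 else frag_of (x # ys))"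
  have h_cone: "frag_extend h (frag_extend (\<lambda>ys. frag_of (x # ys)) d) = 0" for d
    unfolding frag_extend_extend by (intro frag_extend_eq_0) (simp add: h_def)
  have h_off: "frag_extend h (list_boundary ys) = frag_extend (\<lambda>ys. frag_of (x # ys)) (list_boundary ys)"
    if "x \<notin> set ys" for ys
  proof (rule frag_extend_eq)
    fix zs assume "zs \<in> supp (list_boundary ys)"
    then have "set zs \<subseteq> set ys" using keys_list_boundary by blast
    then show "h zs = frag_of (x # zs)" using that by (auto simp: h_def)
  qed
  have homotopy: "bd (h ys) + frag_extend h (list_boundary ys) = frag_of ys"
    if ys: "ys \<in> order_simplices r A n" for ys
  proof (cases "x \<in> set ys")
    case False
    then show ?thesis using h_off[OF False] by (simp add: h_def)
  next
    case True
    then obtain y zs where yzs: "ys = y # zs" by (cases ys) auto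
    have "y = x"
    proof (rule ccontr)
      assume "y \<noteq> x"
      then have "r y x" "r x y" using ys True max by (auto simp: yzs order_simplices_def)
      then show False using asym by blast
    qed
    moreover have "x \<notin> set zs"
      using ys asym by (auto simp: yzs order_simplices_def \<open>y = x\<close>)
    ultimately show ?thesis
      by (simp add: yzs frag_extend_diff h_cone) (simp add: h_def)
  qed
  have "bd (frag_extend h c) + frag_extend h (bd c) = c"
    unfolding frag_extend_extend frag_extend_fun_add[symmetric]
    using frag_extend_cong_frags[OF c homotopy] by simp
  then have "bd (frag_extend h c) = c" using c0 by simp
  moreover have "frag_extend h c \<in> frags (order_simplices r A (Suc n))"
    using c
  proof (rule frags_extend)
    fix ys assume ys: "ys \<in> order_simplices r A n"
    show "h ys \<in> frags (order_simplices r A (Suc n))"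
      using ys x max by (auto simp: h_def order_simplices_def)
  qed
  ultimately show "\<exists>b\<in>frags (order_simplices r A (Suc n)). bd b = c"
    by blast
qed

text \<open>Solves \<open>d (h xs) = g xs + e h (\<partial> xs)\<close> with \<open>h xs\<close> in the carrier, by recursion on the length of
  \<open>xs\<close>: the right-hand side is a cycle by \<open>dg\<close>, and the carrier is exact. The case \<open>j = 0\<close>,
  \<open>g = 0\<close>, \<open>e = 1\<close> constructs chain maps; the case \<open>j = 1\<close>, \<open>g = \<phi> - \<psi>\<close>, \<open>e = -1\<close> constructs chain
  homotopies between \<open>\<phi>\<close> and \<open>\<psi>\<close>.\<close>
lemma acyclic_carrier_solution:
  fixes D :: "nat \<Rightarrow> 'b \<Rightarrow> 'b \<Rightarrow>\<^sub>0 int" and K :: "'a list \<Rightarrow> nat \<Rightarrow> 'b set"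
    and g :: "'a list \<Rightarrow> 'b \<Rightarrow>\<^sub>0 int" and e :: int and j :: nat and S :: "'a list set"
  assumes closed: "\<And>xs ys. xs \<in> S \<Longrightarrow> ys \<in> supp (list_boundary xs) \<Longrightarrow> ys \<in> S"
    and mono: "\<And>xs ys n. xs \<in> S \<Longrightarrow> ys \<in> supp (list_boundary xs) \<Longrightarrow> K ys n \<subseteq> K xs n"
    and exact: "\<And>xs. xs \<in> S \<Longrightarrow> xs \<noteq> [] \<Longrightarrow> exact_complex D (K xs)"
    and g: "\<And>xs. xs \<in> S \<Longrightarrow> xs \<noteq> [] \<Longrightarrow> g xs \<in> frags (K xs (length xs - 1 + j))"
    and dg: "\<And>xs. xs \<in> S \<Longrightarrow> xs \<noteq> [] \<Longrightarrow> frag_extend (D (length xs - 1 + j)) (g xs)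
      + frag_cmul e (frag_extend g (list_boundary xs)) = 0"
    and h0: "h0 \<in> frags (K [] j)" "frag_extend (D j) h0 = g []"
  shows "\<exists>h. h [] = h0 \<and> (\<forall>xs\<in>S. h xs \<in> frags (K xs (length xs + j)) \<and>
    frag_extend (D (length xs + j)) (h xs) = g xs + frag_cmul e (frag_extend h (list_boundary xs)))"
proof -
  define H where "H = rec_nat (\<lambda>_. h0) (\<lambda>n f xs. SOME b. b \<in> frags (K xs (Suc n + j)) \<and>
    frag_extend (D (Suc n + j)) b = g xs + frag_cmul e (frag_extend f (list_boundary xs)))"
  define h where "h = (\<lambda>xs. H (length xs) xs)"
  have h_eq: "frag_extend h (list_boundary xs) = frag_extend (H (length xs - 1)) (list_boundary xs)" for xs
  proof (rule frag_extend_eq)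
    fix ys assume "ys \<in> supp (list_boundary xs)"
    then have "length xs = Suc (length ys)" using keys_list_boundary by blast
    then show "h ys = H (length xs - 1) ys" by (simp add: h_def)
  qed
  have "h xs \<in> frags (K xs (length xs + j)) \<and>
      frag_extend (D (length xs + j)) (h xs) = g xs + frag_cmul e (frag_extend h (list_boundary xs))"
    if "xs \<in> S" for xs
    using that
  proof (induction "length xs" arbitrary: xs)
    case 0
    then show ?case using h0 by (simp add: h_def H_def)
  next
    case (Suc n)
    let ?c = "g xs + frag_cmul e (frag_extend h (list_boundary xs))"
    have ne: "xs \<noteq> []" and len: "length xs = Suc n" "length xs - 1 = n" using Suc.hyps(2) by auto
    have faces: "ys \<in> S \<and> length ys = n \<and> K ys (n + j) \<subseteq> K xs (n + j)"
      if "ys \<in> supp (list_boundary xs)" for ys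
      using closed[OF Suc.prems that] mono[OF Suc.prems that] keys_list_boundary[OF that] len by simp
    have bd: "list_boundary xs \<in> frags {ys \<in> supp (list_boundary xs). True}"
      by (auto simp: frags_def)
    have "frag_extend h (list_boundary xs) \<in> frags (K xs (n + j))"
    proof (rule frags_extend[OF bd])
      fix ys assume "ys \<in> {ys \<in> supp (list_boundary xs). True}"
      then have "ys \<in> S" "length ys = n" "K ys (n + j) \<subseteq> K xs (n + j)" using faces by auto
      then show "h ys \<in> frags (K xs (n + j))"
        using Suc.hyps(1)[of ys] by (auto intro: frags_mono)
    qed
    then have c: "?c \<in> frags (K xs (n + j))"
      using g[OF Suc.prems ne] len by (auto intro: frags_add frags_cmul)
    have "frag_extend (D (n + j)) (frag_extend h (list_boundary xs)) =
        frag_extend (\<lambda>ys. g ys + frag_cmul e (frag_extend h (list_boundary ys))) (list_boundary xs)"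
      unfolding frag_extend_extend
    proof (rule frag_extend_eq)
      fix ys assume "ys \<in> supp (list_boundary xs)"
      then show "frag_extend (D (n + j)) (h ys) = g ys + frag_cmul e (frag_extend h (list_boundary ys))"
        using faces[of ys] Suc.hyps(1)[of ys] by auto
    qed
    also have "\<dots> = frag_extend g (list_boundary xs)"
      by (simp add: frag_extend_fun_add frag_extend_fun_cmul list_boundary_list_boundary
          flip: frag_extend_extend)
    finally have "frag_extend (D (n + j)) ?c = 0"
      using dg[OF Suc.prems ne] len by (simp add: frag_extend_add frag_extend_cmul)
    then have "\<exists>b. b \<in> frags (K xs (Suc (n + j))) \<and> frag_extend (D (Suc (n + j))) b = ?c"
      using exact[OF Suc.prems ne] c unfolding exact_complex_def by blast
    moreover have "h xs = (SOME b. b \<in> frags (K xs (Suc (n + j))) \<and> frag_extend (D (Suc (n + j))) b = ?c)"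
      unfolding h_eq len(2) by (simp add: h_def len(1) H_def)
    ultimately have "h xs \<in> frags (K xs (Suc (n + j))) \<and> frag_extend (D (Suc (n + j))) (h xs) = ?c"
      by (simp only:) (rule someI_ex)
    then show ?case by (simp add: len)
  qed
  moreover have "h [] = h0" by (simp add: h_def H_def)
  ultimately show ?thesis by blast
qed

section \<open>The augmented singular complex\<close>

text \<open>A formal simplex of dimension \<open>-1\<close>; its multiples form the target of the augmentation, so that the
  augmented complex lives in the type of singular chains.\<close>
definition empty_simplex :: "(nat \<Rightarrow> real) \<Rightarrow> 'a"
  where "empty_simplex = (\<lambda>_. undefined)"

fun aug_simplices :: "'a topology \<Rightarrow> nat \<Rightarrow> ((nat \<Rightarrow> real) \<Rightarrow> 'a) set"
  where
    "aug_simplices X 0 = {empty_simplex}"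
  | "aug_simplices X (Suc m) = singular_simplex_set m X"

fun aug_boundary :: "nat \<Rightarrow> ((nat \<Rightarrow> real) \<Rightarrow> 'a) \<Rightarrow> 'a chain"
  where
    "aug_boundary 0 f = 0"
  | "aug_boundary (Suc 0) f = frag_of empty_simplex"
  | "aug_boundary (Suc (Suc m)) f = chain_boundary (Suc m) (frag_of f)"

abbreviation aug_bd :: "nat \<Rightarrow> 'a chain \<Rightarrow> 'a chain"
  where "aug_bd n \<equiv> frag_extend (aug_boundary n)"

lemma frags_aug_simplices: "c \<in> frags (aug_simplices X (Suc m)) \<longleftrightarrow> singular_chain m X c"
  by (simp add: frags_def singular_chain_def)

lemma aug_boundary_extend:
  "aug_bd (Suc (Suc m)) c = chain_boundary (Suc m) c"
  using subset_UNIV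
  by (induction c rule: frag_induction) (auto simp: frag_extend_diff chain_boundary_diff)

lemma aug_boundary_in:
  "c \<in> frags (aug_simplices X (Suc n)) \<Longrightarrow> aug_bd (Suc n) c \<in> frags (aug_simplices X n)"
proof (cases n)
  case 0
  then show ?thesis by (auto intro!: frags_extend[where S = UNIV] simp: frags_def[of UNIV])
next
  case (Suc m)
  then show "c \<in> frags (aug_simplices X (Suc n)) \<Longrightarrow> ?thesis"
    by (simp only: frags_aug_simplices aug_boundary_extend singular_chain_boundary_alt)
qed

lemma aug_boundary_aug_boundary:
  assumes "c \<in> frags (aug_simplices X (Suc n))"
  shows "aug_bd n (aug_bd (Suc n) c) = 0"
proof -
  consider "n = 0" | "n = 1" | m where "n = Suc (Suc m)"
    by atomize_elim presburger
  then show ?thesis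
  proof cases
    case 1
    then show ?thesis by (simp add: frag_extend_eq_0)
  next
    case 2
    have "aug_bd 1 (aug_boundary 2 f) = 0" for f :: "(nat \<Rightarrow> real) \<Rightarrow> 'a"
      by (simp add: numeral_2_eq_2 chain_boundary_of frag_extend_add frag_extend_diff frag_extend_minus)
    then show ?thesis
      unfolding 2 frag_extend_extend by (simp add: frag_extend_eq_0 numeral_2_eq_2)
  next
    case 3
    then show ?thesis
      using assms chain_boundary_boundary_alt[of "Suc m" X c]
      by (simp only: frags_aug_simplices aug_boundary_extend)
  qed
qed

text \<open>Positive degrees are immediate from the triviality of the homology groups. In degree \<open>0\<close> the
  isomorphism of the groups gives the same number of path components as for a point, so the space is
  nonempty and any two points are homologous.\<close>
lemma acyclic_imp_exact_aug:
  assumes "acyclic_space A"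
  shows "exact_complex aug_boundary (aug_simplices A)"
proof -
  let ?pt = "discrete_topology {()}"
  have iso: "homology_group p A \<cong> homology_group p ?pt" for p
    using assms by (simp add: acyclic_space_def)
  have "path_components_of A \<approx> path_components_of ?pt"
    by (rule isomorphic_homology_imp_path_components[OF iso])
  then have "path_components_of ?pt \<approx> path_components_of A" by (rule eqpoll_sym)
  then have "topspace A \<noteq> {}"
    using path_components_of_eq_empty[of A] path_components_of_eq_empty[of ?pt] by auto
  have "path_connected_space A"
    using isomorphic_homology_imp_path_connectedness[OF iso]
    by (simp add: contractible_imp_path_connected_space)
  obtain a where a: "a \<in> topspace A" using \<open>topspace A \<noteq> {}\<close> by blast
  define f0 where "f0 = restrict (\<lambda>_. a) (standard_simplex 0)"
  have f0: "singular_simplex 0 A f0"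
    unfolding singular_simplex_def f0_def
    using a by (auto intro: continuous_map_eq[of _ _ "\<lambda>_. a"] simp: topspace_subtopology)
  show ?thesis
    unfolding exact_complex_def
  proof (intro allI ballI impI)
    fix n and c :: "'a chain" assume c: "c \<in> frags (aug_simplices A n)" and c0: "aug_bd n c = 0"
    consider "n = 0" | "n = 1" | m where "n = Suc (Suc m)"
      by atomize_elim presburger
    then show "\<exists>b\<in>frags (aug_simplices A (Suc n)). aug_bd (Suc n) b = c"
    proof cases
      case 1
      have "frag_cmul (coef c empty_simplex) (frag_of empty_simplex) = c"
        using c 1 by (intro poly_mapping_eqI) (auto simp: frags_def in_keys_iff)
      then show ?thesis
        using f0 1 by (intro bexI[of _ "frag_cmul (coef c empty_simplex) (frag_of f0)"])
          (auto simp: frag_extend_cmul intro: frags_cmul)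
    next
      case 2
      have "\<exists>b. singular_chain 1 A b \<and> chain_boundary 1 b = c - frag_extend (\<lambda>_. frag_of f0) c"
        using c unfolding 2
      proof (induction c rule: frags_induct)
        case zero
        then show ?case by (intro exI[of _ 0]) simp
      next
        case (one f)
        then have "homologous_rel 0 A {} (frag_of f) (frag_of f0)"
          using iso_integer_zeroth_homology_group_aux[OF \<open>path_connected_space A\<close> _ f0] by simp
        then show ?case by (simp add: homologous_rel_def singular_boundary)
      next
        case (diff x y)
        then obtain b b' where "singular_chain 1 A b" "chain_boundary 1 b = x - frag_extend (\<lambda>_. frag_of f0) x"
          "singular_chain 1 A b'" "chain_boundary 1 b' = y - frag_extend (\<lambda>_. frag_of f0) y" by blast
        then show ?case
          by (intro exI[of _ "b - b'"]) (simp add: singular_chain_diff chain_boundary_diff frag_extend_diff)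
      qed
      then obtain b where b: "singular_chain 1 A b" "chain_boundary 1 b = c - frag_extend (\<lambda>_. frag_of f0) c"
        by blast
      have "frag_extend (\<lambda>_. frag_of f0) c = frag_extend (\<lambda>_. frag_of f0) (aug_bd 1 c)"
        by (simp add: frag_extend_extend)
      then have "chain_boundary 1 b = c" using b(2) c0 2 by simp
      then show ?thesis
        using b(1) aug_boundary_extend[of 0 b] unfolding 2
        by (intro bexI[of _ b]) (auto simp: frags_aug_simplices[of _ A 1, simplified])
    next
      case (3 m)
      have "trivial_group (homology_group (int (Suc m)) ?pt)"
        by (rule homology_dimension_axiom[of _ "()"]) auto
      then have "trivial_group (homology_group (int (Suc m)) A)"
        by (rule isomorphic_group_triviality[OF iso group_relative_homology_group
              group_relative_homology_group, THEN iffD2])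
      then have triv: "carrier (homology_group (int (Suc m)) A) = {singular_relboundary_set (Suc m) A {}}"
        by (simp only: trivial_group_def one_relative_homology_group)
      have "singular_relcycle (Suc m) A {} c"
        using c c0 unfolding 3 frags_aug_simplices aug_boundary_extend singular_cycle by blast
      then have "homologous_rel_set (Suc m) A {} c \<in> carrier (homology_group (int (Suc m)) A)"
        unfolding carrier_relative_homology_group by blast
      then have "homologous_rel_set (Suc m) A {} c = singular_relboundary_set (Suc m) A {}"
        unfolding triv by blast
      then have "singular_relboundary (Suc m) A {} c"
        by (simp only: homologous_rel_set_eq_relboundary)
      then obtain d where "singular_chain (Suc (Suc m)) A d" "chain_boundary (Suc (Suc m)) d = c"
        by (auto simp: singular_boundary)
      then show ?thesis
        unfolding 3 by (intro bexI[of _ d]) (simp_all only: frags_aug_simplices aug_boundary_extend)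
    qed
  qed
qed

text \<open>A space with a point \<open>x\<close> whose only neighbourhood is the whole space is contractible: the homotopy
  is constant \<open>x\<close> at time \<open>0\<close> and the identity at all later times.\<close>
lemma acyclic_space_greatest:
  assumes x: "x \<in> topspace X" and top: "\<And>U. openin X U \<Longrightarrow> x \<in> U \<Longrightarrow> U = topspace X"
  shows "acyclic_space X"
proof -
  let ?pt = "discrete_topology {()}"
  let ?h = "\<lambda>(t::real, y). if t = 0 then x else y"
  have cont: "continuous_map (prod_topology (top_of_set {0..1}) X) X ?h"
    unfolding continuous_map_def
  proof (intro conjI allI impI)
    show "?h \<in> topspace (prod_topology (top_of_set {0..1}) X) \<rightarrow> topspace X"
      using x by auto
    fix U assume U: "openin X U"
    show "openin (prod_topology (top_of_set {0..1}) X)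
        {p \<in> topspace (prod_topology (top_of_set {0..1}) X). ?h p \<in> U}" (is "openin ?P ?V")
    proof (cases "x \<in> U")
      case True
      then have "?V = topspace ?P" using top[OF U] x by auto
      then show ?thesis by (simp only: openin_topspace)
    next
      case False
      then have "?V = ({0..1} \<inter> {0<..}) \<times> U"
        using openin_subset[OF U] by (auto split: if_splits)
      moreover have "openin (top_of_set {0..1}) ({0..1} \<inter> {0<..} :: real set)"
        by (intro openin_open_Int open_greaterThan)
      ultimately show ?thesis using U by (simp add: openin_prod_Times_iff)
    qed
  qed
  have "homotopic_with (\<lambda>_. True) X X (\<lambda>_. x) id"
    unfolding homotopic_with_def using cont by (intro exI[of _ ?h]) auto
  then have "X homotopy_equivalent_space ?pt"
    unfolding homotopy_equivalent_space_def
    using x by (intro exI[of _ "\<lambda>_. ()"] exI[of _ "\<lambda>_. x"]) (auto simp: o_def id_def)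
  then show ?thesis
    unfolding acyclic_space_def by (blast intro: homotopy_equivalent_space_imp_isomorphic_homology_groups)
qed

section \<open>Finite \<open>T\<^sub>0\<close> spaces and their chains\<close>

definition finite_T0 :: "'a topology \<Rightarrow> bool"
  where "finite_T0 X \<longleftrightarrow> finite (topspace X) \<and> t0_space X"

lemma spec_le_refl: "x \<in> topspace X \<Longrightarrow> spec_le X x x"
  by (simp add: spec_le_def)

lemma spec_le_trans: "spec_le X x y \<Longrightarrow> spec_le X y z \<Longrightarrow> spec_le X x z"
  by (auto simp: spec_le_def)

lemma spec_le_antisym:
  assumes "finite_T0 X" "spec_le X x y" "spec_le X y x"
  shows "x = y"
proof (rule ccontr)
  assume "x \<noteq> y"
  have xy: "x \<in> topspace X" "y \<in> topspace X" using assms(2) by (auto simp: spec_le_def)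
  then obtain U where "openin X U" "x \<notin> U \<longleftrightarrow> y \<in> U"
    using assms(1) \<open>x \<noteq> y\<close> unfolding finite_T0_def t0_space_def by blast
  then show False
    using assms xy spec_le_iff[of X x y] spec_le_iff[of X y x] by (auto simp: finite_T0_def)
qed

text \<open>Chains are listed in decreasing order, so that a greatest element comes first and serves as the
  cone vertex.\<close>
definition spec_greater :: "'a topology \<Rightarrow> 'a \<Rightarrow> 'a \<Rightarrow> bool"
  where "spec_greater X x y \<longleftrightarrow> spec_less X y x"

lemma spec_greater_asym: "finite_T0 X \<Longrightarrow> spec_greater X x y \<Longrightarrow> \<not> spec_greater X y x"
  using spec_le_antisym by (fastforce simp: spec_greater_def spec_less_def)

abbreviation order_chains :: "'a topology \<Rightarrow> 'a set \<Rightarrow> nat \<Rightarrow> 'a list set"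
  where "order_chains X \<equiv> order_simplices (spec_greater X)"

abbreviation simplices :: "'a topology \<Rightarrow> nat \<Rightarrow> 'a list set"
  where "simplices X k \<equiv> order_chains X (topspace X) (Suc k)"

lemma acyclic_subspace_greatest:
  assumes X: "finite_T0 X" and A: "A \<subseteq> topspace X" and x: "x \<in> A" and max: "\<And>y. y \<in> A \<Longrightarrow> spec_le X y x"
  shows "acyclic_space (subtopology X A)"
proof (rule acyclic_space_greatest)
  show "x \<in> topspace (subtopology X A)" using x A by auto
  fix U assume "openin (subtopology X A) U" "x \<in> U"
  then obtain V where V: "openin X V" "U = V \<inter> A" "x \<in> V" by (auto simp: openin_subtopology)
  have "y \<in> V" if "y \<in> A" for y
    using max[OF that] V x A that spec_le_iff[of X y x] X by (auto simp: finite_T0_def)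
  then show "U = topspace (subtopology X A)" using V A by auto
qed

lemma exact_order_chains_greatest:
  assumes "finite_T0 X" "x \<in> A" "\<And>y. y \<in> A \<Longrightarrow> spec_le X y x"
  shows "exact_complex (\<lambda>_. list_boundary) (order_chains X A)"
  using assms by (intro exact_order_complex_cone[of x] spec_greater_asym)
    (auto simp: spec_greater_def spec_less_def)

lemma chain_list_greatest:
  assumes "sorted_wrt (spec_greater X) xs" "set xs \<subseteq> topspace X" "xs \<noteq> []" "y \<in> set xs"
  shows "spec_le X y (hd xs)"
  using assms by (cases xs) (auto simp: spec_greater_def spec_less_def spec_le_refl)

lemma aug_simplices_mono:
  "A \<subseteq> B \<Longrightarrow> aug_simplices (subtopology X A) n \<subseteq> aug_simplices (subtopology X B) n"
  by (cases n) (auto intro: singular_simplex_mono)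

section \<open>Chain maps with a common acyclic carrier\<close>

text \<open>The simplices of all dimensions, including the empty one.\<close>
definition order_lists :: "'a topology \<Rightarrow> 'a list set"
  where "order_lists X = {xs. sorted_wrt (spec_greater X) xs \<and> set xs \<subseteq> topspace X}"

text \<open>Cycles of the unaugmented complex, expressed with the augmented boundary: the condition is void
  for \<open>k = 0\<close>, and it says that the boundary is zero for \<open>k > 0\<close>.\<close>
definition simplicial_cycle :: "'a topology \<Rightarrow> nat \<Rightarrow> ('a list \<Rightarrow>\<^sub>0 int) \<Rightarrow> bool"
  where "simplicial_cycle X k c \<longleftrightarrow> c \<in> frags (simplices X k) \<and>
    bd c \<in> frags {[]}"

definition carried_map ::
    "'a topology \<Rightarrow> (nat \<Rightarrow> 'b \<Rightarrow> 'b \<Rightarrow>\<^sub>0 int) \<Rightarrow> ('a list \<Rightarrow> nat \<Rightarrow> 'b set) \<Rightarrow> ('a list \<Rightarrow> 'b \<Rightarrow>\<^sub>0 int) \<Rightarrow> bool"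
  where "carried_map X D K \<phi> \<longleftrightarrow> (\<forall>xs\<in>order_lists X. \<phi> xs \<in> frags (K xs (length xs)) \<and>
    frag_extend (D (length xs)) (\<phi> xs) = frag_extend \<phi> (list_boundary xs))"

definition acyclic_carrier :: "'a topology \<Rightarrow> (nat \<Rightarrow> 'b \<Rightarrow> 'b \<Rightarrow>\<^sub>0 int) \<Rightarrow> ('a list \<Rightarrow> nat \<Rightarrow> 'b set) \<Rightarrow> bool"
  where "acyclic_carrier X D K \<longleftrightarrow>
    (\<forall>xs\<in>order_lists X. \<forall>ys. set ys \<subseteq> set xs \<longrightarrow> (\<forall>n. K ys n \<subseteq> K xs n)) \<and>
    (\<forall>xs\<in>order_lists X. xs \<noteq> [] \<longrightarrow> exact_complex D (K xs))"

lemma order_lists_faces: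
  "xs \<in> order_lists X \<Longrightarrow> ys \<in> supp (list_boundary xs) \<Longrightarrow> ys \<in> order_lists X"
  using keys_list_boundary[of ys xs "spec_greater X"] by (auto simp: order_lists_def)

lemma carried_map_ex:
  assumes K: "acyclic_carrier X D K"
    and e: "e \<in> frags (K [] 0)" "frag_extend (D 0) e = 0"
  shows "\<exists>\<phi>. \<phi> [] = e \<and> carried_map X D K \<phi>"
proof -
  have "\<exists>h. h [] = e \<and> (\<forall>xs\<in>order_lists X. h xs \<in> frags (K xs (length xs + 0)) \<and>
      frag_extend (D (length xs + 0)) (h xs) = 0 + frag_cmul 1 (frag_extend h (list_boundary xs)))"
  proof (rule acyclic_carrier_solution)
    fix xs ys assume xs: "xs \<in> order_lists X" and ys: "ys \<in> supp (list_boundary xs)"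
    then show "ys \<in> order_lists X" by (rule order_lists_faces)
    show "K ys n \<subseteq> K xs n" for n
      using K xs keys_list_boundary[OF ys] unfolding acyclic_carrier_def by blast
  qed (use K e in \<open>auto simp: acyclic_carrier_def intro: frag_extend_eq_0\<close>)
  then show ?thesis by (simp add: carried_map_def)
qed

text \<open>The homotopy \<open>h\<close> between the two maps vanishes on the empty list, so it also works for cycles of
  degree \<open>0\<close>, which are not cycles of the augmented complex.\<close>
lemma carried_maps_homologous:
  assumes K: "acyclic_carrier X D K"
    and \<phi>: "carried_map X D K \<phi>" and \<psi>: "carried_map X D K \<psi>"
    and Nil: "\<phi> [] = \<psi> []"
    and T: "\<And>xs. xs \<in> order_lists X \<Longrightarrow> K xs (Suc (Suc k)) \<subseteq> T"
    and c: "simplicial_cycle X k c"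
  shows "\<exists>b\<in>frags T. frag_extend (D (Suc (Suc k))) b = frag_extend \<phi> c - frag_extend \<psi> c"
proof -
  have "\<exists>h. h [] = 0 \<and> (\<forall>xs\<in>order_lists X. h xs \<in> frags (K xs (length xs + 1)) \<and>
      frag_extend (D (length xs + 1)) (h xs) = (\<phi> xs - \<psi> xs) + frag_cmul (- 1) (frag_extend h (list_boundary xs)))"
  proof (rule acyclic_carrier_solution)
    fix xs ys assume xs: "xs \<in> order_lists X" and ys: "ys \<in> supp (list_boundary xs)"
    then show "ys \<in> order_lists X" by (rule order_lists_faces)
    show "K ys n \<subseteq> K xs n" for n
      using K xs keys_list_boundary[OF ys] unfolding acyclic_carrier_def by blast
  next
    fix xs assume xs: "xs \<in> order_lists X" "xs \<noteq> []"
    then have len: "length xs - 1 + 1 = length xs" by (cases xs) auto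
    show "exact_complex D (K xs)" using K xs by (simp add: acyclic_carrier_def)
    show "\<phi> xs - \<psi> xs \<in> frags (K xs (length xs - 1 + 1))"
      unfolding len using \<phi> \<psi> xs(1) by (auto simp: carried_map_def intro: frags_diff)
    show "frag_extend (D (length xs - 1 + 1)) (\<phi> xs - \<psi> xs) +
        frag_cmul (- 1) (frag_extend (\<lambda>xs. \<phi> xs - \<psi> xs) (list_boundary xs)) = 0"
      unfolding len using \<phi> \<psi> xs(1)
      by (simp add: carried_map_def frag_extend_diff frag_extend_fun_diff)
  qed (auto simp: Nil)
  then obtain h where h0: "h [] = 0" and hK: "\<And>xs. xs \<in> order_lists X \<Longrightarrow> h xs \<in> frags (K xs (length xs + 1))"
    and dh: "\<And>xs. xs \<in> order_lists X \<Longrightarrow> frag_extend (D (length xs + 1)) (h xs) =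
      (\<phi> xs - \<psi> xs) - frag_extend h (list_boundary xs)"
    by auto
  have cC: "c \<in> frags (simplices X k)" and lc: "bd c \<in> frags {[]}"
    using c by (auto simp: simplicial_cycle_def)
  have C: "xs \<in> order_lists X" "length xs = Suc k" if "xs \<in> simplices X k" for xs
    using that by (auto simp: order_lists_def order_simplices_def)
  have "frag_extend h c \<in> frags T"
    using cC
  proof (rule frags_extend)
    fix xs assume "xs \<in> simplices X k"
    then show "h xs \<in> frags T"
      using hK[of xs] C[of xs] T[of xs] by (auto intro: frags_mono)
  qed
  moreover have "frag_extend (D (Suc (Suc k))) (frag_extend h c) =
      frag_extend (\<lambda>xs. (\<phi> xs - \<psi> xs) - frag_extend h (list_boundary xs)) c"
    unfolding frag_extend_extend
    using cC
  proof (rule frag_extend_cong_frags)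
    fix xs assume "xs \<in> simplices X k"
    then show "frag_extend (D (Suc (Suc k))) (h xs) = (\<phi> xs - \<psi> xs) - frag_extend h (list_boundary xs)"
      using dh[of xs] C[of xs] by simp
  qed
  moreover have "\<dots> = frag_extend \<phi> c - frag_extend \<psi> c - frag_extend h (bd c)"
    by (simp add: frag_extend_fun_diff frag_extend_extend)
  moreover have "frag_extend h (bd c) = 0"
    using lc by (rule frag_extend_zero_on) (simp add: h0)
  ultimately show ?thesis by auto
qed

section \<open>The order complex computes singular homology\<close>

text \<open>The chain-level form of McCord's weak equivalence from the order complex to the finite space. It
  is described by its carrier alone, which determines it up to homotopy.\<close>
definition mccord_map :: "'a topology \<Rightarrow> ('a list \<Rightarrow> 'a chain) \<Rightarrow> bool"
  where "mccord_map X \<eta> \<longleftrightarrow> \<eta> [] = frag_of empty_simplex \<and>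
    carried_map X aug_boundary (\<lambda>xs. aug_simplices (subtopology X (set xs))) \<eta>"

lemma mccord_map_ex:
  assumes X: "finite_T0 X"
  shows "\<exists>\<eta>. mccord_map X \<eta>"
  unfolding mccord_map_def
proof (rule carried_map_ex)
  show "acyclic_carrier X aug_boundary (\<lambda>xs. aug_simplices (subtopology X (set xs)))"
    unfolding acyclic_carrier_def
  proof (intro conjI ballI allI impI)
    fix xs assume "xs \<in> order_lists X" "xs \<noteq> []"
    then show "exact_complex aug_boundary (aug_simplices (subtopology X (set xs)))"
      using chain_list_greatest[of X xs]
      by (intro acyclic_imp_exact_aug acyclic_subspace_greatest[OF X, of _ "hd xs"])
        (auto simp: order_lists_def)
  qed (rule aug_simplices_mono)
qed auto

lemma mccord_map_frags:
  assumes "mccord_map X \<eta>" "A \<subseteq> topspace X" "c \<in> frags (order_chains X A n)"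
  shows "frag_extend \<eta> c \<in> frags (aug_simplices (subtopology X A) n)"
  using assms(3)
proof (rule frags_extend)
  fix xs assume xs: "xs \<in> order_chains X A n"
  then have "\<eta> xs \<in> frags (aug_simplices (subtopology X (set xs)) n)"
    using assms(1,2) by (auto simp: mccord_map_def carried_map_def order_lists_def order_simplices_def)
  then show "\<eta> xs \<in> frags (aug_simplices (subtopology X A) n)"
    by (rule frags_mono) (use xs in \<open>auto intro!: aug_simplices_mono simp: order_simplices_def\<close>)
qed

lemma mccord_map_boundary:
  assumes "mccord_map X \<eta>" "A \<subseteq> topspace X" "c \<in> frags (order_chains X A n)"
  shows "aug_bd n (frag_extend \<eta> c) = frag_extend \<eta> (bd c)"
  unfolding frag_extend_extend
  using assms(3)
proof (rule frag_extend_cong_frags)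
  fix xs assume "xs \<in> order_chains X A n"
  then show "aug_bd n (\<eta> xs) = frag_extend \<eta> (list_boundary xs)"
    using assms(1,2) by (auto simp: mccord_map_def carried_map_def order_lists_def order_simplices_def)
qed

lemma list_boundary_frags:
  assumes "c \<in> frags (order_simplices r A (Suc n))"
  shows "bd c \<in> frags (order_simplices r A n)"
  using assms by (rule frags_extend) (rule list_boundary_in)

lemma list_boundary_twice: "bd (bd c) = 0"
  unfolding frag_extend_extend by (simp add: list_boundary_list_boundary frag_extend_eq_0)

text \<open>Acyclicity of the mapping cone of \<open>\<eta>\<close> on the subspace \<open>A\<close>, in terms of cone cycles
  \<open>(c, a)\<close> and cone boundaries. It contains both injectivity and surjectivity of \<open>\<eta>\<close> on homology, and it
  is better suited to Mayer-Vietoris arguments than these.\<close>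
definition comparison_exact :: "'a topology \<Rightarrow> ('a list \<Rightarrow> 'a chain) \<Rightarrow> 'a set \<Rightarrow> bool"
  where "comparison_exact X \<eta> A \<longleftrightarrow>
    (\<forall>n. \<forall>c\<in>frags (order_chains X A n). \<forall>a\<in>frags (aug_simplices (subtopology X A) (Suc n)).
      bd c = 0 \<longrightarrow>
      aug_bd (Suc n) a = frag_extend \<eta> c \<longrightarrow>
      (\<exists>c'\<in>frags (order_chains X A (Suc n)).
       \<exists>b\<in>frags (aug_simplices (subtopology X A) (Suc (Suc n))).
         bd c' = c \<and>
         a = frag_extend \<eta> c' + aug_bd (Suc (Suc n)) b))"

lemma comparison_exactD:
  assumes "comparison_exact X \<eta> A" "c \<in> frags (order_chains X A n)"
    "a \<in> frags (aug_simplices (subtopology X A) (Suc n))" "bd c = 0"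
    "aug_bd (Suc n) a = frag_extend \<eta> c"
  obtains c' b where "c' \<in> frags (order_chains X A (Suc n))"
    "b \<in> frags (aug_simplices (subtopology X A) (Suc (Suc n)))"
    "bd c' = c"
    "a = frag_extend \<eta> c' + aug_bd (Suc (Suc n)) b"
  using assms unfolding comparison_exact_def by blast

lemma comparison_exact_greatest:
  assumes X: "finite_T0 X" and \<eta>: "mccord_map X \<eta>" and A: "A \<subseteq> topspace X"
    and x: "x \<in> A" "\<And>y. y \<in> A \<Longrightarrow> spec_le X y x"
  shows "comparison_exact X \<eta> A"
  unfolding comparison_exact_def
proof (intro allI ballI impI)
  fix n c a assume c: "c \<in> frags (order_chains X A n)" and a: "a \<in> frags (aug_simplices (subtopology X A) (Suc n))"
    and c0: "bd c = 0" and da: "aug_bd (Suc n) a = frag_extend \<eta> c"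
  obtain c' where c': "c' \<in> frags (order_chains X A (Suc n))" "bd c' = c"
    using exact_order_chains_greatest[OF X x] c c0 unfolding exact_complex_def by blast
  let ?z = "a - frag_extend \<eta> c'"
  have "?z \<in> frags (aug_simplices (subtopology X A) (Suc n))"
    by (intro frags_diff a mccord_map_frags[OF \<eta> A] c')
  moreover have "aug_bd (Suc n) ?z = 0"
    using mccord_map_boundary[OF \<eta> A c'(1)] by (simp add: frag_extend_diff da c'(2))
  moreover have "exact_complex aug_boundary (aug_simplices (subtopology X A))"
    by (rule acyclic_imp_exact_aug[OF acyclic_subspace_greatest[OF X A x]])
  ultimately obtain b where b: "b \<in> frags (aug_simplices (subtopology X A) (Suc (Suc n)))"
    "aug_bd (Suc (Suc n)) b = ?z"
    unfolding exact_complex_def by blast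
  then have "a = frag_extend \<eta> c' + aug_bd (Suc (Suc n)) b" by simp
  then show "\<exists>c'\<in>frags (order_chains X A (Suc n)). \<exists>b\<in>frags (aug_simplices (subtopology X A) (Suc (Suc n))).
      bd c' = c \<and> a = frag_extend \<eta> c' + aug_bd (Suc (Suc n)) b"
    using c' b(1) by blast
qed

lemma comparison_exact_empty:
  assumes \<eta>: "mccord_map X \<eta>"
  shows "comparison_exact X \<eta> {}"
  unfolding comparison_exact_def
proof (intro allI ballI impI)
  fix n c a assume c: "c \<in> frags (order_chains X {} n)" and a: "a \<in> frags (aug_simplices (subtopology X {}) (Suc n))"
    and da: "aug_bd (Suc n) a = frag_extend \<eta> c"
  have "a = 0"
    using a unfolding frags_aug_simplices by (simp add: singular_chain_empty)
  have keys: "supp c \<subseteq> {[]}"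
    using c by (auto simp: frags_def order_simplices_def)
  have "c = frag_cmul (coef c []) (frag_of [])"
    using keys by (intro poly_mapping_eqI) (auto simp: in_keys_iff)
  moreover from this have "frag_extend \<eta> c = frag_cmul (coef c []) (frag_of empty_simplex)"
    using \<eta> by (metis frag_extend_cmul frag_extend_of mccord_map_def)
  then have "coef c [] = 0" using da \<open>a = 0\<close> by simp
  ultimately have "c = 0" by simp
  then show "\<exists>c'\<in>frags (order_chains X {} (Suc n)). \<exists>b\<in>frags (aug_simplices (subtopology X {}) (Suc (Suc n))).
      bd c' = c \<and> a = frag_extend \<eta> c' + aug_bd (Suc (Suc n)) b"
    using \<open>a = 0\<close> by (intro bexI[of _ 0]) auto
qed

text \<open>Iterated subdivision makes \<open>a\<close> small of order \<open>{U, V}\<close>. The error term of the subdivision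
  homotopy on the boundary of \<open>a\<close> stays in the two parts because the homotopy is natural.\<close>
lemma singular_chain_small:
  assumes U: "openin Y U" and V: "openin Y V" and UV: "U \<union> V = topspace Y" and a: "singular_chain p Y a"
    and da: "chain_boundary p a = u + v"
    and u: "singular_chain (p - 1) (subtopology Y U) u" and v: "singular_chain (p - 1) (subtopology Y V) v"
  obtains a1 a2 b where "singular_chain p (subtopology Y U) a1" "singular_chain p (subtopology Y V) a2"
    "singular_chain (Suc p) Y b" "a = a1 + a2 + chain_boundary (Suc p) b"
proof -
  have "(Y closure_of (topspace Y - U)) = topspace Y - U"
    using U by (intro closure_of_closedin closedin_diff closedin_topspace)
  also have "\<dots> \<subseteq> Y interior_of V"
    using UV V by (auto simp: interior_of_openin)
  finally have cl: "Y closure_of (topspace Y - U) \<subseteq> Y interior_of V" .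
  have aY: "singular_chain p (subtopology Y (topspace Y)) a" using a by simp
  obtain n d e where d: "singular_chain p (subtopology Y (topspace Y - (topspace Y - U))) d"
    and e: "singular_chain p (subtopology Y V) e" and sd: "(singular_subdivision p ^^ n) a = d + e"
    by (rule excised_chain_exists[OF cl openin_subset[OF V] aY])
  obtain h where h0: "\<And>p. h p 0 = (0 :: 'a chain)"
    and hd: "\<And>p c1 c2. h p (c1-c2) = h p c1 - h p c2"
    and hs: "\<And>p X c. singular_chain p X c \<Longrightarrow> singular_chain (Suc p) X (h p c)"
    and hb: "\<And>p X c. singular_chain p X c
               \<Longrightarrow> chain_boundary (Suc p) (h p c) + h (p - Suc 0) (chain_boundary p c)
                   = (singular_subdivision p ^^ n) c - c"
    using chain_homotopic_iterated_singular_subdivision[of n] by blast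
  have d': "singular_chain p (subtopology Y U) d"
    using d openin_subset[OF U] by (simp add: double_diff)
  have eq: "a = d + e - h (p - 1) (u + v) - chain_boundary (Suc p) (h p a)"
    using hb[OF a] sd da by (simp add: algebra_simps)
  show thesis
  proof (cases p)
    case 0
    then have "u + v = 0" using da by (simp add: chain_boundary_def)
    then show thesis
      using eq d' e hs[OF a] h0 that[of d e "- h p a"]
      by (simp add: singular_chain_minus chain_boundary_minus)
  next
    case (Suc q)
    have "h q (u + v) = h q u + h q v"
      using hd[of q u "0 - v"] hd[of q 0 v] h0[of q] by simp
    moreover have "singular_chain p (subtopology Y U) (h q u)" "singular_chain p (subtopology Y V) (h q v)"
      using hs u v Suc by auto
    ultimately show thesis
      using eq d' e hs[OF a] Suc that[of "d - h q u" "e - h q v" "- h p a"]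
      by (simp add: singular_chain_minus singular_chain_diff chain_boundary_minus algebra_simps)
  qed
qed

lemma aug_chain_small:
  assumes U: "openin Y U" and V: "openin Y V" and UV: "U \<union> V = topspace Y"
    and a: "a \<in> frags (aug_simplices Y (Suc n))"
    and da: "aug_bd (Suc n) a = u + v"
    and u: "u \<in> frags (aug_simplices (subtopology Y U) n)"
    and v: "v \<in> frags (aug_simplices (subtopology Y V) n)"
  obtains a1 a2 b where "a1 \<in> frags (aug_simplices (subtopology Y U) (Suc n))"
    "a2 \<in> frags (aug_simplices (subtopology Y V) (Suc n))"
    "b \<in> frags (aug_simplices Y (Suc (Suc n)))"
    "a = a1 + a2 + aug_bd (Suc (Suc n)) b"
proof (cases n)
  case 0
  show thesis
    using singular_chain_small[OF U V UV, of 0 a 0 0] a that 0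
    by (auto simp: frags_aug_simplices aug_boundary_extend chain_boundary_def simp del: aug_simplices.simps)
next
  case (Suc m)
  then show thesis
    using singular_chain_small[OF U V UV, of "Suc m" a u v] a da u v that
    by (auto simp: frags_aug_simplices aug_boundary_extend simp del: aug_simplices.simps)
qed

text \<open>A chain lies in whichever of the two lower sets contains its greatest element.\<close>
lemma order_chains_Un:
  assumes X: "finite_T0 X" and A: "A \<subseteq> topspace X" and U: "openin (subtopology X A) U"
    and V: "openin (subtopology X A) V" and UV: "U \<union> V = A"
  shows "order_chains X A n \<subseteq> order_chains X U n \<union> order_chains X V n"
proof
  fix xs assume xs: "xs \<in> order_chains X A n"
  have lower: "y \<in> W" if W: "openin (subtopology X A) W" and "x \<in> W" "spec_le X y x" "y \<in> A" for W x y
  proof -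
    obtain W' where W': "openin X W'" "W = W' \<inter> A" using W by (auto simp: openin_subtopology)
    then show ?thesis
      using that X spec_le_iff[of X y x] by (auto simp: finite_T0_def spec_le_def)
  qed
  show "xs \<in> order_chains X U n \<union> order_chains X V n"
  proof (cases "xs = []")
    case True
    then show ?thesis using xs by (simp add: order_simplices_def)
  next
    case False
    have le: "spec_le X y (hd xs)" if "y \<in> set xs" for y
      using xs A False that by (intro chain_list_greatest) (auto simp: order_simplices_def)
    have "hd xs \<in> A" using xs False by (auto simp: order_simplices_def)
    then consider "hd xs \<in> U" | "hd xs \<in> V" using UV by blast
    then show ?thesis
    proof cases
      case 1
      then have "set xs \<subseteq> U" using lower[OF U 1] le xs by (auto simp: order_simplices_def)
      then show ?thesis using xs by (auto simp: order_simplices_def)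
    next
      case 2
      then have "set xs \<subseteq> V" using lower[OF V 2] le xs by (auto simp: order_simplices_def)
      then show ?thesis using xs by (auto simp: order_simplices_def)
    qed
  qed
qed

lemma aug_simplices_Int:
  "aug_simplices (subtopology X U) n \<inter> aug_simplices (subtopology X V) n
    = aug_simplices (subtopology X (U \<inter> V)) n"
  by (cases n) (auto simp: singular_simplex_subtopology)

lemma order_simplices_Int: "order_simplices r U n \<inter> order_simplices r V n = order_simplices r (U \<inter> V) n"
  by (auto simp: order_simplices_def)

lemma frags_Int: "frags (S \<inter> T) = frags S \<inter> frags T"
  by (auto simp: frags_def)

text \<open>The Mayer-Vietoris argument for mapping cones. A cone cycle of \<open>A\<close> is split as a sum of cone
  chains of \<open>U\<close> and \<open>V\<close>; their boundaries are opposite, hence a cone cycle of \<open>U \<inter> V\<close>, hence a cone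
  boundary there. Correcting by it makes both summands cone cycles.\<close>
lemma comparison_exact_Un:
  assumes X: "finite_T0 X" and \<eta>: "mccord_map X \<eta>" and A: "A \<subseteq> topspace X"
    and U: "openin (subtopology X A) U" and V: "openin (subtopology X A) V" and UV: "U \<union> V = A"
    and exU: "comparison_exact X \<eta> U" and exV: "comparison_exact X \<eta> V"
    and exUV: "comparison_exact X \<eta> (U \<inter> V)"
  shows "comparison_exact X \<eta> A"
  unfolding comparison_exact_def
proof (intro allI ballI impI)
  let ?d = "\<lambda>n. aug_bd n" and ?e = "frag_extend \<eta>" and ?l = "bd"
  let ?T = "\<lambda>A n. frags (aug_simplices (subtopology X A) n)" and ?C = "\<lambda>A n. frags (order_chains X A n)"
  fix n c a assume c: "c \<in> ?C A n" and a: "a \<in> ?T A (Suc n)"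
    and c0: "?l c = 0" and da: "?d (Suc n) a = ?e c"
  have UA: "U \<subseteq> A" "V \<subseteq> A" using UV by auto
  have Ut: "U \<subseteq> topspace X" and Vt: "V \<subseteq> topspace X" and It: "U \<inter> V \<subseteq> topspace X" using UA A by auto
  have subU: "subtopology (subtopology X A) U = subtopology X U"
    and subV: "subtopology (subtopology X A) V = subtopology X V"
    using UA by (auto simp: subtopology_subtopology Int_absorb1)
  have T_mono: "x \<in> ?T A k" if "x \<in> ?T B k" "B \<subseteq> A" for x B k
    using that aug_simplices_mono frags_mono by metis
  have C_mono: "x \<in> ?C A k" if "x \<in> ?C B k" "B \<subseteq> A" for x B k
    using that order_simplices_mono frags_mono by metis
  have "supp c \<subseteq> order_chains X U n \<union> order_chains X V n"
    using c order_chains_Un[OF X A U V UV] by (auto simp: frags_def)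
  then obtain c1 c2 where c1: "c1 \<in> ?C U n" and c2: "c2 \<in> ?C V n" and c12: "c1 + c2 = c"
    using frag_split unfolding frags_def mem_Collect_eq by metis
  have e1: "?e c1 \<in> ?T U n" and e2: "?e c2 \<in> ?T V n"
    using mccord_map_frags[OF \<eta>] Ut Vt c1 c2 by auto
  have "?d (Suc n) a = ?e c1 + ?e c2" using da by (simp add: c12[symmetric] frag_extend_add)
  then obtain a1 a2 b0 where a1: "a1 \<in> ?T U (Suc n)" and a2: "a2 \<in> ?T V (Suc n)"
    and b0: "b0 \<in> ?T A (Suc (Suc n))" and a12: "a = a1 + a2 + ?d (Suc (Suc n)) b0"
    using aug_chain_small[OF U V _ a, of "?e c1" "?e c2"] e1 e2 UV A
    unfolding subU subV by (auto simp: Int_absorb1 simp del: aug_boundary.simps aug_simplices.simps)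
  have "?d (Suc n) (?d (Suc (Suc n)) b0) = 0" by (rule aug_boundary_aug_boundary[OF b0])
  then have sum_d: "?d (Suc n) a1 + ?d (Suc n) a2 = ?e c1 + ?e c2"
    using \<open>?d (Suc n) a = ?e c1 + ?e c2\<close> unfolding a12 frag_extend_add by simp
  have sum_l: "?l c1 + ?l c2 = 0" using c0 by (simp add: c12[symmetric] frag_extend_add)
  \<comment> \<open>\<open>u\<close> and the boundary of \<open>c1\<close> form the cone boundary of \<open>(c1, a1)\<close>, which lies over \<open>U \<inter> V\<close>\<close>
  define u where "u = ?d (Suc n) a1 - ?e c1"
  have u': "u = ?e c2 - ?d (Suc n) a2" unfolding u_def using sum_d by (simp add: algebra_simps)
  have "u \<in> ?T U n" unfolding u_def by (intro frags_diff aug_boundary_in a1 e1)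
  moreover have "u \<in> ?T V n" unfolding u' by (intro frags_diff aug_boundary_in a2 e2)
  ultimately have u: "u \<in> ?T (U \<inter> V) n" by (simp add: frags_Int flip: aug_simplices_Int)
  have "\<exists>c'\<in>?C (U \<inter> V) n. \<exists>b\<in>?T (U \<inter> V) (Suc n). ?l c' = ?l c1 \<and> - u = ?e c' + ?d (Suc n) b"
  proof (cases n)
    case 0
    let ?k = "coef (- u) empty_simplex"
    have "- u = frag_cmul ?k (frag_of empty_simplex)"
      using u 0 by (intro poly_mapping_eqI) (auto simp: frags_def in_keys_iff)
    moreover have "?e (frag_cmul ?k (frag_of [])) = frag_cmul ?k (frag_of empty_simplex)"
      using \<eta> unfolding mccord_map_def frag_extend_cmul by simp
    moreover have "?l c1 = 0"
      using c1 0 by (auto simp: frags_def order_simplices_def intro!: frag_extend_eq_0)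
    ultimately show ?thesis
      using 0 by (intro bexI[of _ "frag_cmul ?k (frag_of [])"] bexI[of _ 0])
        (auto simp: frag_extend_cmul order_simplices_def intro!: frags_cmul)
  next
    case (Suc m)
    have l1: "?l c1 \<in> ?C U m" using c1 Suc by (auto intro: list_boundary_frags)
    have "?l c1 = - ?l c2" using sum_l by (simp add: eq_neg_iff_add_eq_0)
    moreover have "?l c2 \<in> ?C V m" using c2 Suc by (auto intro: list_boundary_frags)
    ultimately have "?l c1 \<in> ?C V m" by (simp add: frags_minus)
    then have l: "?l c1 \<in> ?C (U \<inter> V) m" using l1 by (simp add: frags_Int flip: order_simplices_Int)
    have "?d n u = - ?e (?l c1)"
      using aug_boundary_aug_boundary[OF a1] mccord_map_boundary[OF \<eta> Ut c1]
      by (simp add: u_def frag_extend_diff)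
    then have "?d (Suc m) (- u) = ?e (?l c1)" using Suc by (simp add: frag_extend_minus)
    moreover have "- u \<in> ?T (U \<inter> V) (Suc m)" using u Suc by (simp add: frags_minus)
    ultimately obtain c' b where "c' \<in> ?C (U \<inter> V) (Suc m)" "b \<in> ?T (U \<inter> V) (Suc (Suc m))"
      "?l c' = ?l c1" "- u = ?e c' + ?d (Suc (Suc m)) b"
      using comparison_exactD[OF exUV l] list_boundary_twice by metis
    then show ?thesis unfolding Suc by blast
  qed
  then obtain c' b where c': "c' \<in> ?C (U \<inter> V) n" and b: "b \<in> ?T (U \<inter> V) (Suc n)"
    and lc': "?l c' = ?l c1" and ub: "- u = ?e c' + ?d (Suc n) b" by blast
  have c'U: "c' \<in> ?C U n" and c'V: "c' \<in> ?C V n"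
    by (rule frags_mono[OF c' order_simplices_mono], simp)+
  have bU: "b \<in> ?T U (Suc n)" and bV: "b \<in> ?T V (Suc n)"
    by (rule frags_mono[OF b aug_simplices_mono], simp)+
  have U1: "c1 - c' \<in> ?C U n" "a1 + b \<in> ?T U (Suc n)" "?l (c1 - c') = 0"
    by (intro frags_diff frags_add c1 c'U a1 bU | simp add: frag_extend_diff lc')+
  have "?d (Suc n) (a1 + b) = ?e (c1 - c')"
    using ub unfolding u_def frag_extend_add frag_extend_diff by (simp add: algebra_simps)
  then obtain x1 y1 where x1: "x1 \<in> ?C U (Suc n)" "y1 \<in> ?T U (Suc (Suc n))" "?l x1 = c1 - c'"
      "a1 + b = ?e x1 + ?d (Suc (Suc n)) y1"
    using comparison_exactD[OF exU U1] by metis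
  have V1: "c2 + c' \<in> ?C V n" "a2 - b \<in> ?T V (Suc n)" "?l (c2 + c') = 0"
    using sum_l by (intro frags_diff frags_add c2 c'V a2 bV | simp add: frag_extend_add lc' add.commute)+
  have "?d (Suc n) (a2 - b) = ?e (c2 + c')"
    using ub unfolding u' frag_extend_add frag_extend_diff by (simp add: algebra_simps)
  then obtain x2 y2 where x2: "x2 \<in> ?C V (Suc n)" "y2 \<in> ?T V (Suc (Suc n))" "?l x2 = c2 + c'"
      "a2 - b = ?e x2 + ?d (Suc (Suc n)) y2"
    using comparison_exactD[OF exV V1] by metis
  show "\<exists>c'\<in>?C A (Suc n). \<exists>b\<in>?T A (Suc (Suc n)). ?l c' = c \<and> a = ?e c' + ?d (Suc (Suc n)) b"
  proof (intro bexI conjI)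
    show "?l (x1 + x2) = c" unfolding frag_extend_add x1 x2 using c12 by simp
    have "a = (a1 + b) + (a2 - b) + ?d (Suc (Suc n)) b0" unfolding a12 by simp
    also have "\<dots> = ?e (x1 + x2) + ?d (Suc (Suc n)) (y1 + y2 + b0)"
      unfolding x1 x2 frag_extend_add by (simp add: algebra_simps)
    finally show "a = ?e (x1 + x2) + ?d (Suc (Suc n)) (y1 + y2 + b0)" .
    show "x1 + x2 \<in> ?C A (Suc n)" by (intro frags_add C_mono[OF x1(1)] C_mono[OF x2(1)] UA)
    show "y1 + y2 + b0 \<in> ?T A (Suc (Suc n))"
      by (intro frags_add T_mono[OF x1(2)] T_mono[OF x2(2)] UA b0)
  qed
qed

text \<open>Induction on the number of points of \<open>A\<close>. For a maximal point \<open>x\<close>, the points below \<open>x\<close> and the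
  points other than \<open>x\<close> form open sets \<open>U\<close> and \<open>V\<close> that cover \<open>A\<close>; if \<open>U\<close> is everything, then \<open>A\<close> has
  a greatest element.\<close>
theorem comparison_exact:
  assumes X: "finite_T0 X" and \<eta>: "mccord_map X \<eta>" and "A \<subseteq> topspace X"
  shows "comparison_exact X \<eta> A"
  using assms(3)
proof (induction "card A" arbitrary: A rule: less_induct)
  case less
  have fin: "finite A" using less.prems X by (auto simp: finite_T0_def intro: finite_subset)
  show ?case
  proof (cases "A = {}")
    case True
    then show ?thesis using comparison_exact_empty[OF \<eta>] by simp
  next
    case False
    have "asymp_on A (spec_less X)" "transp_on A (spec_less X)"
      using spec_le_antisym[OF X] spec_le_trans[of X]
      unfolding asymp_on_def transp_on_def spec_less_def by blast+
    then obtain x where x: "x \<in> A" and maximal: "\<And>y. y \<in> A \<Longrightarrow> y \<noteq> x \<Longrightarrow> \<not> spec_less X x y"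
      using Finite_Set.bex_max_element[OF fin, of "spec_less X"] False by blast
    define U where "U = {y \<in> A. spec_le X y x}"
    define V where "V = A - {x}"
    have xt: "x \<in> topspace X" and fX: "finite (topspace X)"
      using x less.prems X by (auto simp: finite_T0_def)
    show ?thesis
    proof (cases "U = A")
      case True
      show ?thesis
        by (rule comparison_exact_greatest[OF X \<eta> less.prems x]) (use True in \<open>auto simp: U_def\<close>)
    next
      case False
      have "U = minimal_open X x \<inter> A"
        using spec_le_iff_mem[OF fX _ xt] less.prems by (auto simp: U_def)
      then have U: "openin (subtopology X A) U"
        using openin_minimal_open[OF fX xt] by (auto simp: openin_subtopology)
      have "openin X {y \<in> topspace X. \<not> spec_le X x y}"
        unfolding openin_iff_lower_set[OF fX] using spec_le_trans by (auto simp: spec_le_def)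
      moreover have "V = {y \<in> topspace X. \<not> spec_le X x y} \<inter> A"
        using maximal less.prems spec_le_refl[OF xt] by (auto simp: V_def spec_less_def)
      ultimately have V: "openin (subtopology X A) V"
        unfolding openin_subtopology by blast
      have UV: "U \<union> V = A"
        using x spec_le_refl[OF xt] by (auto simp: U_def V_def)
      have "U \<subset> A" "V \<subset> A" "U \<inter> V \<subset> A"
        using False x by (auto simp: U_def V_def)
      then have "card U < card A" "card V < card A" "card (U \<inter> V) < card A"
        using psubset_card_mono[OF fin] by blast+
      moreover have "U \<subseteq> topspace X" "V \<subseteq> topspace X" "U \<inter> V \<subseteq> topspace X"
        using less.prems by (auto simp: U_def V_def)
      ultimately show ?thesis
        by (intro comparison_exact_Un[OF X \<eta> less.prems U V UV] less.hyps)
    qed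
  qed
qed

lemma simplicial_cycle_Suc:
  assumes "simplicial_cycle X (Suc j) c"
  shows "bd c = 0"
proof -
  have "bd c \<in> frags (simplices X j) \<inter> frags {[]}"
    using assms list_boundary_frags by (auto simp: simplicial_cycle_def)
  also have "frags (simplices X j) \<inter> frags {[]} = {0}"
    unfolding frags_Int[symmetric] by (simp add: order_simplices_def)
  finally show ?thesis by simp
qed

lemma frags_singleton:
  assumes "c \<in> frags {x}"
  shows "c = frag_cmul (coef c x) (frag_of x)"
  using assms by (intro poly_mapping_eqI) (auto simp: frags_def in_keys_iff)

lemma mccord_map_Nil_eq_0:
  assumes "mccord_map X \<eta>" "w \<in> frags {[]}" "frag_extend \<eta> w = 0"
  shows "w = 0"
proof -
  define k where "k = coef w []"
  have w: "w = frag_cmul k (frag_of [])" using frags_singleton[OF assms(2)] by (simp add: k_def)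
  then have "frag_cmul k (frag_of empty_simplex) = frag_extend \<eta> w"
    using assms(1) by (simp add: mccord_map_def frag_extend_cmul)
  then show ?thesis using assms(3) w by simp
qed

lemma mccord_frags:
  assumes "mccord_map X \<eta>" "c \<in> frags (order_chains X (topspace X) n)"
  shows "frag_extend \<eta> c \<in> frags (aug_simplices X n)"
  using mccord_map_frags[OF assms(1) order_refl assms(2)] by simp

lemma mccord_boundary:
  assumes "mccord_map X \<eta>" "c \<in> frags (order_chains X (topspace X) n)"
  shows "aug_bd n (frag_extend \<eta> c) = frag_extend \<eta> (bd c)"
  using mccord_map_boundary[OF assms(1) order_refl assms(2)] .

lemma mccord_cycle:
  assumes \<eta>: "mccord_map X \<eta>" and c: "simplicial_cycle X k c"
  shows "singular_relcycle k X {} (frag_extend \<eta> c)"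
proof -
  have cC: "c \<in> frags (simplices X k)" using c by (simp add: simplicial_cycle_def)
  have ch: "singular_chain k X (frag_extend \<eta> c)"
    using mccord_frags[OF \<eta> cC] by (simp only: frags_aug_simplices)
  moreover have "chain_boundary k (frag_extend \<eta> c) = 0"
  proof (cases k)
    case 0
    then show ?thesis by (simp add: chain_boundary_def)
  next
    case (Suc j)
    have "aug_bd (Suc (Suc j)) (frag_extend \<eta> c) = 0"
      using mccord_boundary[OF \<eta> cC] simplicial_cycle_Suc[of X j c] c Suc by simp
    then show ?thesis by (simp only: Suc aug_boundary_extend)
  qed
  ultimately show ?thesis by (simp add: singular_cycle)
qed

lemmas comparison_exact_space =
  comparison_exactD[OF comparison_exact[OF _ _ order_refl], unfolded subtopology_topspace]

abbreviation mccord_class ::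
    "nat \<Rightarrow> 'a topology \<Rightarrow> ('a list \<Rightarrow> 'a chain) \<Rightarrow> ('a list \<Rightarrow>\<^sub>0 int) \<Rightarrow> 'a chain set"
  where "mccord_class k X \<eta> c \<equiv> homologous_rel_set k X {} (frag_extend \<eta> c)"

text \<open>Surjectivity of \<open>\<eta>\<close> on homology. For \<open>k = 0\<close> the augmentation of \<open>a\<close> need not vanish; it is
  matched by a multiple \<open>w\<close> of the empty list.\<close>
lemma mccord_cycle_surj:
  assumes X: "finite_T0 X" and \<eta>: "mccord_map X \<eta>" and a: "singular_relcycle k X {} a"
  shows "\<exists>c. simplicial_cycle X k c \<and>
    mccord_class k X \<eta> c = homologous_rel_set k X {} a"
proof -
  have aT: "a \<in> frags (aug_simplices X (Suc k))"
    using a by (simp only: frags_aug_simplices singular_cycle)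
  have "\<exists>w. w \<in> frags (order_chains X (topspace X) k) \<and> w \<in> frags {[]} \<and>
      bd w = 0 \<and> aug_bd (Suc k) a = frag_extend \<eta> w"
  proof (cases k)
    case 0
    let ?m = "coef (aug_bd (Suc 0) a) empty_simplex"
    have "aug_bd (Suc 0) a \<in> frags {empty_simplex}"
      using aug_boundary_in[of a X 0] aT 0 by simp
    then have "aug_bd (Suc 0) a = frag_cmul ?m (frag_of empty_simplex)"
      by (rule frags_singleton)
    moreover have "frag_extend \<eta> (frag_cmul ?m (frag_of [])) = frag_cmul ?m (frag_of empty_simplex)"
      using \<eta> by (simp only: frag_extend_cmul frag_extend_of mccord_map_def)
    ultimately show ?thesis
      using 0 by (intro exI[of _ "frag_cmul ?m (frag_of [])"])
        (auto simp: frag_extend_cmul order_simplices_def intro!: frags_cmul)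
  next
    case (Suc j)
    then have "aug_bd (Suc k) a = 0"
      using a by (simp only: Suc aug_boundary_extend singular_cycle)
    then show ?thesis by (intro exI[of _ 0]) simp
  qed
  then obtain w where w: "w \<in> frags (order_chains X (topspace X) k)" "w \<in> frags {[]}"
    "bd w = 0" "aug_bd (Suc k) a = frag_extend \<eta> w" by blast
  obtain c b where c: "c \<in> frags (simplices X k)"
    and b: "b \<in> frags (aug_simplices X (Suc (Suc k)))" and lc: "bd c = w"
    and ab: "a = frag_extend \<eta> c + aug_bd (Suc (Suc k)) b"
    by (rule comparison_exact_space[OF X \<eta> w(1) aT w(3,4)])
  have "singular_relboundary k X {} (a - frag_extend \<eta> c)"
    unfolding singular_boundary
    using b ab by (intro exI[of _ b]) (simp only: frags_aug_simplices aug_boundary_extend add_diff_cancel_left')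
  then have "homologous_rel k X {} a (frag_extend \<eta> c)"
    by (simp add: homologous_rel_def)
  then have "mccord_class k X \<eta> c = homologous_rel_set k X {} a"
    by (simp add: homologous_rel_set_eq homologous_rel_sym)
  then show ?thesis using c lc w by (auto simp: simplicial_cycle_def)
qed

lemma mccord_boundary_iff:
  assumes X: "finite_T0 X" and \<eta>: "mccord_map X \<eta>" and c: "simplicial_cycle X k c"
  shows "singular_relboundary k X {} (frag_extend \<eta> c) \<longleftrightarrow>
    c \<in> bd ` frags (simplices X (Suc k))"
proof
  assume "singular_relboundary k X {} (frag_extend \<eta> c)"
  then obtain a where "singular_chain (Suc k) X a" "chain_boundary (Suc k) a = frag_extend \<eta> c"
    by (auto simp: singular_boundary)
  then have a: "a \<in> frags (aug_simplices X (Suc (Suc k)))"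
    and da: "aug_bd (Suc (Suc k)) a = frag_extend \<eta> c"
    by (simp_all only: frags_aug_simplices aug_boundary_extend)
  have cC: "c \<in> frags (simplices X k)" using c by (simp add: simplicial_cycle_def)
  have "frag_extend \<eta> (bd c) = 0"
    using aug_boundary_aug_boundary[OF a] mccord_boundary[OF \<eta> cC] da by simp
  then have lc: "bd c = 0"
    using mccord_map_Nil_eq_0[OF \<eta>] c by (simp add: simplicial_cycle_def)
  obtain c' where "c' \<in> frags (simplices X (Suc k))"
    "bd c' = c"
    by (rule comparison_exact_space[OF X \<eta> cC a lc da])
  then show "c \<in> bd ` frags (simplices X (Suc k))" by blast
next
  assume "c \<in> bd ` frags (simplices X (Suc k))"
  then obtain b where b: "b \<in> frags (simplices X (Suc k))" "c = bd b"
    by blast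
  show "singular_relboundary k X {} (frag_extend \<eta> c)"
    unfolding singular_boundary
    using mccord_frags[OF \<eta> b(1)] mccord_boundary[OF \<eta> b(1)] b(2)
    by (intro exI[of _ "frag_extend \<eta> b"]) (simp only: frags_aug_simplices aug_boundary_extend)
qed

text \<open>Topological acyclicity, which is what Vietoris-like maps provide, becomes exactness of the order
  complex; this is what acyclic carriers with values in order complexes require.\<close>
lemma exact_order_chains_acyclic:
  assumes X: "finite_T0 X" and A: "A \<subseteq> topspace X" and "acyclic_space (subtopology X A)"
  shows "exact_complex (\<lambda>_. list_boundary) (order_chains X A)"
  unfolding exact_complex_def
proof (intro allI ballI impI)
  fix n c assume c: "c \<in> frags (order_chains X A n)" and c0: "bd c = 0"
  obtain \<eta> where \<eta>: "mccord_map X \<eta>" using mccord_map_ex[OF X] by blast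
  have "exact_complex aug_boundary (aug_simplices (subtopology X A))"
    by (rule acyclic_imp_exact_aug) fact
  moreover have "frag_extend \<eta> c \<in> frags (aug_simplices (subtopology X A) n)"
    by (rule mccord_map_frags[OF \<eta> A c])
  moreover have "aug_bd n (frag_extend \<eta> c) = 0"
    by (simp add: mccord_map_boundary[OF \<eta> A c] c0)
  ultimately obtain a where "a \<in> frags (aug_simplices (subtopology X A) (Suc n))"
    "aug_bd (Suc n) a = frag_extend \<eta> c"
    unfolding exact_complex_def by blast
  then show "\<exists>b\<in>frags (order_chains X A (Suc n)). bd b = c"
    using comparison_exactD[OF comparison_exact[OF X \<eta> A] c _ c0] by metis
qed

section \<open>Vietoris-like maps on chains\<close>

lemma aug_boundary_extend_1: "aug_bd (Suc 0) c = frag_extend (\<lambda>_. frag_of empty_simplex) c"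
  by (rule frag_extend_eq) simp

lemma continuous_map_spec_le:
  assumes X: "finite_T0 X" and Y: "finite_T0 Y" and f: "continuous_map X Y f" and le: "spec_le X x x'"
  shows "spec_le Y (f x) (f x')"
proof -
  have x: "x \<in> topspace X" "x' \<in> topspace X" using le by (auto simp: spec_le_def)
  then have y: "f x \<in> topspace Y" "f x' \<in> topspace Y" using f by (auto simp: continuous_map_def)
  have "f x \<in> U" if "openin Y U" "f x' \<in> U" for U
  proof -
    have "openin X {z \<in> topspace X. f z \<in> U}" using f that(1) by (simp add: continuous_map_def)
    then show ?thesis
      using le x that(2) X spec_le_iff[of X x x'] by (auto simp: finite_T0_def)
  qed
  then show ?thesis using y Y spec_le_iff[of Y "f x" "f x'"] by (auto simp: finite_T0_def)
qed

lemma order_listsD: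
  assumes "xs \<in> order_lists X"
  shows "sorted_wrt (spec_greater X) xs" "set xs \<subseteq> topspace X"
  using assms by (auto simp: order_lists_def)

lemma image_greatest:
  assumes X: "finite_T0 X" and Y: "finite_T0 Y" and f: "continuous_map X Y f"
    and xs: "xs \<in> order_lists X" "xs \<noteq> []"
  shows "f ` set xs \<subseteq> topspace Y" "f (hd xs) \<in> f ` set xs"
    "\<And>y. y \<in> f ` set xs \<Longrightarrow> spec_le Y y (f (hd xs))"
  using continuous_map_spec_le[OF X Y f] chain_list_greatest[OF order_listsD[OF xs(1)] xs(2)]
    order_listsD(2)[OF xs(1)] f xs(2) by (auto simp: continuous_map_def)

text \<open>The image of a nonempty chain under a continuous map has a greatest element, so its order complex
  is a cone.\<close>
lemma acyclic_carrier_image: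
  assumes X: "finite_T0 X" and Y: "finite_T0 Y" and f: "continuous_map X Y f"
  shows "acyclic_carrier X (\<lambda>_. list_boundary) (\<lambda>xs. order_chains Y (f ` set xs))"
  unfolding acyclic_carrier_def
proof (intro conjI ballI allI impI)
  fix xs assume "xs \<in> order_lists X" "xs \<noteq> []"
  then show "exact_complex (\<lambda>_. list_boundary) (order_chains Y (f ` set xs))"
    using image_greatest[OF X Y f] by (intro exact_order_chains_greatest[OF Y, of "f (hd xs)"]) auto
qed (rule order_simplices_mono, blast)

lemma acyclic_carrier_image_aug:
  assumes X: "finite_T0 X" and Y: "finite_T0 Y" and f: "continuous_map X Y f"
  shows "acyclic_carrier X aug_boundary (\<lambda>xs. aug_simplices (subtopology Y (f ` set xs)))"
  unfolding acyclic_carrier_def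
proof (intro conjI ballI allI impI)
  fix xs assume "xs \<in> order_lists X" "xs \<noteq> []"
  then show "exact_complex aug_boundary (aug_simplices (subtopology Y (f ` set xs)))"
    using image_greatest[OF X Y f]
    by (intro acyclic_imp_exact_aug acyclic_subspace_greatest[OF Y, of _ "f (hd xs)"]) auto
qed (rule aug_simplices_mono, blast)

text \<open>The acyclicity condition on a Vietoris-like map says that the preimages of
  chains form an acyclic carrier.\<close>
lemma acyclic_carrier_preimage:
  assumes X: "finite_T0 X" and Y: "finite_T0 Y" and f: "vietoris_like_map X Y f"
  shows "acyclic_carrier Y (\<lambda>_. list_boundary)
    (\<lambda>ys. order_chains X {x \<in> topspace X. f x \<in> set ys})"
  unfolding acyclic_carrier_def
proof (intro conjI ballI allI impI)
  fix ys assume ys: "ys \<in> order_lists Y" "ys \<noteq> []"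
  have "sorted_wrt (spec_less Y) (rev ys)"
    using ys(1) by (simp add: order_lists_def sorted_wrt_rev flip: spec_greater_def)
  moreover have "set (rev ys) \<subseteq> topspace Y" "rev ys \<noteq> []"
    using ys by (auto simp: order_lists_def)
  ultimately have "acyclic_space (subtopology X (\<Union>y\<in>set (rev ys). {x \<in> topspace X. f x = y}))"
    using f unfolding vietoris_like_map_def by blast
  moreover have "(\<Union>y\<in>set (rev ys). {x \<in> topspace X. f x = y}) = {x \<in> topspace X. f x \<in> set ys}"
    by auto
  ultimately show "exact_complex (\<lambda>_. list_boundary) (order_chains X {x \<in> topspace X. f x \<in> set ys})"
    by (intro exact_order_chains_acyclic[OF X]) auto
qed (rule order_simplices_mono, blast)

text \<open>Dropping repetitions from the image of a list gives a list again, to which the exactness of preimages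
  of chains of \<open>Y\<close> applies.\<close>
lemma image_order_list:
  assumes X: "finite_T0 X" and Y: "finite_T0 Y" and f: "continuous_map X Y f"
    and xs: "xs \<in> order_lists X"
  shows "\<exists>ys\<in>order_lists Y. set ys = f ` set xs"
  using xs
proof (induction xs)
  case Nil
  then show ?case by (intro bexI[of _ "[]"]) (auto simp: order_lists_def)
next
  case (Cons x xs)
  then have "xs \<in> order_lists X" by (auto simp: order_lists_def)
  then obtain ys where ys: "ys \<in> order_lists Y" "set ys = f ` set xs" using Cons.IH by blast
  show ?case
  proof (cases "f x \<in> set ys")
    case True
    then show ?thesis using ys by (intro bexI[of _ ys]) auto
  next
    case False
    have "spec_le Y y (f x) \<and> y \<noteq> f x" if "y \<in> set ys" for y
    proof (intro conjI)
      have "y \<in> f ` set (x # xs)" using that ys(2) by simp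
      then show "spec_le Y y (f x)" using image_greatest(3)[OF X Y f Cons.prems, of y] by simp
      show "y \<noteq> f x" using that False by metis
    qed
    moreover have "f x \<in> topspace Y" using image_greatest(1)[OF X Y f Cons.prems] by auto
    ultimately have "f x # ys \<in> order_lists Y"
      using ys(1) by (auto simp: order_lists_def spec_greater_def spec_less_def)
    then show ?thesis using ys by (intro bexI[of _ "f x # ys"]) auto
  qed
qed

lemma acyclic_carrier_preimage_image:
  assumes X: "finite_T0 X" and Y: "finite_T0 Y" and f: "vietoris_like_map X Y f"
  shows "acyclic_carrier X (\<lambda>_. list_boundary)
    (\<lambda>xs. order_chains X {x \<in> topspace X. f x \<in> f ` set xs})"
  unfolding acyclic_carrier_def
proof (intro conjI ballI allI impI)
  fix xs assume xs: "xs \<in> order_lists X" "xs \<noteq> []"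
  have "continuous_map X Y f" using f by (simp add: vietoris_like_map_def)
  then obtain ys where ys: "ys \<in> order_lists Y" "set ys = f ` set xs"
    using image_order_list[OF X Y _ xs(1)] by blast
  then have "ys \<noteq> []" using xs(2) by auto
  then show "exact_complex (\<lambda>_. list_boundary) (order_chains X {x \<in> topspace X. f x \<in> f ` set xs})"
    using acyclic_carrier_preimage[OF X Y f] ys unfolding acyclic_carrier_def by (metis (no_types))
qed (rule order_simplices_mono, blast)

lemma carried_map_compose:
  assumes \<phi>: "carried_map X (\<lambda>_. list_boundary) (\<lambda>xs. order_chains Y (A xs)) \<phi>"
    and A: "\<And>xs. xs \<in> order_lists X \<Longrightarrow> A xs \<subseteq> topspace Y"
    and \<psi>: "carried_map Y D K \<psi>"
    and K: "\<And>xs ys. xs \<in> order_lists X \<Longrightarrow> ys \<in> order_chains Y (A xs) (length xs) \<Longrightarrow>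
      K ys (length xs) \<subseteq> K' xs (length xs)"
  shows "carried_map X D K' (\<lambda>xs. frag_extend \<psi> (\<phi> xs))"
  unfolding carried_map_def
proof (intro ballI conjI)
  fix xs assume xs: "xs \<in> order_lists X"
  have fr: "\<phi> xs \<in> frags (order_chains Y (A xs) (length xs))"
    and bd: "bd (\<phi> xs) = frag_extend \<phi> (list_boundary xs)"
    using \<phi> xs by (auto simp: carried_map_def)
  have ol: "ys \<in> order_lists Y \<and> length ys = length xs" if "ys \<in> order_chains Y (A xs) (length xs)" for ys
    using that A[OF xs] by (auto simp: order_simplices_def order_lists_def)
  have \<psi>1: "\<psi> ys \<in> frags (K ys (length xs))"
    and \<psi>2: "frag_extend (D (length xs)) (\<psi> ys) = frag_extend \<psi> (list_boundary ys)"
    if "ys \<in> order_chains Y (A xs) (length xs)" for ys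
    using \<psi> ol[OF that] by (auto simp: carried_map_def)
  show "frag_extend \<psi> (\<phi> xs) \<in> frags (K' xs (length xs))"
    using fr by (rule frags_extend) (rule frags_mono[OF \<psi>1 K[OF xs]])
  have "frag_extend (D (length xs)) (frag_extend \<psi> (\<phi> xs)) = frag_extend \<psi> (bd (\<phi> xs))"
    unfolding frag_extend_extend using fr by (rule frag_extend_cong_frags) (rule \<psi>2)
  then show "frag_extend (D (length xs)) (frag_extend \<psi> (\<phi> xs)) =
      frag_extend (\<lambda>xs. frag_extend \<psi> (\<phi> xs)) (list_boundary xs)"
    by (simp add: bd frag_extend_extend)
qed

lemma carried_map_ident:
  assumes "\<And>xs. xs \<in> order_lists X \<Longrightarrow> xs \<in> K xs (length xs)"
  shows "carried_map X (\<lambda>_. list_boundary) K frag_of"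
  using assms by (simp add: carried_map_def)

lemma carried_map_mccord:
  "mccord_map X \<eta> \<Longrightarrow> carried_map X aug_boundary (\<lambda>xs. aug_simplices (subtopology X (set xs))) \<eta>"
  by (simp add: mccord_map_def)

lemma carried_map_frags:
  assumes "carried_map X (\<lambda>_. list_boundary) (\<lambda>xs. order_chains Y (A xs)) \<phi>"
    and "\<And>xs. xs \<in> order_lists X \<Longrightarrow> A xs \<subseteq> topspace Y"
    and "c \<in> frags (order_chains X (topspace X) n)"
  shows "frag_extend \<phi> c \<in> frags (order_chains Y (topspace Y) n)"
    and "bd (frag_extend \<phi> c) = frag_extend \<phi> (bd c)"
proof -
  have C: "xs \<in> order_lists X \<and> length xs = n" if "xs \<in> order_chains X (topspace X) n" for xs
    using that by (auto simp: order_lists_def order_simplices_def)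
  show "frag_extend \<phi> c \<in> frags (order_chains Y (topspace Y) n)"
    using assms(3)
  proof (rule frags_extend)
    fix xs assume "xs \<in> order_chains X (topspace X) n"
    then have "\<phi> xs \<in> frags (order_chains Y (A xs) n)" "A xs \<subseteq> topspace Y"
      using assms(1,2) C by (auto simp: carried_map_def)
    then show "\<phi> xs \<in> frags (order_chains Y (topspace Y) n)"
      using frags_mono order_simplices_mono by metis
  qed
  show "bd (frag_extend \<phi> c) = frag_extend \<phi> (bd c)"
    unfolding frag_extend_extend
    using assms(3) by (rule frag_extend_cong_frags) (use assms(1) C in \<open>auto simp: carried_map_def\<close>)
qed

lemma carried_map_cycle:
  assumes \<phi>: "carried_map X (\<lambda>_. list_boundary) (\<lambda>xs. order_chains Y (A xs)) \<phi>"
    and A: "\<And>xs. xs \<in> order_lists X \<Longrightarrow> A xs \<subseteq> topspace Y"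
    and Nil: "\<phi> [] = frag_of []" and c: "simplicial_cycle X k c"
  shows "simplicial_cycle Y k (frag_extend \<phi> c)"
proof -
  have cC: "c \<in> frags (simplices X k)" and l: "bd c \<in> frags {[]}"
    using c by (auto simp: simplicial_cycle_def)
  have "frag_extend \<phi> (bd c) \<in> frags {[]}"
    using l by (rule frags_extend) (simp add: Nil)
  then show ?thesis
    using carried_map_frags[OF \<phi> A cC] by (simp add: simplicial_cycle_def)
qed

lemma simplicial_cycle_diff:
  "simplicial_cycle X k c \<Longrightarrow> simplicial_cycle X k c' \<Longrightarrow> simplicial_cycle X k (c - c')"
  by (simp add: simplicial_cycle_def frags_diff frag_extend_diff)

lemma homologous_rel_set_eq_iff:
  "homologous_rel_set k X {} a = homologous_rel_set k X {} a' \<longleftrightarrow> singular_relboundary k X {} (a - a')"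
  by (simp add: homologous_rel_set_eq) (simp add: homologous_rel_def)

lemma mccord_class_eq_iff:
  assumes "finite_T0 X" "mccord_map X \<eta>" "simplicial_cycle X k c" "simplicial_cycle X k c'"
  shows "mccord_class k X \<eta> c = mccord_class k X \<eta> c' \<longleftrightarrow>
    c - c' \<in> bd ` frags (simplices X (Suc k))"
  unfolding homologous_rel_set_eq_iff frag_extend_diff[symmetric]
  using assms by (intro mccord_boundary_iff simplicial_cycle_diff)

text \<open>The map induced by \<open>f\<close> on singular chains, precomposed with \<open>\<eta>\<close> and extended to the augmentation.\<close>
lemma carried_map_pushforward:
  assumes \<eta>: "mccord_map X \<eta>" and f: "continuous_map X Y f"
  shows "carried_map X aug_boundary (\<lambda>xs. aug_simplices (subtopology Y (f ` set xs)))
    (\<lambda>xs. case length xs of 0 \<Rightarrow> frag_of empty_simplex | Suc m \<Rightarrow> chain_map m f (\<eta> xs))"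
    (is "carried_map _ _ _ ?\<phi>")
  unfolding carried_map_def
proof (intro ballI conjI)
  fix xs assume xs: "xs \<in> order_lists X"
  then have m: "\<eta> xs \<in> frags (aug_simplices (subtopology X (set xs)) (length xs))"
    and d: "aug_bd (length xs) (\<eta> xs) = frag_extend \<eta> (list_boundary xs)"
    using \<eta> by (auto simp: mccord_map_def carried_map_def)
  have contf: "continuous_map (subtopology X (set xs)) (subtopology Y (f ` set xs)) f"
    using f by (auto simp: continuous_map_in_subtopology intro: continuous_map_from_subtopology)
  show "?\<phi> xs \<in> frags (aug_simplices (subtopology Y (f ` set xs)) (length xs))"
  proof (cases "length xs")
    case 0
    then show ?thesis by simp
  next
    case (Suc k)
    then have "singular_chain k (subtopology X (set xs)) (\<eta> xs)" using m by (simp only: frags_aug_simplices)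
    then show ?thesis
      unfolding Suc nat.case frags_aug_simplices by (rule singular_chain_chain_map[OF _ contf])
  qed
  consider "length xs = 0" | "length xs = 1" | k where "length xs = Suc (Suc k)"
    by atomize_elim presburger
  then show "aug_bd (length xs) (?\<phi> xs) = frag_extend ?\<phi> (list_boundary xs)"
  proof cases
    case 1
    then show ?thesis by simp
  next
    case 2
    then obtain x where x: "xs = [x]" by (cases xs) auto
    have "frag_extend (\<lambda>_. frag_of empty_simplex) (chain_map 0 f (\<eta> [x])) =
        frag_extend (\<lambda>_. frag_of empty_simplex) (aug_bd 1 (\<eta> [x]))"
      by (simp add: chain_map_def frag_extend_extend)
    then show ?thesis
      using d \<eta> by (simp add: x mccord_map_def aug_boundary_extend_1)
  next
    case (3 k)
    have m': "singular_chain (Suc k) (subtopology X (set xs)) (\<eta> xs)"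
      using m unfolding 3 by (simp only: frags_aug_simplices)
    have "aug_bd (length xs) (?\<phi> xs) = chain_boundary (Suc k) (chain_map (Suc k) f (\<eta> xs))"
      unfolding 3 nat.case by (rule aug_boundary_extend)
    also have "\<dots> = chain_map k f (chain_boundary (Suc k) (\<eta> xs))"
      using chain_boundary_chain_map[OF m'] by simp
    also have "chain_boundary (Suc k) (\<eta> xs) = frag_extend \<eta> (list_boundary xs)"
      using d unfolding 3 by (simp only: aug_boundary_extend)
    also have "chain_map k f (frag_extend \<eta> (list_boundary xs)) = frag_extend (\<lambda>ys. chain_map k f (\<eta> ys)) (list_boundary xs)"
      by (simp add: chain_map_def frag_extend_extend)
    also have "\<dots> = frag_extend ?\<phi> (list_boundary xs)"
    proof (rule frag_extend_eq)
      fix ys assume "ys \<in> supp (list_boundary xs)"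
      then have "length xs = Suc (length ys)" using keys_list_boundary by blast
      then have "length ys = Suc k" by (simp add: 3)
      then show "chain_map k f (\<eta> ys) = ?\<phi> ys" by simp
    qed
    finally show ?thesis .
  qed
qed

text \<open>Both \<open>f\<^sub># \<circ> \<eta>X\<close> and \<open>\<eta>Y \<circ> \<phi>\<close> are carried by the singular chains of the images of chains, so they
  agree on homology.\<close>
lemma hom_induced_mccord_class:
  assumes X: "finite_T0 X" and Y: "finite_T0 Y" and f: "continuous_map X Y f"
    and \<eta>X: "mccord_map X \<eta>X" and \<eta>Y: "mccord_map Y \<eta>Y"
    and \<phi>: "carried_map X (\<lambda>_. list_boundary) (\<lambda>xs. order_chains Y (f ` set xs)) \<phi>"
    and Nil: "\<phi> [] = frag_of []" and c: "simplicial_cycle X k c"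
  shows "hom_induced (int k) X {} Y {} f (mccord_class k X \<eta>X c) =
    mccord_class k Y \<eta>Y (frag_extend \<phi> c)"
proof -
  let ?K = "\<lambda>xs. aug_simplices (subtopology Y (f ` set xs))"
  let ?\<psi> = "\<lambda>xs. case length xs of 0 \<Rightarrow> frag_of empty_simplex | Suc m \<Rightarrow> chain_map m f (\<eta>X xs)"
  have im: "f ` set xs \<subseteq> topspace Y" if "xs \<in> order_lists X" for xs
    using that f by (auto simp: order_lists_def continuous_map_def)
  have 1: "carried_map X aug_boundary ?K ?\<psi>"
    by (rule carried_map_pushforward[OF \<eta>X f])
  have 2: "carried_map X aug_boundary ?K (\<lambda>xs. frag_extend \<eta>Y (\<phi> xs))"
    by (rule carried_map_compose[OF \<phi> im carried_map_mccord[OF \<eta>Y]])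
      (auto intro!: aug_simplices_mono simp: order_simplices_def)
  have "\<exists>b\<in>frags (aug_simplices Y (Suc (Suc k))). aug_bd (Suc (Suc k)) b =
      frag_extend ?\<psi> c - frag_extend (\<lambda>xs. frag_extend \<eta>Y (\<phi> xs)) c"
  proof (rule carried_maps_homologous[OF acyclic_carrier_image_aug[OF X Y f] 1 2 _ _ c])
    show "(case length [] of 0 \<Rightarrow> frag_of empty_simplex | Suc m \<Rightarrow> chain_map m f (\<eta>X [])) = frag_extend \<eta>Y (\<phi> [])"
      using \<eta>Y by (simp add: Nil mccord_map_def)
    show "?K xs (Suc (Suc k)) \<subseteq> aug_simplices Y (Suc (Suc k))" for xs
      using aug_simplices_mono[of "f ` set xs" UNIV Y] by (simp only: subtopology_UNIV subset_UNIV)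
  qed
  then have "singular_relboundary k Y {} (frag_extend ?\<psi> c - frag_extend \<eta>Y (frag_extend \<phi> c))"
    unfolding singular_boundary frags_aug_simplices aug_boundary_extend frag_extend_extend by (simp only: Bex_def frags_aug_simplices)
  moreover have "frag_extend ?\<psi> c = chain_map k f (frag_extend \<eta>X c)"
  proof -
    have "frag_extend ?\<psi> c = frag_extend (\<lambda>xs. chain_map k f (\<eta>X xs)) c"
      by (rule frag_extend_cong_frags[of _ "simplices X k"])
        (use c in \<open>auto simp: simplicial_cycle_def order_simplices_def\<close>)
    then show ?thesis by (simp add: chain_map_def frag_extend_extend)
  qed
  ultimately have "homologous_rel_set k Y {} (chain_map k f (frag_extend \<eta>X c)) =
      mccord_class k Y \<eta>Y (frag_extend \<phi> c)"
    by (simp add: homologous_rel_set_eq_iff)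
  moreover have "hom_induced (int k) X {} Y {} f (mccord_class k X \<eta>X c) =
      homologous_rel_set k Y {} (chain_map k f (frag_extend \<eta>X c))"
    by (rule hom_induced_chain_map[OF f _ mccord_cycle[OF \<eta>X c]]) auto
  ultimately show ?thesis by simp
qed

lemma carrier_mccord:
  assumes X: "finite_T0 X" and \<eta>: "mccord_map X \<eta>"
  shows "carrier (homology_group (int k) X) =
    (\<lambda>c. mccord_class k X \<eta> c) ` {c. simplicial_cycle X k c}"
  unfolding carrier_relative_homology_group
  using mccord_cycle[OF \<eta>] mccord_cycle_surj[OF X \<eta>] by (fastforce simp: image_iff)

text \<open>A chain map \<open>s\<close> carried by preimages represents the inverse of \<open>f\<^sub>*\<close>. Let \<open>\<phi>\<close> be carried by
  images. Then \<open>\<phi> s\<close> and the identity are carried by the full simplex on \<open>ys\<close>, and \<open>s \<phi>\<close> and the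
  identity are carried by the preimage of the image of \<open>xs\<close>; so \<open>\<phi>\<close> and \<open>s\<close> are inverse up to
  homotopy.\<close>
lemma vietoris_inverse_class:
  assumes X: "finite_T0 X" and Y: "finite_T0 Y" and f: "vietoris_like_map X Y f"
    and \<eta>X: "mccord_map X \<eta>X" and \<eta>Y: "mccord_map Y \<eta>Y"
    and s: "carried_map Y (\<lambda>_. list_boundary)
      (\<lambda>ys. order_chains X {x \<in> topspace X. f x \<in> set ys}) s"
    and sNil: "s [] = frag_of []" and c: "simplicial_cycle Y k c"
  shows "inv_into (carrier (homology_group (int k) X)) (hom_induced (int k) X {} Y {} f)
      (mccord_class k Y \<eta>Y c) = mccord_class k X \<eta>X (frag_extend s c)"
proof -
  let ?l = "\<lambda>_::nat. list_boundary" and ?f = "hom_induced (int k) X {} Y {} f"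
  let ?C = "\<lambda>X. frags (simplices X (Suc k))"
  have cont: "continuous_map X Y f" using f by (simp add: vietoris_like_map_def)
  obtain \<phi> where \<phi>Nil: "\<phi> [] = frag_of []"
    and \<phi>: "carried_map X ?l (\<lambda>xs. order_chains Y (f ` set xs)) \<phi>"
    using carried_map_ex[OF acyclic_carrier_image[OF X Y cont], of "frag_of []"]
    by (auto simp: order_simplices_def)
  have im: "f ` set xs \<subseteq> topspace Y" if "xs \<in> order_lists X" for xs
    using that cont by (auto simp: order_lists_def continuous_map_def)
  have pre: "{x \<in> topspace X. f x \<in> set ys} \<subseteq> topspace X" for ys by auto
  have f_class: "?f (mccord_class k X \<eta>X t) =
      mccord_class k Y \<eta>Y (frag_extend \<phi> t)" if "simplicial_cycle X k t" for t
    by (rule hom_induced_mccord_class[OF X Y cont \<eta>X \<eta>Y \<phi> \<phi>Nil that])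
  have s_cycle: "simplicial_cycle X k (frag_extend s z)" if "simplicial_cycle Y k z" for z
    by (rule carried_map_cycle[OF s pre sNil that])
  have \<phi>_cycle: "simplicial_cycle Y k (frag_extend \<phi> t)" if "simplicial_cycle X k t" for t
    by (rule carried_map_cycle[OF \<phi> im \<phi>Nil that])
  have ps: "frag_extend \<phi> (frag_extend s z) - z \<in> bd ` ?C Y"
    if z: "simplicial_cycle Y k z" for z
  proof -
    have 1: "carried_map Y ?l (\<lambda>ys. order_chains Y (id ` set ys)) (\<lambda>ys. frag_extend \<phi> (s ys))"
      by (rule carried_map_compose[OF s pre \<phi>]) (rule order_simplices_mono, auto simp: order_simplices_def)
    have 2: "carried_map Y ?l (\<lambda>ys. order_chains Y (id ` set ys)) frag_of"
      by (rule carried_map_ident) (auto simp: order_lists_def order_simplices_def)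
    have "\<exists>b\<in>?C Y. bd b = frag_extend (\<lambda>ys. frag_extend \<phi> (s ys)) z - frag_extend frag_of z"
      by (rule carried_maps_homologous[OF acyclic_carrier_image[OF Y Y continuous_map_id] 1 2 _ _ z])
        (auto simp: sNil \<phi>Nil order_lists_def order_simplices_def)
    then obtain b where "b \<in> ?C Y"
      "bd b = frag_extend (\<lambda>ys. frag_extend \<phi> (s ys)) z - frag_extend frag_of z" by blast
    then show ?thesis by (intro image_eqI[of _ _ b]) (simp_all add: frag_extend_extend)
  qed
  have sp: "frag_extend s (frag_extend \<phi> t) - t \<in> bd ` ?C X"
    if t: "simplicial_cycle X k t" for t
  proof -
    let ?K = "\<lambda>xs. order_chains X {x \<in> topspace X. f x \<in> f ` set xs}"
    have 1: "carried_map X ?l ?K (\<lambda>xs. frag_extend s (\<phi> xs))"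
    proof (rule carried_map_compose[OF \<phi> im s])
      fix xs ys assume "ys \<in> order_chains Y (f ` set xs) (length xs)"
      then have "set ys \<subseteq> f ` set xs" by (simp add: order_simplices_def)
      then show "order_chains X {x \<in> topspace X. f x \<in> set ys} (length xs) \<subseteq> ?K xs (length xs)"
        by (intro order_simplices_mono) blast
    qed
    have 2: "carried_map X ?l ?K frag_of"
      by (rule carried_map_ident) (auto simp: order_lists_def order_simplices_def)
    have "\<exists>b\<in>?C X. bd b = frag_extend (\<lambda>xs. frag_extend s (\<phi> xs)) t - frag_extend frag_of t"
      by (rule carried_maps_homologous[OF acyclic_carrier_preimage_image[OF X Y f] 1 2 _ _ t])
        (auto simp: sNil \<phi>Nil order_lists_def order_simplices_def)
    then obtain b where "b \<in> ?C X"
      "bd b = frag_extend (\<lambda>xs. frag_extend s (\<phi> xs)) t - frag_extend frag_of t" by blast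
    then show ?thesis by (intro image_eqI[of _ _ b]) (simp_all add: frag_extend_extend)
  qed
  have inj: "inj_on ?f (carrier (homology_group (int k) X))"
    unfolding carrier_mccord[OF X \<eta>X]
  proof (rule inj_onI, clarsimp simp del: homologous_rel_set_eq)
    fix t t' assume t: "simplicial_cycle X k t" and t': "simplicial_cycle X k t'"
      and eq: "?f (mccord_class k X \<eta>X t) = ?f (mccord_class k X \<eta>X t')"
    let ?t = "t - t'"
    have tt: "simplicial_cycle X k ?t" by (rule simplicial_cycle_diff[OF t t'])
    have "frag_extend \<phi> ?t \<in> bd ` ?C Y"
      using eq unfolding f_class[OF t] f_class[OF t'] mccord_class_eq_iff[OF Y \<eta>Y \<phi>_cycle[OF t] \<phi>_cycle[OF t']]
      by (simp add: frag_extend_diff)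
    then obtain u where u: "u \<in> ?C Y" "frag_extend \<phi> ?t = bd u" by blast
    have "frag_extend s (frag_extend \<phi> ?t) = bd (frag_extend s u)"
      using carried_map_frags(2)[OF s pre u(1)] u(2) by simp
    moreover have "frag_extend s u \<in> ?C X" by (rule carried_map_frags(1)[OF s pre u(1)])
    moreover obtain b where b: "b \<in> ?C X" "frag_extend s (frag_extend \<phi> ?t) - ?t = bd b"
      using sp[OF tt] by blast
    ultimately have "?t = bd (frag_extend s u - b)" "frag_extend s u - b \<in> ?C X"
      by (auto simp: frag_extend_diff frags_diff algebra_simps)
    then have "?t \<in> bd ` ?C X" by blast
    then show "mccord_class k X \<eta>X t = mccord_class k X \<eta>X t'"
      using mccord_class_eq_iff[OF X \<eta>X t t'] by blast
  qed
  have "?f (mccord_class k X \<eta>X (frag_extend s c)) = mccord_class k Y \<eta>Y c"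
    unfolding f_class[OF s_cycle[OF c]]
    using ps[OF c] mccord_class_eq_iff[OF Y \<eta>Y \<phi>_cycle[OF s_cycle[OF c]] c] by blast
  moreover have "mccord_class k X \<eta>X (frag_extend s c) \<in> carrier (homology_group (int k) X)"
    unfolding carrier_mccord[OF X \<eta>X] using s_cycle[OF c] by blast
  ultimately show ?thesis using inv_into_f_f[OF inj] by metis
qed

text \<open>The trace that a nonzero matrix entry leaves on points: an order-preserving choice, for the
  elements \<open>y\<close> of \<open>ys\<close>, of elements of \<open>xs\<close> that \<open>G\<close> relates to \<open>y\<close>. It runs against the direction of \<open>G\<close>.\<close>
definition monotone_selection :: "'a topology \<Rightarrow> 'b topology \<Rightarrow> ('a \<Rightarrow> 'b set) \<Rightarrow> 'a list \<Rightarrow> 'b list \<Rightarrow> bool"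
  where "monotone_selection X Y G xs ys \<longleftrightarrow> (\<exists>f. (\<forall>y\<in>set ys. f y \<in> set xs \<and> y \<in> G (f y)) \<and>
    (\<forall>y\<in>set ys. \<forall>y'\<in>set ys. spec_le Y y y' \<longrightarrow> spec_le X (f y) (f y')))"

lemma order_simplices_distinct:
  assumes "xs \<in> order_chains X A n"
  shows "distinct xs"
proof -
  have "sorted_wrt (spec_greater X) xs" using assms by (simp add: order_simplices_def)
  then show ?thesis
    by (induction xs) (auto simp: spec_greater_def spec_less_def)
qed

lemma order_chain_comparable:
  assumes "xs \<in> order_chains X A n" "A \<subseteq> topspace X" "x \<in> set xs" "y \<in> set xs"
  shows "spec_le X x y \<or> spec_le X y x"
proof -
  have "sorted_wrt (spec_greater X) xs" "set xs \<subseteq> topspace X" using assms(1,2) by (auto simp: order_simplices_def)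
  then show ?thesis
    using assms(3,4)
    by (induction xs) (auto simp: spec_greater_def spec_less_def spec_le_refl)
qed

lemma finite_T0_graph_space:
  assumes "finite_T0 X" "finite_T0 Y"
  shows "finite_T0 (graph_space X Y G)"
proof -
  have "topspace (graph_space X Y G) \<subseteq> topspace X \<times> topspace Y"
    by (auto simp: topspace_graph_space multi_graph_def)
  then show ?thesis
    using assms unfolding finite_T0_def graph_space_def
    by (auto intro: finite_subset t0_space_subtopology t0_space_prod_topologyI)
qed

text \<open>\<open>\<phi>\<close> induces \<open>\<Phi>\<close> on homology, and its matrix entries are controlled by \<open>G\<close>. Both properties
  are stable under composition.\<close>
definition chain_representative ::
    "'a topology \<Rightarrow> 'b topology \<Rightarrow> ('a list \<Rightarrow> 'a chain) \<Rightarrow> ('b list \<Rightarrow> 'b chain) \<Rightarrow> ('a \<Rightarrow> 'b set) \<Rightarrow>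
      (int \<Rightarrow> 'a chain set \<Rightarrow> 'b chain set) \<Rightarrow> ('a list \<Rightarrow> 'b list \<Rightarrow>\<^sub>0 int) \<Rightarrow> bool"
  where "chain_representative X Y \<eta>X \<eta>Y G \<Phi> \<phi> \<longleftrightarrow> \<phi> [] = frag_of [] \<and>
    carried_map X (\<lambda>_. list_boundary) (\<lambda>_. order_chains Y (topspace Y)) \<phi> \<and>
    (\<forall>xs\<in>order_lists X. \<forall>ys\<in>supp (\<phi> xs). monotone_selection X Y G xs ys) \<and>
    (\<forall>k c. simplicial_cycle X k c \<longrightarrow>
      \<Phi> (int k) (mccord_class k X \<eta>X c) = mccord_class k Y \<eta>Y (frag_extend \<phi> c))"

lemma chain_representativeD:
  assumes "chain_representative X Y \<eta>X \<eta>Y G \<Phi> \<phi>"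
  shows "\<phi> [] = frag_of []"
    and "carried_map X (\<lambda>_. list_boundary) (\<lambda>_. order_chains Y (topspace Y)) \<phi>"
    and "xs \<in> order_lists X \<Longrightarrow> ys \<in> supp (\<phi> xs) \<Longrightarrow> monotone_selection X Y G xs ys"
    and "simplicial_cycle X k c \<Longrightarrow>
      \<Phi> (int k) (mccord_class k X \<eta>X c) = mccord_class k Y \<eta>Y (frag_extend \<phi> c)"
  using assms by (auto simp: chain_representative_def)

text \<open>The chain map is \<open>r \<circ> s\<close> with \<open>s\<close> carried by preimages under the projection to \<open>X\<close>, and \<open>r\<close> by
  images under the projection to \<open>Y\<close>. A list \<open>ys\<close> in the support of the image of \<open>xs\<close> comes from a chain
  \<open>zs\<close> of the graph of the same length, over \<open>xs\<close>, and the projection from \<open>zs\<close> to \<open>ys\<close> is a bijection;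
  since \<open>zs\<close> is totally ordered, its inverse is order-preserving.\<close>
theorem vietoris_multimap_chain_map:
  assumes X: "finite_T0 X" and Y: "finite_T0 Y" and G: "vietoris_like_multimap X Y G"
    and \<eta>X: "mccord_map X \<eta>X" and \<eta>Y: "mccord_map Y \<eta>Y"
  shows "\<exists>\<phi>. chain_representative X Y \<eta>X \<eta>Y G (\<lambda>k. multi_induced k X Y G) \<phi>"
proof -
  let ?\<Gamma> = "graph_space X Y G" and ?l = "\<lambda>_::nat. list_boundary"
  have \<Gamma>: "finite_T0 ?\<Gamma>" by (rule finite_T0_graph_space[OF X Y])
  have p: "vietoris_like_map ?\<Gamma> X fst" using G by (simp add: vietoris_like_multimap_def)
  have q: "continuous_map ?\<Gamma> Y snd"
    unfolding graph_space_def by (intro continuous_map_from_subtopology continuous_map_snd)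
  obtain \<eta> where \<eta>: "mccord_map ?\<Gamma> \<eta>" using mccord_map_ex[OF \<Gamma>] by blast
  let ?P = "\<lambda>xs. {z \<in> topspace ?\<Gamma>. fst z \<in> set xs}"
  obtain s where sNil: "s [] = frag_of []"
    and s: "carried_map X ?l (\<lambda>xs. order_chains ?\<Gamma> (?P xs)) s"
    using carried_map_ex[OF acyclic_carrier_preimage[OF \<Gamma> X p], of "frag_of []"]
    by (auto simp: order_simplices_def)
  obtain r where rNil: "r [] = frag_of []"
    and r: "carried_map ?\<Gamma> ?l (\<lambda>zs. order_chains Y (snd ` set zs)) r"
    using carried_map_ex[OF acyclic_carrier_image[OF \<Gamma> Y q], of "frag_of []"]
    by (auto simp: order_simplices_def)
  have pre: "?P xs \<subseteq> topspace ?\<Gamma>" for xs by auto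
  have im: "snd ` set zs \<subseteq> topspace Y" if "zs \<in> order_lists ?\<Gamma>" for zs
    using that q by (auto simp: order_lists_def continuous_map_def Pi_def)
  define \<phi> where "\<phi> = (\<lambda>xs. frag_extend r (s xs))"
  have "\<phi> [] = frag_of []" by (simp add: \<phi>_def sNil rNil)
  moreover have "carried_map X ?l (\<lambda>_. order_chains Y (topspace Y)) \<phi>"
    unfolding \<phi>_def
  proof (rule carried_map_compose[OF s pre r])
    fix xs zs assume "zs \<in> order_chains ?\<Gamma> (?P xs) (length xs)"
    then have "zs \<in> order_lists ?\<Gamma>" by (auto simp: order_simplices_def order_lists_def)
    then show "order_chains Y (snd ` set zs) (length xs) \<subseteq> order_chains Y (topspace Y) (length xs)"
      by (intro order_simplices_mono im)
  qed
  moreover have "monotone_selection X Y G xs ys"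
    if xs: "xs \<in> order_lists X" and ys: "ys \<in> supp (\<phi> xs)" for xs ys
  proof -
    obtain zs where zs: "zs \<in> supp (s xs)" "ys \<in> supp (r zs)"
      using ys keys_frag_extend[of r "s xs"] by (auto simp: \<phi>_def)
    have zC: "zs \<in> order_chains ?\<Gamma> (?P xs) (length xs)"
      using s xs zs(1) by (auto simp: carried_map_def frags_def)
    then have zL: "zs \<in> order_lists ?\<Gamma>" and len: "length zs = length xs"
      by (auto simp: order_simplices_def order_lists_def)
    have yC: "ys \<in> order_chains Y (snd ` set zs) (length zs)"
      using r zL zs(2) by (auto simp: carried_map_def frags_def)
    have "card (set ys) = length zs"
      using order_simplices_distinct[OF yC] yC distinct_card[of ys] by (simp add: order_simplices_def)
    moreover have "card (set zs) = length zs"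
      using order_simplices_distinct[OF zC] by (rule distinct_card)
    moreover have sub: "set ys \<subseteq> snd ` set zs" using yC by (simp add: order_simplices_def)
    \<comment> \<open>equal lengths force the projection to be injective on \<open>zs\<close>\<close>
    ultimately have "card (snd ` set zs) = card (set zs)"
      using card_mono[OF _ sub] card_image_le[of "set zs" snd] by simp
    then have inj: "inj_on snd (set zs)" by (rule eq_card_imp_inj_on[rotated]) simp
    define g where "g = the_inv_into (set zs) snd"
    have g: "g y \<in> set zs" "snd (g y) = y" if "y \<in> set ys" for y
      using that sub the_inv_into_into[OF inj _ order_refl, of y] f_the_inv_into_f[OF inj, of y]
      by (auto simp: g_def)
    have z_mem: "z \<in> topspace ?\<Gamma>" "fst z \<in> set xs" if "z \<in> set zs" for z
      using that zC by (auto simp: order_simplices_def)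
    show ?thesis
      unfolding monotone_selection_def
    proof (intro exI[of _ "fst \<circ> g"] conjI ballI impI)
      fix y assume y: "y \<in> set ys"
      show "(fst \<circ> g) y \<in> set xs" using z_mem(2)[OF g(1)[OF y]] by simp
      show "y \<in> G ((fst \<circ> g) y)"
        using z_mem(1)[OF g(1)[OF y]] g(2)[OF y] by (auto simp: topspace_graph_space multi_graph_def)
    next
      fix y y' assume y: "y \<in> set ys" "y' \<in> set ys" and le: "spec_le Y y y'"
      have gt: "g y \<in> topspace ?\<Gamma>" "g y' \<in> topspace ?\<Gamma>" using z_mem(1) g(1) y by auto
      have "spec_le ?\<Gamma> (g y) (g y') \<or> spec_le ?\<Gamma> (g y') (g y)"
        by (rule order_chain_comparable[OF zC pre g(1)[OF y(1)] g(1)[OF y(2)]])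
      moreover have "g y = g y'" if "spec_le ?\<Gamma> (g y') (g y)"
      proof -
        have "spec_le Y y' y"
          using continuous_map_spec_le[OF \<Gamma> Y q that] g(2) y by simp
        then show ?thesis using spec_le_antisym[OF Y le] by simp
      qed
      ultimately have "spec_le ?\<Gamma> (g y) (g y')" using spec_le_refl[OF gt(1)] by auto
      then show "spec_le X ((fst \<circ> g) y) ((fst \<circ> g) y')"
        using continuous_map_spec_le[OF \<Gamma> X _ \<open>spec_le ?\<Gamma> (g y) (g y')\<close>, of fst] p
        by (simp add: vietoris_like_map_def)
    qed
  qed
  moreover have "multi_induced (int k) X Y G (mccord_class k X \<eta>X c) =
      mccord_class k Y \<eta>Y (frag_extend \<phi> c)" if c: "simplicial_cycle X k c" for k c
  proof -
    have sc: "simplicial_cycle ?\<Gamma> k (frag_extend s c)" by (rule carried_map_cycle[OF s pre sNil c])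
    show ?thesis
      unfolding multi_induced_def o_def
        vietoris_inverse_class[OF \<Gamma> X p \<eta> \<eta>X s sNil c]
        hom_induced_mccord_class[OF \<Gamma> Y q \<eta> \<eta>Y r rNil sc]
      by (simp add: \<phi>_def frag_extend_extend)
  qed
  ultimately show ?thesis unfolding chain_representative_def by blast
qed

section \<open>Lefschetz numbers and fixed points\<close>

text \<open>The boundary without augmentation, as the Lefschetz number refers to unreduced homology.\<close>
definition simplex_boundary :: "'a list \<Rightarrow> ('a list \<Rightarrow>\<^sub>0 int)"
  where "simplex_boundary xs = (if length xs \<le> 1 then 0 else list_boundary xs)"

lemma simplex_boundary_0: "c \<in> frags (simplices X 0) \<Longrightarrow> frag_extend simplex_boundary c = 0"
  by (erule frag_extend_zero_on) (simp add: simplex_boundary_def order_simplices_def)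

lemma simplex_boundary_Suc:
  "c \<in> frags (simplices X (Suc k)) \<Longrightarrow> frag_extend simplex_boundary c = bd c"
  by (erule frag_extend_cong_frags) (simp add: simplex_boundary_def order_simplices_def)

lemma finite_complex_simplices:
  assumes X: "finite_T0 X"
  shows "finite_complex (simplices X) simplex_boundary"
proof
  fix k
  have "finite {xs. set xs \<subseteq> topspace X \<and> length xs = Suc k}"
    using X by (intro finite_lists_length_eq) (simp add: finite_T0_def)
  then show "finite (simplices X k)"
    by (rule rev_finite_subset) (auto simp: order_simplices_def)
  show "simplex_boundary s = 0" if "s \<in> simplices X 0" for s
    using that by (simp add: simplex_boundary_def order_simplices_def)
  show D: "simplex_boundary s \<in> frags (simplices X k)" if "s \<in> simplices X (Suc k)" for s k
    using list_boundary_in[OF that] that by (simp add: simplex_boundary_def order_simplices_def)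
  show "frag_extend simplex_boundary (simplex_boundary s) = 0" if s: "s \<in> simplices X k" for s
  proof -
    consider "k = 0" | "k = 1" | j where "k = Suc (Suc j)"
      by atomize_elim presburger
    then show ?thesis
    proof cases
      case 1
      then show ?thesis using s by (simp add: simplex_boundary_def order_simplices_def)
    next
      case 2
      then show ?thesis using D[of s 0] s by (intro simplex_boundary_0) auto
    next
      case (3 j)
      then show ?thesis
        using D[of s "Suc j"] s simplex_boundary_Suc[of "simplex_boundary s" X j]
        by (simp add: simplex_boundary_def order_simplices_def list_boundary_list_boundary)
    qed
  qed
qed

lemma cycles_simplices:
  assumes X: "finite_T0 X"
  shows "finite_complex.cycles (simplices X) simplex_boundary k = {c. simplicial_cycle X k c}"
proof -
  interpret finite_complex "simplices X" simplex_boundary by (rule finite_complex_simplices[OF X])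
  have "c \<in> cycles k \<longleftrightarrow> simplicial_cycle X k c" for c
  proof (cases k)
    case 0
    have "frags (order_chains X (topspace X) 0) \<subseteq> frags {[]}"
      by (auto simp: frags_def order_simplices_def)
    then show ?thesis
      using list_boundary_frags[of c _ "topspace X" 0] simplex_boundary_0[of c X] 0
      by (auto simp: cycles_def simplicial_cycle_def)
  next
    case (Suc j)
    then show ?thesis
      using simplicial_cycle_Suc[of X j c] simplex_boundary_Suc[of c X j]
      by (auto simp: cycles_def simplicial_cycle_def)
  qed
  then show ?thesis by blast
qed

lemma boundaries_simplices:
  assumes X: "finite_T0 X"
  shows "finite_complex.boundaries (simplices X) simplex_boundary k =
    bd ` frags (simplices X (Suc k))"
proof -
  interpret finite_complex "simplices X" simplex_boundary by (rule finite_complex_simplices[OF X])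
  show ?thesis unfolding boundaries_def by (intro image_cong refl simplex_boundary_Suc)
qed

lemma presented_homology_group:
  assumes X: "finite_T0 X" and \<eta>: "mccord_map X \<eta>"
  shows "presented_group (homology_group (int k) X)
    (finite_complex.cycles (simplices X) simplex_boundary k)
    (finite_complex.boundaries (simplices X) simplex_boundary k)
    (\<lambda>c. mccord_class k X \<eta> c)"
proof -
  interpret finite_complex "simplices X" simplex_boundary by (rule finite_complex_simplices[OF X])
  interpret comm_group "homology_group (int k) X" by (rule abelian_homology_group)
  show ?thesis
  proof
    show "frag_subgroup (cycles k)" by (rule frag_subgroup_cycles)
    show "frag_subgroup (boundaries k)" by (rule frag_subgroup_boundaries)
    show "boundaries k \<subseteq> cycles k" by (rule boundaries_subset_cycles)
    show "mccord_class k X \<eta> (x + y) =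
        mccord_class k X \<eta> x \<otimes>\<^bsub>homology_group (int k) X\<^esub>
        mccord_class k X \<eta> y" for x y
    proof -
      let ?a = "frag_extend \<eta> x" and ?b = "frag_extend \<eta> y"
      have "homologous_rel k X {} (?a + ?b) c \<longleftrightarrow>
          (\<exists>a'. homologous_rel k X {} ?a a' \<and> (\<exists>b'. homologous_rel k X {} ?b b' \<and> c = a' + b'))" for c
      proof
        assume "homologous_rel k X {} (?a + ?b) c"
        then have "homologous_rel k X {} ?a (c - ?b)"
          by (simp add: homologous_rel_def algebra_simps)
        then show "\<exists>a'. homologous_rel k X {} ?a a' \<and> (\<exists>b'. homologous_rel k X {} ?b b' \<and> c = a' + b')"
          by (intro exI[of _ "c - ?b"] conjI exI[of _ ?b]) simp_all
      next
        assume "\<exists>a'. homologous_rel k X {} ?a a' \<and> (\<exists>b'. homologous_rel k X {} ?b b' \<and> c = a' + b')"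
        then show "homologous_rel k X {} (?a + ?b) c" using homologous_rel_add by blast
      qed
      then show ?thesis
        unfolding mult_relative_homology_group frag_extend_add by (simp add: set_eq_iff)
    qed
    show "mccord_class k X \<eta> x = \<one>\<^bsub>homology_group (int k) X\<^esub> \<longleftrightarrow> x \<in> boundaries k"
      if "x \<in> cycles k" for x
      using that mccord_boundary_iff[OF X \<eta>]
      unfolding one_relative_homology_group homologous_rel_set_eq_relboundary
        cycles_simplices[OF X] boundaries_simplices[OF X] by blast
    show "(\<lambda>c. mccord_class k X \<eta> c) ` cycles k = carrier (homology_group (int k) X)"
      unfolding carrier_mccord[OF X \<eta>] cycles_simplices[OF X] ..
  qed
qed

lemma simplices_empty:
  assumes X: "finite_T0 X" and k: "k > card (topspace X)"
  shows "simplices X k = {}"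
proof -
  have False if "xs \<in> simplices X k" for xs
  proof -
    have "card (set xs) = Suc k" "set xs \<subseteq> topspace X"
      using distinct_card[OF order_simplices_distinct[OF that]] that by (auto simp: order_simplices_def)
    then have "Suc k \<le> card (topspace X)"
      using card_mono[of "topspace X" "set xs"] X by (simp add: finite_T0_def)
    then show False using k by simp
  qed
  then show ?thesis by blast
qed

theorem lefschetz_number_chain_map:
  assumes X: "finite_T0 X" and \<eta>: "mccord_map X \<eta>" and rep: "chain_representative X X \<eta> \<eta> F \<Phi> \<phi>"
  shows "lefschetz_number X \<Phi> = (\<Sum>k\<le>card (topspace X). (-1) ^ k * trace_on (simplices X k) \<phi>)"
proof -
  interpret finite_complex "simplices X" simplex_boundary by (rule finite_complex_simplices[OF X])
  note Nil = chain_representativeD(1)[OF rep] and \<phi> = chain_representativeD(2)[OF rep]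
    and \<Phi> = chain_representativeD(4)[OF rep]
  let ?M = "card (topspace X)" and ?cl = "\<lambda>k c. mccord_class k X \<eta> c"
  let ?t = "\<lambda>k. torsion_free_trace (homology_group (int k) X) (\<Phi> (int k))"
  have \<phi>_frags: "\<phi> s \<in> frags (simplices X k)" if "s \<in> simplices X k" for s k
    using \<phi> that by (auto simp: carried_map_def order_lists_def order_simplices_def)
  have comm: "frag_extend simplex_boundary (\<phi> s) = frag_extend \<phi> (simplex_boundary s)"
    if s: "s \<in> simplices X k" for s k
  proof (cases k)
    case 0
    then show ?thesis
      using simplex_boundary_0[OF \<phi>_frags[of s 0]] s by (simp add: simplex_boundary_def order_simplices_def)
  next
    case (Suc j)
    then have "frag_extend simplex_boundary (\<phi> s) = bd (\<phi> s)"
      using simplex_boundary_Suc[OF \<phi>_frags[of s "Suc j"]] s by simp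
    also have "\<dots> = frag_extend \<phi> (list_boundary s)"
      using \<phi> s by (auto simp: carried_map_def order_lists_def order_simplices_def)
    also have "list_boundary s = simplex_boundary s"
      using s Suc by (simp add: simplex_boundary_def order_simplices_def)
    finally show ?thesis .
  qed
  have pre: "topspace X \<subseteq> topspace X" by simp
  have "\<exists>n z c. basis_mod (cycles k) (weak_boundaries k) n z c \<and> ?t k = (\<Sum>i<n. c i (frag_extend \<phi> (z i)))" for k
  proof -
    interpret P: presented_group "homology_group (int k) X" "cycles k" "boundaries k" "?cl k"
      by (rule presented_homology_group[OF X \<eta>])
    have "x \<in> cycles k" if x: "x \<in> frags (simplices X k)" "m > 0" "frag_cmul m x \<in> boundaries k" for x m
    proof -
      have "frag_cmul m x \<in> cycles k" using x(3) boundaries_subset_cycles by blast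
      then show ?thesis using x by (simp add: cycles_def frag_extend_cmul)
    qed
    moreover have "x \<in> frags (simplices X k)" if "x \<in> cycles k" for x
      using that by (simp add: cycles_def)
    ultimately have weak: "P.torsion_relations = weak_boundaries k"
      unfolding P.torsion_relations_def weak_boundaries_def by blast
    obtain n z c where "basis_mod (cycles k) (weak_boundaries k) n z c" using homology_basis_ex by blast
    then have b: "basis_mod (cycles k) P.torsion_relations n z c" by (simp add: weak)
    have f_cycle: "frag_extend \<phi> x \<in> cycles k" if "x \<in> cycles k" for x
      using that carried_map_cycle[OF \<phi> pre Nil] unfolding cycles_simplices[OF X] by blast
    have f_boundary: "frag_extend \<phi> x \<in> boundaries k" if x: "x \<in> boundaries k" for x
    proof -
      obtain y where y: "y \<in> frags (simplices X (Suc k))" "x = bd y"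
        using x unfolding boundaries_simplices[OF X] by blast
      then have "frag_extend \<phi> x = bd (frag_extend \<phi> y)"
        using carried_map_frags(2)[OF \<phi> pre y(1)] by simp
      then show ?thesis
        unfolding boundaries_simplices[OF X] using carried_map_frags(1)[OF \<phi> pre y(1)] by blast
    qed
    have cls: "\<Phi> (int k) (?cl k x) = ?cl k (frag_extend \<phi> x)" if "x \<in> cycles k" for x
      using that unfolding cycles_simplices[OF X] by (simp add: \<Phi>)
    show ?thesis
      using P.torsion_free_trace_basis[OF b f_cycle frag_extend_diff f_boundary cls] unfolding weak by blast
  qed
  then have "\<forall>k. \<exists>p. basis_mod (cycles k) (weak_boundaries k) (fst p) (fst (snd p)) (snd (snd p)) \<and>
      ?t k = (\<Sum>i<fst p. snd (snd p) i (frag_extend \<phi> (fst (snd p) i)))"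
    by (simp only: split_paired_Ex fst_conv snd_conv) blast
  then obtain p where p: "\<forall>k. basis_mod (cycles k) (weak_boundaries k) (fst (p k)) (fst (snd (p k))) (snd (snd (p k))) \<and>
      ?t k = (\<Sum>i<fst (p k). snd (snd (p k)) i (frag_extend \<phi> (fst (snd (p k)) i)))"
    by (rule choice[THEN exE])
  define n where "n = (\<lambda>k. fst (p k))"
  define z where "z = (\<lambda>k. fst (snd (p k)))"
  define c where "c = (\<lambda>k. snd (snd (p k)))"
  have basis: "basis_mod (cycles k) (weak_boundaries k) (n k) (z k) (c k)"
    and t: "?t k = (\<Sum>i<n k. c k i (frag_extend \<phi> (z k i)))" for k
    using p unfolding n_def z_def c_def by blast+
  \<comment> \<open>above the dimension of the order complex the only cycle is \<open>0\<close>, so the basis is empty and the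
    sum over all degrees is a finite one\<close>
  have "n k = 0" if k: "k > ?M" for k
  proof (rule ccontr)
    assume "n k \<noteq> 0"
    then have pos: "0 < n k" by simp
    have "c k 0 (0 - 0) = c k 0 0 - c k 0 0"
      using basis[of k] pos cycles_0[of k] unfolding basis_mod_def by blast
    moreover have "z k 0 \<in> cycles k" "c k 0 (z k 0) = 1"
      using basis[of k] pos by (simp_all add: basis_mod_def)
    moreover have "cycles k = {0}" using simplices_empty[OF X k] cycles_0[of k] by (auto simp: cycles_def)
    ultimately show False by simp
  qed
  then have "?t k = 0" if "k > ?M" for k unfolding t using that by simp
  then have "{k. (-1) ^ k * ?t k \<noteq> 0} \<subseteq> {..?M}"
    by (intro subsetI) (simp only: mem_Collect_eq atMost_iff not_le[symmetric] mult_eq_0_iff, blast)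
  then have "lefschetz_number X \<Phi> = (\<Sum>k\<le>?M. (-1) ^ k * ?t k)"
    unfolding lefschetz_number_def by (intro Sum_any.expand_superset) auto
  also have "\<dots> = (\<Sum>k\<le>?M. (-1) ^ k * trace_on (simplices X k) \<phi>)"
    unfolding t by (rule hopf_trace[OF \<phi>_frags comm simplices_empty[OF X] basis])
  finally show ?thesis .
qed

lemma monotone_selection_compose:
  assumes "monotone_selection X Y F xs ys" "monotone_selection Y Z G ys zs"
  shows "monotone_selection X Z (multi_comp G F) xs zs"
proof -
  obtain f g where f: "\<And>y. y \<in> set ys \<Longrightarrow> f y \<in> set xs \<and> y \<in> F (f y)"
      "\<And>y y'. y \<in> set ys \<Longrightarrow> y' \<in> set ys \<Longrightarrow> spec_le Y y y' \<Longrightarrow> spec_le X (f y) (f y')"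
    and g: "\<And>z. z \<in> set zs \<Longrightarrow> g z \<in> set ys \<and> z \<in> G (g z)"
      "\<And>z z'. z \<in> set zs \<Longrightarrow> z' \<in> set zs \<Longrightarrow> spec_le Z z z' \<Longrightarrow> spec_le Y (g z) (g z')"
    using assms unfolding monotone_selection_def by blast
  show ?thesis
    unfolding monotone_selection_def
  proof (intro exI[of _ "f \<circ> g"] conjI ballI impI)
    fix z assume z: "z \<in> set zs"
    show "(f \<circ> g) z \<in> set xs" using f(1) g(1)[OF z] by simp
    show "z \<in> multi_comp G F ((f \<circ> g) z)"
      unfolding multi_comp_def using f(1)[of "g z"] g(1)[OF z] by (intro UN_I[of "g z"]) simp_all
  next
    fix z z' assume "z \<in> set zs" "z' \<in> set zs" "spec_le Z z z'"
    then show "spec_le X ((f \<circ> g) z) ((f \<circ> g) z')" using f(2) g by simp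
  qed
qed

lemma chain_representative_compose:
  assumes \<phi>: "chain_representative X Y \<eta>X \<eta>Y F \<Phi> \<phi>" and \<psi>: "chain_representative Y Z \<eta>Y \<eta>Z G \<Psi> \<psi>"
  shows "chain_representative X Z \<eta>X \<eta>Z (multi_comp G F) (\<lambda>k. \<Psi> k \<circ> \<Phi> k) (\<lambda>xs. frag_extend \<psi> (\<phi> xs))"
  unfolding chain_representative_def
proof (intro conjI ballI allI impI)
  note \<phi>' = chain_representativeD[OF \<phi>] and \<psi>' = chain_representativeD[OF \<psi>]
  have Y: "topspace Y \<subseteq> topspace Y" by simp
  show "frag_extend \<psi> (\<phi> []) = frag_of []" by (simp add: \<phi>'(1) \<psi>'(1))
  show "carried_map X (\<lambda>_. list_boundary) (\<lambda>_. order_chains Z (topspace Z)) (\<lambda>xs. frag_extend \<psi> (\<phi> xs))"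
    by (rule carried_map_compose[OF \<phi>'(2) Y \<psi>'(2)]) simp
  fix xs zs assume xs: "xs \<in> order_lists X" and zs: "zs \<in> supp (frag_extend \<psi> (\<phi> xs))"
  obtain ys where ys: "ys \<in> supp (\<phi> xs)" "zs \<in> supp (\<psi> ys)"
    using zs keys_frag_extend[of \<psi> "\<phi> xs"] by auto
  then have "ys \<in> order_lists Y"
    using \<phi>'(2) xs by (auto simp: carried_map_def frags_def order_simplices_def order_lists_def)
  then show "monotone_selection X Z (multi_comp G F) xs zs"
    using monotone_selection_compose[OF \<phi>'(3)[OF xs ys(1)] \<psi>'(3)[OF _ ys(2)]] by simp
next
  note \<phi>' = chain_representativeD[OF \<phi>] and \<psi>' = chain_representativeD[OF \<psi>]
  fix k c assume c: "simplicial_cycle X k c"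
  have cycle: "simplicial_cycle Y k (frag_extend \<phi> c)"
    by (rule carried_map_cycle[OF \<phi>'(2) _ \<phi>'(1) c]) simp
  have eq: "frag_extend (\<lambda>xs. frag_extend \<psi> (\<phi> xs)) c = frag_extend \<psi> (frag_extend \<phi> c)"
    by (simp add: frag_extend_extend)
  show "(\<Psi> (int k) \<circ> \<Phi> (int k)) (mccord_class k X \<eta>X c) =
      mccord_class k Z \<eta>Z (frag_extend (\<lambda>xs. frag_extend \<psi> (\<phi> xs)) c)"
    unfolding eq o_apply \<phi>'(4)[OF c] by (rule \<psi>'(4)[OF cycle])
qed

text \<open>The greatest element \<open>m\<close> with \<open>m \<le> f m\<close>; the least element of the chain shows that there is one.\<close>
lemma monotone_self_map_fixpoint:
  assumes X: "finite_T0 X" and xs: "xs \<in> order_chains X (topspace X) n" "xs \<noteq> []"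
    and f: "\<And>x. x \<in> set xs \<Longrightarrow> f x \<in> set xs"
    and mono: "\<And>x y. x \<in> set xs \<Longrightarrow> y \<in> set xs \<Longrightarrow> spec_le X x y \<Longrightarrow> spec_le X (f x) (f y)"
  shows "\<exists>x\<in>set xs. f x = x"
proof -
  have order: "asymp_on A (spec_less X)" "transp_on A (spec_less X)" for A
    using spec_le_antisym[OF X] spec_le_trans[of X] unfolding asymp_on_def transp_on_def spec_less_def by blast+
  obtain b where b: "b \<in> set xs" "\<And>x. x \<in> set xs \<Longrightarrow> x \<noteq> b \<Longrightarrow> \<not> spec_less X x b"
    using Finite_Set.bex_min_element[OF finite_set order, of xs] xs(2) by auto
  let ?S = "{x \<in> set xs. spec_le X x (f x)}"
  have "b \<in> ?S"
    using order_chain_comparable[OF xs(1) order_refl b(1) f[OF b(1)]] b(2)[OF f[OF b(1)]] b(1)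
    by (cases "f b = b") (auto simp: spec_less_def)
  then have ne: "?S \<noteq> {}" by blast
  have fin: "finite ?S" by simp
  obtain m where m: "m \<in> ?S" "\<And>x. x \<in> ?S \<Longrightarrow> x \<noteq> m \<Longrightarrow> \<not> spec_less X m x"
    using Finite_Set.bex_max_element[OF fin order ne] by blast
  have "f m \<in> ?S" using m(1) f mono by blast
  then have "f m = m" using m by (auto simp: spec_less_def)
  then show ?thesis using m(1) by blast
qed

text \<open>The representatives of the factors compose to one of the composite. Since the Lefschetz number is
  nonzero, it has a nonzero diagonal entry, i.e. a chain \<open>xs\<close> with a monotone selection from \<open>xs\<close> to
  itself.\<close>
theorem theorem3:
  fixes X :: "'a topology" and F :: "'a \<Rightarrow> 'a set"
    and n :: nat and Y :: "nat \<Rightarrow> 'a topology" and G :: "nat \<Rightarrow> 'a \<Rightarrow> 'a set"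
  assumes "finite (topspace X)" and "t0_space X"
    and "multivalued_map X X F"
    and "Y 0 = X" and "Y (Suc n) = X"
    and "\<And>i. i \<le> Suc n \<Longrightarrow> finite (topspace (Y i)) \<and> t0_space (Y i)"
    and "\<And>i. i \<le> n \<Longrightarrow> vietoris_like_multimap (Y i) (Y (Suc i)) (G i)"
    and "\<And>x. x \<in> topspace X \<Longrightarrow> F x = multi_comp_upto G n x"
    and "lefschetz_number X (multi_induced_upto Y G n) \<noteq> 0"
  shows "\<exists>x\<in>topspace X. x \<in> F x"
proof -
  have Y: "finite_T0 (Y i)" if "i \<le> Suc n" for i using assms(6)[OF that] by (simp add: finite_T0_def)
  have X: "finite_T0 X" using assms(1,2) by (simp add: finite_T0_def)
  \<comment> \<open>\<open>\<eta>\<close> depends on the topology only, so that it is the same at both ends of the cycle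
    \<open>Y 0 = X = Y (Suc n)\<close>\<close>
  define \<eta> :: "'a topology \<Rightarrow> 'a list \<Rightarrow> 'a chain" where "\<eta> = (\<lambda>X. SOME \<eta>. mccord_map X \<eta>)"
  have \<eta>: "mccord_map X' (\<eta> X')" if "finite_T0 X'" for X'
    unfolding \<eta>_def using mccord_map_ex[OF that] by (rule someI_ex)
  have "\<exists>\<phi>. chain_representative X (Y (Suc m)) (\<eta> X) (\<eta> (Y (Suc m))) (multi_comp_upto G m)
      (multi_induced_upto Y G m) \<phi>" if "m \<le> n" for m
    using that
  proof (induction m)
    case 0
    have Y1: "finite_T0 (Y (Suc 0))" by (rule Y) simp
    have "vietoris_like_multimap X (Y (Suc 0)) (G 0)" using assms(7)[of 0] by (simp add: assms(4))
    from vietoris_multimap_chain_map[OF X Y1 this \<eta>[OF X] \<eta>[OF Y1]]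
    show ?case by (simp add: chain_representative_def assms(4))
  next
    case (Suc m)
    let ?Y = "Y (Suc m)" and ?Z = "Y (Suc (Suc m))"
    have fY: "finite_T0 ?Y" and fZ: "finite_T0 ?Z" using Y Suc.prems by auto
    obtain \<phi> where \<phi>: "chain_representative X ?Y (\<eta> X) (\<eta> ?Y) (multi_comp_upto G m)
        (multi_induced_upto Y G m) \<phi>"
      using Suc by auto
    obtain \<psi> where "chain_representative ?Y ?Z (\<eta> ?Y) (\<eta> ?Z) (G (Suc m))
        (\<lambda>k. multi_induced k ?Y ?Z (G (Suc m))) \<psi>"
      using vietoris_multimap_chain_map[OF fY fZ assms(7)[OF Suc.prems] \<eta>[OF fY] \<eta>[OF fZ]] by blast
    from chain_representative_compose[OF \<phi> this]
    show ?case by (auto simp: chain_representative_def)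
  qed
  from this[OF order_refl] obtain \<phi>
    where rep: "chain_representative X X (\<eta> X) (\<eta> X) (multi_comp_upto G n) (multi_induced_upto Y G n) \<phi>"
    unfolding assms(5) by blast
  have "(\<Sum>k\<le>card (topspace X). (-1) ^ k * trace_on (simplices X k) \<phi>) \<noteq> 0"
    using assms(9) unfolding lefschetz_number_chain_map[OF X \<eta>[OF X] rep] .
  then obtain k where "trace_on (simplices X k) \<phi> \<noteq> 0"
    by (metis (no_types, lifting) mult_zero_right sum.neutral)
  then obtain xs where xs: "xs \<in> simplices X k" "coef (\<phi> xs) xs \<noteq> 0"
    unfolding trace_on_def by (meson sum.neutral)
  have "xs \<in> order_lists X" using xs(1) by (auto simp: order_simplices_def order_lists_def)
  moreover have "xs \<in> supp (\<phi> xs)" using xs(2) by (simp add: in_keys_iff)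
  ultimately obtain f where f: "\<And>y. y \<in> set xs \<Longrightarrow> f y \<in> set xs \<and> y \<in> multi_comp_upto G n (f y)"
    and mono: "\<And>y y'. y \<in> set xs \<Longrightarrow> y' \<in> set xs \<Longrightarrow> spec_le X y y' \<Longrightarrow> spec_le X (f y) (f y')"
    using chain_representativeD(3)[OF rep, of xs xs] unfolding monotone_selection_def by blast
  have "xs \<noteq> []" using xs(1) by (auto simp: order_simplices_def)
  then obtain x where x: "x \<in> set xs" "f x = x"
    using monotone_self_map_fixpoint[OF X xs(1), of f] f mono by blast
  then have "x \<in> topspace X" using xs(1) by (auto simp: order_simplices_def)
  moreover have "x \<in> F x" using assms(8)[OF calculation] f[OF x(1)] x(2) by simp
  ultimately show ?thesis by blast
qed

end
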